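(* Let $h_1<\tilde h_1$ be positive integers. Let $T$ be the staircase transformation with height $h_1$ of the first tower and cutting sequence $r_j=j$, and let $\tilde T$ be the staircase transformation with height $\tilde h_1$ of the first tower and cutting sequence $\tilde r_j=j$. Then $T$ and $\tilde T$ are disjoint.
   Context: Staircase transformation with parameters $(h_1,\{r_j\})$: start with a tower (column) of $h_1$ disjoint intervals (levels) of equal length, on which the map sends each level except the top one to the next level by translation. Given the $j$-th tower of $h_j$ levels, cut it vertically into $r_j$ subcolumns of equal width, numbered $i=0,1,\dots,r_j-1$ from left to right. Place $i$ additional new levels (spacers, of the same width as the subcolumn levels) on top of the $i$-th subcolumn, and stack the subcolumns from left to right, each next one on top of the previous one. This gives the $(j+1)$-st tower, with $h_{j+1}=r_jh_j+r_j(r_j-1)/2$ levels. The staircase transformation is the limiting map on the union of all the towers, with Lebesgue measure normalized to a probability measure (the total measure is finite for $r_j=j$). Two automorphisms $\tilde T$ of $(\tilde X,\tilde\mu)$ and $T$ of $(X,\mu)$ are disjoint if $\tilde\mu\times\mu$ is the only $(\tilde T\times T)$-invariant measure on $\tilde X\times X$ with marginals $\tilde\mu$ and $\mu$. *)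

theory Defs
  imports "HOL-Analysis.Analysis"
begin

text \<open>
  Cutting and stacking is carried out on the half-line. Towers are numbered from 1; the equations at
  index 0 are dummies that repeat the first tower. The levels of the \<open>j\<close>-th tower are the intervals
  \<open>{a..<a + stair_width r j}\<close>, where \<open>a\<close> runs through the list \<open>stair_levels h1 r j\<close> of left
  endpoints, ordered from the bottom to the top of the tower. The levels of the first tower are
  \<open>[0,1), ..., [h1 - 1, h1)\<close>; the common length 1 is immaterial after normalization.
\<close>

fun stair_width :: "(nat \<Rightarrow> nat) \<Rightarrow> nat \<Rightarrow> real" where
  "stair_width r 0 = 1"
| "stair_width r (Suc 0) = 1"
| "stair_width r (Suc (Suc j)) = stair_width r (Suc j) / real (r (Suc j))"

text \<open>
  One step of the construction, for a tower with list of left endpoints \<open>as\<close> and width \<open>w\<close> that is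
  cut into \<open>q\<close> subcolumns of width \<open>w / q\<close>. The levels of the given tower fill the interval
  \<open>{0..<length as * w}\<close>, and the new spacers are laid out consecutively to the right of it.
  Subcolumns \<open>0, ..., i - 1\<close> use up \<open>0 + 1 + ... + (i - 1) = i * (i - 1) div 2\<close> of them.
\<close>

definition stair_subcolumn :: "nat \<Rightarrow> real \<Rightarrow> real list \<Rightarrow> nat \<Rightarrow> real list" where
  "stair_subcolumn q w as i =
     map (\<lambda>a. a + real i * (w / real q)) as @
     map (\<lambda>k. real (length as) * w + real (i * (i - 1) div 2 + k) * (w / real q)) [0..<i]"

definition stair_cut_stack :: "nat \<Rightarrow> real \<Rightarrow> real list \<Rightarrow> real list" where
  "stair_cut_stack q w as = concat (map (stair_subcolumn q w as) [0..<q])"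

fun stair_levels :: "nat \<Rightarrow> (nat \<Rightarrow> nat) \<Rightarrow> nat \<Rightarrow> real list" where
  "stair_levels h1 r 0 = map real [0..<h1]"
| "stair_levels h1 r (Suc 0) = map real [0..<h1]"
| "stair_levels h1 r (Suc (Suc j)) =
     stair_cut_stack (r (Suc j)) (stair_width r (Suc j)) (stair_levels h1 r (Suc j))"

lemma length_stair_cut_stack:
  "length (stair_cut_stack q w as) = q * length as + q * (q - 1) div 2"
proof -
  have "(\<Sum>i\<leftarrow>[0..<q]. length as + i) = q * length as + q * (q - 1) div 2"
  proof (induction q)
    case (Suc q)
    have "q * (q - 1) div 2 + q = Suc q * q div 2"
      by (cases q) auto
    with Suc show ?case by simp
  qed simp
  then show ?thesis
    by (simp add: stair_cut_stack_def stair_subcolumn_def length_concat comp_def)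
qed

definition stair_level :: "nat \<Rightarrow> (nat \<Rightarrow> nat) \<Rightarrow> nat \<Rightarrow> nat \<Rightarrow> real set" where
  "stair_level h1 r j k =
     {stair_levels h1 r j ! k ..< stair_levels h1 r j ! k + stair_width r j}"

definition staircase_space :: "nat \<Rightarrow> (nat \<Rightarrow> nat) \<Rightarrow> real set" where
  "staircase_space h1 r =
     (\<Union>j\<in>{1..}. \<Union>k<length (stair_levels h1 r j). stair_level h1 r j k)"

definition staircase_measure :: "nat \<Rightarrow> (nat \<Rightarrow> nat) \<Rightarrow> real measure" where
  "staircase_measure h1 r =
     uniform_measure (restrict_space lborel (staircase_space h1 r)) (staircase_space h1 r)"

text \<open>
  Every tower determines the map on all its levels except the top one. The translations coming from
  different towers agree where they are both defined, so the description below picks out a unique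
  value as soon as \<open>x\<close> lies below the top of some tower. If \<open>r j \<ge> 2\<close> for all \<open>j \<ge> 2\<close>, every point
  of the space does, because the top level of each tower from the third on is then a new spacer.
\<close>

definition staircase_map :: "nat \<Rightarrow> (nat \<Rightarrow> nat) \<Rightarrow> real \<Rightarrow> real" where
  "staircase_map h1 r x =
     (THE y. \<exists>j k. 1 \<le> j \<and> Suc k < length (stair_levels h1 r j) \<and> x \<in> stair_level h1 r j k \<and>
        y = x + (stair_levels h1 r j ! Suc k - stair_levels h1 r j ! k))"

definition joinings ::
    "'a measure \<Rightarrow> ('a \<Rightarrow> 'a) \<Rightarrow> 'b measure \<Rightarrow> ('b \<Rightarrow> 'b) \<Rightarrow> ('a \<times> 'b) measure set" where
  "joinings M S N T =
     {\<nu>. sets \<nu> = sets (M \<Otimes>\<^sub>M N) \<and>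
         map_prod S T \<in> measurable \<nu> \<nu> \<and> distr \<nu> \<nu> (map_prod S T) = \<nu> \<and>
         distr \<nu> M fst = M \<and> distr \<nu> N snd = N}"

definition disjoint_systems ::
    "'a measure \<Rightarrow> ('a \<Rightarrow> 'a) \<Rightarrow> 'b measure \<Rightarrow> ('b \<Rightarrow> 'b) \<Rightarrow> bool" where
  "disjoint_systems M S N T \<longleftrightarrow> joinings M S N T = {M \<Otimes>\<^sub>M N}"

end

theory Submission
  imports Defs "HOL-Probability.Probability_Measure"
begin

text \<open>
  At stage \<open>j\<close> the towers have heights \<open>(j - 1)! (h + e\<^sub>j / 2)\<close> and \<open>(j - 1)! (h' + e\<^sub>j / 2)\<close>, where \<open>e\<^sub>j\<close>
  is a partial sum of the series of \<open>e\<close>. As \<open>e\<close> is irrational and \<open>h \<noteq> h'\<close>, the ratio of the heights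
  tends to an irrational number (\<open>heights_incommensurable\<close>). The theorem follows from this and from
  the linear growth of the spacers.

  Reading a function along a tower from bottom to top gives a word, and the word of stage \<open>j + 1\<close>
  consists of \<open>j\<close> copies of the word of stage \<open>j\<close> separated by \<open>0, 1, ..., j - 1\<close> spacers. Let \<open>X\<close> be the
  words of the indicator of a level of the first system, and \<open>Y\<close> those of the centred indicator of
  a level of the second one. The heart of the proof is \<open>cross_correlation\<close>: the sum of
  \<open>X J p * Y J (p + s)\<close> over \<open>p\<close> is small compared with the height, uniformly in \<open>s\<close>, for large \<open>J\<close>.
  Given a joining, its mass on the product of level \<open>p\<close> and level \<open>q\<close> of the towers of stage \<open>J\<close>
  depends only on \<open>q - p\<close>, by invariance. So the deviation of the joining from the product measure on
  two given levels is a weighted sum of such correlations, up to the mass outside the towers, and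
  short diagonals have little mass because the marginals are prescribed (\<open>diagonal_estimate\<close>,
  \<open>independent_levels\<close>). Levels generate the sigma-algebra, hence the joining is the product.

  For \<open>cross_correlation\<close>, the van der Corput inequality applied to consecutive copies of \<open>X j\<close>
  eliminates \<open>X\<close> and leaves autocorrelations of \<open>Y (j + 1)\<close> at lags close to a bounded multiple of the
  height \<open>h'\<^sub>j\<close> of the other tower. By incommensurability, copies of \<open>Y j\<close> meet at such a lag with
  shifts comparable to their length. At these shifts autocorrelations are small
  (\<open>interval_correlation\<close>): copies number \<open>l\<close> and \<open>l + d\<close> of \<open>Y (j - 1)\<close> meet with shifts which, as \<open>l\<close>
  varies, form an arithmetic progression of step \<open>d < j\<close>, and averages of \<open>Y (j - 1)\<close> along such
  progressions are small in mean, uniformly in \<open>d\<close> (\<open>progression_average\<close>). The last assertion is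
  reduced, by van der Corput again, to autocorrelations at multiples of \<open>d\<close> that lie next to heights
  of towers somewhat taller than \<open>d\<close>. Near a height the decay is elementary (\<open>corr_near_height\<close>):
  consecutive copies meet with shifts that run through consecutive integers, and averages of \<open>Y\<close> over
  long windows are small in mean since \<open>Y\<close> is centred (\<open>window_bound_eventually\<close>).
\<close>

section \<open>Heights of the towers\<close>

text \<open>
  Subcolumns \<open>0, ..., k - 1\<close> carry \<open>0 + 1 + ... + (k - 1)\<close> spacers altogether.
\<close>

definition tri :: "nat \<Rightarrow> nat" where "tri k = k * (k - 1) div 2"

lemma double_tri: "2 * tri k = k * (k - 1)"
  unfolding tri_def by (cases k) auto

lemma tri_le_square: "tri k \<le> k ^ 2"
proof -
  have "2 * tri k \<le> k * k" unfolding double_tri by (simp add: mult_le_mono)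
  then show ?thesis by (simp add: power2_eq_square)
qed

lemma tri_Suc: "tri (Suc k) = tri k + k"
  using double_tri[of k] double_tri[of "Suc k"] by (cases k) (auto simp: algebra_simps)

lemma tri_add: "tri (k + d) = tri k + tri d + k * d"
  by (induction d) (auto simp: tri_Suc, auto simp: tri_def)

definition ht :: "nat \<Rightarrow> nat \<Rightarrow> nat" where
  "ht h j = length (stair_levels h (\<lambda>j. j) j)"

lemma ht_1 [simp]: "ht h (Suc 0) = h"
  by (simp add: ht_def)

lemma ht_Suc: "1 \<le> j \<Longrightarrow> ht h (Suc j) = j * ht h j + tri j"
  by (cases j) (auto simp: ht_def length_stair_cut_stack tri_def)

lemma ht_ge_fact:
  assumes "1 \<le> j" "0 < h"
  shows "fact (j - 1) \<le> ht h j"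
  using assms
proof (induction j rule: nat_induct_at_least)
  case base
  then show ?case by simp
next
  case (Suc j)
  then have "fact (Suc j - 1) = j * fact (j - 1)" by (cases j) auto
  also have "\<dots> \<le> j * ht h j" using Suc by (intro mult_le_mono2) auto
  also have "\<dots> \<le> ht h (Suc j)" using Suc by (simp add: ht_Suc)
  finally show ?case .
qed

lemma ht_pos: "0 < h \<Longrightarrow> 1 \<le> j \<Longrightarrow> 0 < ht h j"
  using ht_ge_fact[of j h] by (metis fact_gt_zero less_le_trans)

lemma ht_ge: "0 < h \<Longrightarrow> 1 \<le> j \<Longrightarrow> j - 1 \<le> ht h j"
  using ht_ge_fact[of j h] fact_ge_self[of "j - 1"] by linarith

lemma ht_Suc_ge: "1 \<le> j \<Longrightarrow> j * ht h j \<le> ht h (Suc j)"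
  by (simp add: ht_Suc)

lemma subcolumn_fits:
  assumes "1 \<le> j" "k < j"
  shows "k * ht h j + tri k + ht h j \<le> ht h (Suc j)"
proof -
  have "tri k \<le> tri j" using tri_add[of k "j - k"] assms(2) by simp
  moreover have "k * ht h j + ht h j \<le> j * ht h j"
    using assms(2) by (metis Suc_leI add.commute mult_Suc mult_le_mono1)
  ultimately show ?thesis using ht_Suc[OF assms(1), of h] by simp
qed

lemma ht_Suc_le: "0 < h \<Longrightarrow> 1 \<le> j \<Longrightarrow> ht h (Suc j) \<le> 2 * j * ht h j"
proof -
  assume h: "0 < h" "1 \<le> j"
  have "2 * tri j \<le> j * (2 * ht h j)"
    unfolding double_tri using ht_ge[OF h] by (intro mult_le_mono2) auto
  then have "tri j \<le> j * ht h j" by simp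
  then show ?thesis using h by (simp add: ht_Suc)
qed

lemma ht_growth: "0 < h \<Longrightarrow> 1 \<le> p \<Longrightarrow> ht h (p + M) \<le> (2 * (p + M)) ^ M * ht h p"
proof (induction M)
  case (Suc M)
  have "ht h (p + Suc M) \<le> 2 * (p + M) * ht h (p + M)"
    using ht_Suc_le[of h "p + M"] Suc.prems by simp
  also have "\<dots> \<le> 2 * (p + M) * ((2 * (p + M)) ^ M * ht h p)"
    using Suc by (intro mult_le_mono2) auto
  also have "\<dots> \<le> (2 * (p + Suc M)) * ((2 * (p + Suc M)) ^ M * ht h p)"
    by (intro mult_le_mono power_mono) auto
  finally show ?case by (simp only: power_Suc mult.assoc)
qed simp

lemma ht_mono:
  assumes "i \<le> j" "1 \<le> i"
  shows "ht h i \<le> ht h j"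
  using assms
proof (induction j rule: dec_induct)
  case (step j)
  then have "ht h j \<le> j * ht h j" by (cases j) auto
  also have "\<dots> \<le> ht h (Suc j)" using step by (intro ht_Suc_ge) auto
  finally show ?case using step by auto
qed simp

lemma ht_mono_base: "1 \<le> j \<Longrightarrow> h \<le> h' \<Longrightarrow> ht h j \<le> ht h' j"
proof -
  assume j: "1 \<le> j" and h: "h \<le> h'"
  from j show ?thesis
  proof (induction j rule: nat_induct_at_least)
    case (Suc j)
    then show ?case by (simp add: ht_Suc)
  qed (use h in simp)
qed

lemma ht_le_mult:
  assumes "1 \<le> j" "0 < h"
  shows "ht h' j \<le> (h' + 1) * ht h j"
  using assms
proof (induction j rule: nat_induct_at_least)
  case base
  then show ?case by (cases h) auto
next
  case (Suc j)
  then have "ht h' (Suc j) = j * ht h' j + tri j" by (simp add: ht_Suc)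
  also have "\<dots> \<le> j * ((h' + 1) * ht h j) + (h' + 1) * tri j"
    using Suc by (intro add_mono mult_le_mono2) auto
  also have "\<dots> = (h' + 1) * ht h (Suc j)"
    using Suc by (simp add: ht_Suc algebra_simps)
  finally show ?case .
qed

text \<open>
  Each stage multiplies the height at least by the index of the stage. Spacer counts are bounded by
  powers of the index, so they are all negligible against the heights.
\<close>

lemma power_over_ht:
  assumes "0 < h"
  shows "(\<lambda>j. real j ^ k / real (ht h j)) \<longlonglongrightarrow> 0"
proof (induction k)
  case 0
  have "norm (1 / real (ht h (j + 2))) \<le> inverse (real (Suc j))" for j
  proof -
    have "Suc j \<le> ht h (j + 2)" using ht_ge[OF assms, of "j + 2"] by simp
    then have "real (Suc j) \<le> real (ht h (j + 2))" by (simp only: of_nat_le_iff)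
    then have "inverse (real (ht h (j + 2))) \<le> inverse (real (Suc j))"
      by (rule le_imp_inverse_le) simp
    then show ?thesis by (simp add: inverse_eq_divide)
  qed
  then have "(\<lambda>j. 1 / real (ht h (j + 2))) \<longlonglongrightarrow> 0"
    by (rule Lim_null_comparison[OF always_eventually[OF allI] LIMSEQ_inverse_real_of_nat])
  then have "(\<lambda>j. 1 / real (ht h j)) \<longlonglongrightarrow> 0"
    by (rule LIMSEQ_offset)
  then show ?case by simp
next
  case (Suc k)
  have bound: "norm (real (Suc j) ^ Suc k / real (ht h (Suc j)))
      \<le> 2 ^ Suc k * (real j ^ k / real (ht h j))" if "1 \<le> j" for j
  proof -
    have p: "0 < real (ht h j)" using ht_pos[OF assms that] by simp
    have "real (j * ht h j) \<le> real (ht h (Suc j))"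
      using ht_Suc_ge[OF that] of_nat_le_iff by blast
    then have a: "real j * real (ht h j) \<le> real (ht h (Suc j))" by simp
    have "real (Suc j) ^ Suc k \<le> (2 * real j) ^ Suc k"
      using that by (intro power_mono) auto
    also have "\<dots> = 2 ^ Suc k * real j ^ k * real j" by (simp add: power_mult_distrib)
    finally have "real (Suc j) ^ Suc k / real (ht h (Suc j))
        \<le> (2 ^ Suc k * real j ^ k * real j) / (real j * real (ht h j))"
      using a p that by (intro frac_le) auto
    also have "\<dots> = 2 ^ Suc k * (real j ^ k / real (ht h j))"
      using that by simp
    finally show ?thesis by simp
  qed
  have "(\<lambda>j. 2 ^ Suc k * (real j ^ k / real (ht h j))) \<longlonglongrightarrow> 0"
    using tendsto_mult_right_zero[OF Suc.IH] by simp
  then have "(\<lambda>j. real (Suc j) ^ Suc k / real (ht h (Suc j))) \<longlonglongrightarrow> 0"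
  proof (rule Lim_null_comparison[rotated])
    show "\<forall>\<^sub>F j in sequentially. norm (real (Suc j) ^ Suc k / real (ht h (Suc j)))
      \<le> 2 ^ Suc k * (real j ^ k / real (ht h j))"
      using eventually_ge_at_top[of 1] by eventually_elim (rule bound)
  qed
  then show ?case
    by (rule filterlim_sequentially_Suc[THEN iffD1])
qed

lemma power_le_ht:
  assumes "0 < h" "0 < e"
  shows "\<forall>\<^sub>F j in sequentially. c * real j ^ k \<le> e * real (ht h j)"
proof -
  have "(\<lambda>j. c * (real j ^ k / real (ht h j))) \<longlonglongrightarrow> 0"
    using tendsto_mult_right_zero[OF power_over_ht[OF assms(1)]] .
  then have "\<forall>\<^sub>F j in sequentially. c * (real j ^ k / real (ht h j)) < e"
    using assms(2) by (rule order_tendstoD)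
  then show ?thesis
  proof (rule eventually_elim2[OF _ eventually_ge_at_top[of 1]])
    fix j :: nat assume a: "c * (real j ^ k / real (ht h j)) < e" "1 \<le> j"
    then have "0 < real (ht h j)" using ht_pos assms by simp
    then show "c * real j ^ k \<le> e * real (ht h j)"
      using a(1) by (simp add: field_simps)
  qed
qed

section \<open>The ratio of the heights\<close>

text \<open>
  The spacers added at stage \<open>i + 2\<close> contribute \<open>1 / (2 i!)\<close> after division by the factorial; this is
  how the number \<open>e\<close> enters.
\<close>

lemma ht_over_fact:
  "real (ht h (j + 2)) / fact (j + 1) = real h + (\<Sum>i<j. 1 / fact i) / 2"
proof (induction j)
  case 0
  show ?case by (simp add: ht_Suc numeral_2_eq_2 tri_def)
next
  case (Suc j)
  have t: "real (tri (j + 2)) = real (j + 2) * real (j + 1) / 2"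
  proof -
    have "real (2 * tri (j + 2)) = real ((j + 2) * (j + 1))" unfolding double_tri by simp
    then show ?thesis unfolding of_nat_mult by simp
  qed
  have "real (ht h (Suc j + 2)) / fact (Suc j + 1)
      = (real (j + 2) * real (ht h (j + 2)) + real (tri (j + 2))) / (real (j + 2) * fact (j + 1))"
    using ht_Suc[of "j + 2" h] by (simp add: algebra_simps)
  also have "\<dots> = real (ht h (j + 2)) / fact (j + 1) + real (tri (j + 2)) / (real (j + 2) * fact (j + 1))"
    by (simp add: add_divide_distrib del: fact_Suc)
  also have "real (tri (j + 2)) / (real (j + 2) * fact (j + 1)) = 1 / fact j / 2"
    unfolding t by (simp add: divide_simps)
  finally show ?case using Suc by (simp add: add_divide_distrib)
qed

lemma ht_over_fact_tendsto:
  "(\<lambda>j. real (ht h (Suc j)) / fact j) \<longlonglongrightarrow> real h + exp 1 / 2"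
proof -
  have "(\<lambda>i. 1 / fact i :: real) sums exp 1"
    using exp_converges[of "1::real"] by (simp add: inverse_eq_divide)
  then have "(\<lambda>j. real h + (\<Sum>i<j. 1 / fact i) / 2) \<longlonglongrightarrow> real h + exp 1 / 2"
    unfolding sums_def by (intro tendsto_intros) auto
  then have "(\<lambda>j. real (ht h (j + 2)) / fact (j + 1)) \<longlonglongrightarrow> real h + exp 1 / 2"
    unfolding ht_over_fact .
  then show ?thesis
    by (intro LIMSEQ_offset[of "\<lambda>j. real (ht h (Suc j)) / fact j" 1]) (simp del: fact_Suc)
qed

text \<open>
  If \<open>e\<close> were rational with denominator \<open>q - 1\<close>, then \<open>q!\<close> times the tail of the exponential series
  after the term of index \<open>q\<close> would be an integer strictly between 0 and 1.
\<close>

lemma exp_1_irrational: "exp 1 \<notin> (\<rat> :: real set)"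
proof
  assume "exp 1 \<in> (\<rat> :: real set)"
  then obtain a b :: int where ab: "b > 0" "exp 1 = real_of_int a / real_of_int b"
    by (auto elim: Rats_cases')
  define q where "q = nat b + 1"
  have q: "q \<ge> 2" "exp 1 = real_of_int a / real (q - 1)" using ab by (auto simp: q_def)
  define s where "s = (\<lambda>k. 1 / fact k :: real)"
  have s: "s sums exp 1"
    using exp_converges[of "1::real"] by (simp add: inverse_eq_divide s_def)
  define T where "T = (\<Sum>k. s (k + Suc q))"
  have T: "exp 1 = (\<Sum>k<Suc q. s k) + T"
    using suminf_split_initial_segment[OF sums_summable[OF s], of "Suc q"] sums_unique[OF s]
    by (simp add: T_def)
  have sT: "summable (\<lambda>k. s (k + Suc q))"
    using sums_summable[OF s] by (rule summable_ignore_initial_segment)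
  have "0 < T" unfolding T_def by (rule suminf_pos[OF sT]) (simp add: s_def)
  have dom: "s (k + Suc q) \<le> (1 / 2) ^ k * (1 / fact (Suc q))" for k
  proof (induction k)
    case (Suc k)
    have "s (Suc k + Suc q) = 1 / real (Suc k + Suc q) * s (k + Suc q)"
      by (simp add: s_def)
    also have "\<dots> \<le> 1 / 2 * ((1 / 2) ^ k * (1 / fact (Suc q)))"
      using q(1) by (intro mult_mono Suc) (auto simp: s_def divide_simps)
    finally show ?case by simp
  qed (simp add: s_def)
  have g: "(\<lambda>k. (1 / 2) ^ k * (1 / fact (Suc q)) :: real) sums (2 * (1 / fact (Suc q)))"
    using sums_mult2[OF geometric_sums[of "1 / 2 :: real"], of "1 / fact (Suc q)"] by simp
  have "T \<le> 2 * (1 / fact (Suc q))"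
    unfolding T_def using suminf_le[OF dom sT sums_summable[OF g]] sums_unique[OF g] by simp
  then have "fact q * T \<le> fact q * (2 * (1 / fact (Suc q)))" by (intro mult_left_mono) auto
  also have "\<dots> = 2 / real (Suc q)" by (simp add: divide_simps)
  also have "\<dots> < 1" using q(1) by simp
  finally have lt: "fact q * T < 1" .
  have "fact q * s k \<in> \<int>" if "k < Suc q" for k
  proof -
    have "fact k dvd (fact q :: nat)" using that by (intro fact_dvd) auto
    then obtain c where "fact q = fact k * (c::nat)" by (rule dvdE)
    then have "(fact q :: real) = fact k * real c" by (metis of_nat_fact of_nat_mult)
    then show ?thesis by (simp add: s_def)
  qed
  then have "(\<Sum>k<Suc q. fact q * s k) \<in> \<int>" by (intro Ints_sum) auto
  then have i1: "fact q * (\<Sum>k<Suc q. s k) \<in> \<int>" by (simp only: sum_distrib_left)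
  have "(q - 1) dvd (fact q :: nat)" using q(1) by (intro dvd_fact) auto
  then obtain c where "fact q = (q - 1) * (c::nat)" by (rule dvdE)
  then have "(fact q :: real) = real (q - 1) * real c" by (metis of_nat_fact of_nat_mult)
  then have "fact q * exp 1 = real_of_int a * real c" using q by simp
  then have "fact q * exp 1 \<in> (\<int> :: real set)" by simp
  then have "fact q * T \<in> \<int>" using i1 T
    by (metis Ints_diff add_diff_cancel_left' distrib_left)
  then obtain z where z: "fact q * T = real_of_int z" by (auto elim: Ints_cases)
  have "0 < fact q * T" using \<open>0 < T\<close> by simp
  then show False using lt unfolding z by simp
qed

lemma ratio_irrational:
  assumes "(h::nat) \<noteq> h'" "D \<noteq> (0::nat)"
  shows "real D * ((real h' + exp 1 / 2) / (real h + exp 1 / 2)) \<notin> \<int>"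
proof
  assume "real D * ((real h' + exp 1 / 2) / (real h + exp 1 / 2)) \<in> \<int>"
  then obtain z where z: "real D * ((real h' + exp 1 / 2) / (real h + exp 1 / 2)) = real_of_int z"
    by (auto elim: Ints_cases)
  have pos: "real h + exp 1 / 2 > 0" by (simp add: add_nonneg_pos)
  then have eq: "real D * (real h' + exp 1 / 2) = real_of_int z * (real h + exp 1 / 2)"
    using z by (simp add: field_simps)
  then have eq2: "(real D - real_of_int z) * exp 1 = 2 * (real_of_int z * real h - real D * real h')"
    by (simp add: algebra_simps)
  show False
  proof (cases "real D = real_of_int z")
    case True
    then show False using eq2 assms by simp
  next
    case False
    then have "exp 1 = 2 * (real_of_int z * real h - real D * real h') / (real D - real_of_int z)"
      using eq2 by (simp add: field_simps)
    also have "\<dots> \<in> \<rat>" by (intro Rats_divide Rats_mult Rats_diff) auto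
    finally show False using exp_1_irrational by simp
  qed
qed

lemma away_from_integers:
  fixes a :: "nat \<Rightarrow> real"
  assumes "a \<longlonglongrightarrow> x" "x \<notin> \<int>"
  obtains d where "0 < d" "\<forall>\<^sub>F j in sequentially. \<forall>e::int. d \<le> \<bar>a j - e\<bar>"
proof
  define d where "d = min (frac x) (1 - frac x) / 2"
  show "0 < d" using assms(2) frac_lt_1[of x] frac_ge_0[of x] frac_eq_0_iff[of x]
    by (auto simp: d_def)
  then have "\<forall>\<^sub>F j in sequentially. dist (a j) x < d" using assms(1) by (rule tendstoD[rotated])
  then show "\<forall>\<^sub>F j in sequentially. \<forall>e::int. d \<le> \<bar>a j - e\<bar>"
  proof eventually_elim
    case (elim j)
    show ?case
    proof
      fix e :: int
      have "2 * d \<le> \<bar>x - e\<bar>"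
      proof (cases "e \<le> \<lfloor>x\<rfloor>")
        case True
        then have "real_of_int e \<le> of_int \<lfloor>x\<rfloor>" by simp
        then show ?thesis by (auto simp: d_def frac_def min_def)
      next
        case False
        then have "real_of_int e \<ge> of_int \<lfloor>x\<rfloor> + 1" by linarith
        then show ?thesis by (auto simp: d_def frac_def min_def)
      qed
      then show "d \<le> \<bar>a j - e\<bar>" using elim unfolding dist_real_def by linarith
    qed
  qed
qed

text \<open>
  The ratio of the two heights tends to an irrational number, so no bounded positive multiple of
  \<open>ht h' j\<close> comes close to a multiple of \<open>ht h j\<close>. Two staircases with equal first heights would
  violate this already for \<open>D = 1\<close>, and indeed the diagonal joining is then not a product.
\<close>

lemma heights_incommensurable:
  assumes "0 < h" "h \<noteq> h'"
  shows "\<exists>d>0. \<forall>\<^sub>F j in sequentially. \<forall>D\<in>{1..R}. \<forall>e::int.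
    d * real (ht h j) \<le> \<bar>real D * real (ht h' j) - e * real (ht h j)\<bar>"
proof (induction R)
  case 0
  show ?case by (auto intro: exI[of _ 1])
next
  case (Suc R)
  then obtain d1 where d1: "0 < d1" and ev1: "\<forall>\<^sub>F j in sequentially. \<forall>D\<in>{1..R}. \<forall>e::int.
    d1 * real (ht h j) \<le> \<bar>real D * real (ht h' j) - e * real (ht h j)\<bar>" by blast
  let ?a = "\<lambda>j. real (Suc R) * ((real (ht h' j)) / (real (ht h j)))"
  have "(\<lambda>j. real (Suc R) * ((real (ht h' (Suc j)) / fact j) / (real (ht h (Suc j)) / fact j)))
      \<longlonglongrightarrow> real (Suc R) * ((real h' + exp 1 / 2) / (real h + exp 1 / 2))"
    by (intro tendsto_intros ht_over_fact_tendsto) (simp add: add_nonneg_eq_0_iff)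
  then have "(\<lambda>j. ?a (Suc j)) \<longlonglongrightarrow> real (Suc R) * ((real h' + exp 1 / 2) / (real h + exp 1 / 2))"
    by (simp add: divide_simps)
  then have "?a \<longlonglongrightarrow> real (Suc R) * ((real h' + exp 1 / 2) / (real h + exp 1 / 2))"
    by (subst (asm) filterlim_sequentially_Suc)
  then obtain d2 where d2: "0 < d2" and ev2: "\<forall>\<^sub>F j in sequentially. \<forall>e::int. d2 \<le> \<bar>?a j - e\<bar>"
    using away_from_integers ratio_irrational[OF assms(2), of "Suc R"] by blast
  define d where "d = min d1 d2"
  have "\<forall>\<^sub>F j in sequentially. \<forall>D\<in>{1..Suc R}. \<forall>e::int.
    d * real (ht h j) \<le> \<bar>real D * real (ht h' j) - e * real (ht h j)\<bar>"
    using ev1 ev2 eventually_ge_at_top[of 1]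
  proof eventually_elim
    case (elim j)
    have p: "0 < real (ht h j)" using ht_pos[OF assms(1)] elim(3) by simp
    show ?case
    proof (intro ballI allI)
      fix D e assume D: "D \<in> {1..Suc R}"
      show "d * real (ht h j) \<le> \<bar>real D * real (ht h' j) - real_of_int e * real (ht h j)\<bar>"
      proof (cases "D = Suc R")
        case True
        have "d \<le> d2" by (simp add: d_def)
        also have "d2 \<le> \<bar>?a j - e\<bar>" using elim(2) by (rule spec)
        finally have "d * real (ht h j) \<le> \<bar>?a j - e\<bar> * real (ht h j)"
          using p by (intro mult_right_mono) simp_all
        also have "\<dots> = \<bar>(?a j - e) * real (ht h j)\<bar>" using p by (simp add: abs_mult)
        also have "(?a j - e) * real (ht h j) = real D * real (ht h' j) - real_of_int e * real (ht h j)"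
          using p True by (simp add: field_simps)
        finally show ?thesis .
      next
        case False
        have "d * real (ht h j) \<le> d1 * real (ht h j)"
          by (intro mult_right_mono) (auto simp: d_def)
        also have "\<dots> \<le> \<bar>real D * real (ht h' j) - real_of_int e * real (ht h j)\<bar>"
          using elim(1) D False by (metis atLeastAtMost_iff le_SucE)
        finally show ?thesis .
      qed
    qed
  qed
  moreover have "0 < d" using d1 d2 by (simp add: d_def)
  ultimately show ?case by blast
qed

section \<open>Words along the towers\<close>

text \<open>
  The position, within tower \<open>j + 1\<close>, at which the copy of tower \<open>j\<close> in subcolumn \<open>k\<close> starts. The
  quadratic term makes the distance of copies \<open>k\<close> and \<open>k + d\<close> depend linearly on \<open>k\<close> with slope \<open>d\<close>.
\<close>

definition pos :: "nat \<Rightarrow> nat \<Rightarrow> nat \<Rightarrow> int" where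
  "pos h j k = int (k * ht h j + tri k)"

lemma pos_add: "pos h j (k + d) = pos h j k + int d * int (ht h j) + int (tri d) + int k * int d"
  by (simp add: pos_def tri_add algebra_simps)

lemma pos_nonneg: "0 \<le> pos h j k"
  by (simp add: pos_def)

lemma pos_plus_ht_le:
  assumes "1 \<le> j" "k < j"
  shows "pos h j k + int (ht h j) \<le> int (ht h (Suc j))"
  using subcolumn_fits[OF assms, of h]
  unfolding pos_def by (simp only: of_nat_add[symmetric] of_nat_le_iff)

text \<open>
  The word \<open>Y j\<close> lists the values of a function on the levels of tower \<open>j\<close> from bottom to top, where
  the function is constant on levels from stage \<open>m\<close> on; the set \<open>Z\<close> holds the positions of the
  spacers. Words are extended by zero to all integers, so that translates can be added and
  correlated without boundary terms. Values at spacers are arbitrary because there are few of them.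
\<close>

locale staircase_word =
  fixes h m :: nat and Y :: "nat \<Rightarrow> int \<Rightarrow> real"
  assumes h_pos: "0 < h" and m_ge: "1 \<le> m"
    and bounded: "\<bar>Y j n\<bar> \<le> 1"
    and support: "m \<le> j \<Longrightarrow> Y j n \<noteq> 0 \<Longrightarrow> 0 \<le> n \<and> n < int (ht h j)"
    and stacking: "m \<le> j \<Longrightarrow> \<exists>Z. finite Z \<and> card Z \<le> j ^ 2 \<and>
      (\<forall>n. if n \<in> Z then (\<Sum>k<j. Y j (n - pos h j k)) = 0
           else Y (Suc j) n = (\<Sum>k<j. Y j (n - pos h j k)))"
begin

lemma ht_real_pos: "m \<le> j \<Longrightarrow> 0 < real (ht h j)"
  using ht_pos[OF h_pos] m_ge by simp

lemma block_sum_bounded: "m \<le> j \<Longrightarrow> \<bar>\<Sum>k<j. Y j (n - pos h j k)\<bar> \<le> 1"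
  using stacking[of j] bounded by (metis abs_zero zero_le_one)

lemma spacer_error:
  assumes "m \<le> j" "finite S"
  shows "(\<Sum>n\<in>S. \<bar>Y (Suc j) (n + c) - (\<Sum>k<j. Y j (n + c - pos h j k))\<bar>) \<le> real (j ^ 2)"
proof -
  obtain Z where Z: "finite Z" "card Z \<le> j ^ 2"
    "\<And>n. if n \<in> Z then (\<Sum>k<j. Y j (n - pos h j k)) = 0
           else Y (Suc j) n = (\<Sum>k<j. Y j (n - pos h j k))"
    using stacking[OF assms(1)] by blast
  have "(\<Sum>n\<in>S. \<bar>Y (Suc j) (n + c) - (\<Sum>k<j. Y j (n + c - pos h j k))\<bar>)
      \<le> (\<Sum>n\<in>S. if n + c \<in> Z then 1 else 0)"
    using Z(3) bounded by (intro sum_mono) (auto split: if_splits simp: if_split)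
  also have "\<dots> = real (card {n \<in> S. n + c \<in> Z})"
    using assms(2) by (simp add: sum.If_cases Int_def)
  also have "card {n \<in> S. n + c \<in> Z} \<le> card Z"
    by (rule card_inj_on_le[of "\<lambda>n. n + c"]) (auto intro: Z inj_onI)
  finally show ?thesis using Z(2) by linarith
qed

lemma expand_left:
  assumes "m \<le> j" "finite S" "\<And>n. \<bar>u n\<bar> \<le> 1"
  shows "\<bar>(\<Sum>n\<in>S. Y (Suc j) (n + c) * u n) - (\<Sum>l<j. \<Sum>n\<in>S. Y j (n + c - pos h j l) * u n)\<bar>
    \<le> real (j ^ 2)"
proof -
  have "(\<Sum>n\<in>S. Y (Suc j) (n + c) * u n) - (\<Sum>l<j. \<Sum>n\<in>S. Y j (n + c - pos h j l) * u n)
      = (\<Sum>n\<in>S. (Y (Suc j) (n + c) - (\<Sum>k<j. Y j (n + c - pos h j k))) * u n)"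
    by (subst sum.swap) (simp add: sum_subtractf left_diff_distrib sum_distrib_right)
  also have "\<bar>\<dots>\<bar> \<le> (\<Sum>n\<in>S. \<bar>(Y (Suc j) (n + c) - (\<Sum>k<j. Y j (n + c - pos h j k))) * u n\<bar>)"
    by (rule sum_abs)
  also have "\<dots> \<le> (\<Sum>n\<in>S. \<bar>Y (Suc j) (n + c) - (\<Sum>k<j. Y j (n + c - pos h j k))\<bar>)"
    using assms(3) by (intro sum_mono) (simp add: abs_mult mult_left_le)
  also have "\<dots> \<le> real (j ^ 2)" by (rule spacer_error[OF assms(1,2)])
  finally show ?thesis .
qed

lemma expand_both:
  assumes "m \<le> j" "finite S"
  shows "\<bar>(\<Sum>n\<in>S. Y (Suc j) (n + a) * Y (Suc j) (n + b))
      - (\<Sum>l<j. \<Sum>l'<j. \<Sum>n\<in>S. Y j (n + a - pos h j l) * Y j (n + b - pos h j l'))\<bar>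
    \<le> 2 * real (j ^ 2)"
proof -
  have 1: "\<bar>(\<Sum>n\<in>S. Y (Suc j) (n + a) * Y (Suc j) (n + b))
      - (\<Sum>l<j. \<Sum>n\<in>S. Y j (n + a - pos h j l) * Y (Suc j) (n + b))\<bar> \<le> real (j ^ 2)"
    by (rule expand_left[OF assms bounded])
  have 2: "\<bar>(\<Sum>n\<in>S. Y (Suc j) (n + b) * (\<Sum>l<j. Y j (n + a - pos h j l)))
     - (\<Sum>l'<j. \<Sum>n\<in>S. Y j (n + b - pos h j l') * (\<Sum>l<j. Y j (n + a - pos h j l)))\<bar> \<le> real (j ^ 2)"
    by (rule expand_left[OF assms block_sum_bounded[OF assms(1)]])
  have 3: "(\<Sum>n\<in>S. Y (Suc j) (n + b) * (\<Sum>l<j. Y j (n + a - pos h j l)))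
      = (\<Sum>l<j. \<Sum>n\<in>S. Y j (n + a - pos h j l) * Y (Suc j) (n + b))"
    unfolding sum.swap[of _ S "{..<j}"] by (simp add: sum_distrib_left mult.commute)
  have "(\<Sum>l'<j. \<Sum>n\<in>S. Y j (n + b - pos h j l') * (\<Sum>l<j. Y j (n + a - pos h j l)))
      = (\<Sum>l'<j. \<Sum>n\<in>S. \<Sum>l<j. Y j (n + a - pos h j l) * Y j (n + b - pos h j l'))"
    by (simp add: sum_distrib_left mult.commute)
  also have "\<dots> = (\<Sum>l'<j. \<Sum>l<j. \<Sum>n\<in>S. Y j (n + a - pos h j l) * Y j (n + b - pos h j l'))"
    by (intro sum.cong refl sum.swap)
  also have "\<dots> = (\<Sum>l<j. \<Sum>l'<j. \<Sum>n\<in>S. Y j (n + a - pos h j l) * Y j (n + b - pos h j l'))"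
    by (rule sum.swap)
  finally show ?thesis using 1 2 3 by linarith
qed

definition corr :: "nat \<Rightarrow> int \<Rightarrow> real" where
  "corr i x = (\<Sum>n\<in>{0..<int (ht h i)}. Y i n * Y i (n + x))"

lemma corr_eq:
  assumes "m \<le> i" "finite S" "\<And>n. 0 \<le> n + a \<Longrightarrow> n + a < int (ht h i) \<Longrightarrow> n \<in> S"
  shows "(\<Sum>n\<in>S. Y i (n + a) * Y i (n + b)) = corr i (b - a)"
proof -
  have "(\<Sum>n\<in>S. Y i (n + a) * Y i (n + b)) = (\<Sum>n\<in>(\<lambda>n. n + a) ` S. Y i n * Y i (n + (b - a)))"
    by (subst sum.reindex) (auto simp: inj_on_def algebra_simps)
  also have "\<dots> = corr i (b - a)"
    unfolding corr_def
  proof (rule sum.mono_neutral_right)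
    show "{0..<int (ht h i)} \<subseteq> (\<lambda>n. n + a) ` S"
    proof
      fix n assume "n \<in> {0..<int (ht h i)}"
      then have "n - a \<in> S" using assms(3)[of "n - a"] by simp
      then show "n \<in> (\<lambda>n. n + a) ` S" by (intro image_eqI[of _ _ "n - a"]) auto
    qed
  qed (use assms(2) support[OF assms(1)] in force)+
  finally show ?thesis .
qed

lemma corr_le_overlap:
  assumes "m \<le> i"
  shows "\<bar>corr i x\<bar> \<le> max 0 (real (ht h i) - real_of_int \<bar>x\<bar>)"
proof -
  have "corr i x = (\<Sum>n\<in>{max 0 (-x)..<min (int (ht h i)) (int (ht h i) - x)}. Y i n * Y i (n + x))"
    unfolding corr_def
  proof (rule sum.mono_neutral_right)
    show "\<forall>n\<in>{0..<int (ht h i)} - {max 0 (-x)..<min (int (ht h i)) (int (ht h i) - x)}.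
        Y i n * Y i (n + x) = 0"
      using support[OF assms] by fastforce
  qed simp_all
  then have "\<bar>corr i x\<bar> \<le> (\<Sum>n\<in>{max 0 (-x)..<min (int (ht h i)) (int (ht h i) - x)}. \<bar>Y i n * Y i (n + x)\<bar>)"
    using sum_abs by metis
  also have "\<dots> \<le> (\<Sum>n\<in>{max 0 (-x)..<min (int (ht h i)) (int (ht h i) - x)}. 1)"
    using bounded by (intro sum_mono) (simp add: abs_mult mult_le_one)
  also have "\<dots> \<le> max 0 (real (ht h i) - real_of_int \<bar>x\<bar>)"
    by simp
  finally show ?thesis .
qed

lemma corr_eq_0:
  assumes "m \<le> i" "int (ht h i) \<le> \<bar>x\<bar>"
  shows "corr i x = 0"
  using corr_le_overlap[OF assms(1), of x] assms(2) by linarith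

section \<open>Unique ergodicity in mean\<close>

text \<open>
  The finite set of starting points is arbitrary in order to make the bound invariant under
  translation; it stands for a sum over all integers.
\<close>

definition window_bound :: "nat \<Rightarrow> nat \<Rightarrow> real \<Rightarrow> bool" where
  "window_bound i w B \<longleftrightarrow> (\<forall>S. finite S \<longrightarrow> (\<Sum>n\<in>S. \<bar>\<Sum>k<w. Y i (n - int k)\<bar>) \<le> B)"

text \<open>
  A word is the sum of translates of the previous word and a few spacers, so the triangle inequality
  transfers the bound to the next stage. An average in mean is used because no pointwise bound can
  hold: windows inside a run of spacers exist at every stage.
\<close>

lemma window_bound_Suc:
  assumes "m \<le> i" "window_bound i w B"
  shows "window_bound (Suc i) w (real i * B + real w * real (i ^ 2))"
  unfolding window_bound_def
proof (intro allI impI)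
  fix S :: "int set" assume S: "finite S"
  let ?P = "\<lambda>n. \<Sum>l<i. Y i (n - pos h i l)"
  have "(\<Sum>n\<in>S. \<bar>\<Sum>k<w. Y (Suc i) (n - int k)\<bar>)
      \<le> (\<Sum>n\<in>S. (\<Sum>l<i. \<bar>\<Sum>k<w. Y i ((n - pos h i l) - int k)\<bar>)
           + (\<Sum>k<w. \<bar>Y (Suc i) (n - int k) - ?P (n - int k)\<bar>))"
  proof (rule sum_mono)
    fix n
    have "(\<Sum>k<w. Y (Suc i) (n - int k))
        = (\<Sum>k<w. ?P (n - int k)) + (\<Sum>k<w. Y (Suc i) (n - int k) - ?P (n - int k))"
      by (simp add: sum_subtractf)
    also have "(\<Sum>k<w. ?P (n - int k)) = (\<Sum>l<i. \<Sum>k<w. Y i ((n - pos h i l) - int k))"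
      by (subst sum.swap) (simp add: algebra_simps)
    finally have "\<bar>\<Sum>k<w. Y (Suc i) (n - int k)\<bar> \<le> \<bar>\<Sum>l<i. \<Sum>k<w. Y i ((n - pos h i l) - int k)\<bar>
       + \<bar>\<Sum>k<w. Y (Suc i) (n - int k) - ?P (n - int k)\<bar>" by linarith
    also have "\<dots> \<le> (\<Sum>l<i. \<bar>\<Sum>k<w. Y i ((n - pos h i l) - int k)\<bar>)
           + (\<Sum>k<w. \<bar>Y (Suc i) (n - int k) - ?P (n - int k)\<bar>)"
      by (intro add_mono sum_abs)
    finally show "\<bar>\<Sum>k<w. Y (Suc i) (n - int k)\<bar> \<le> \<dots>" .
  qed
  also have "\<dots> = (\<Sum>l<i. \<Sum>n\<in>S. \<bar>\<Sum>k<w. Y i ((n - pos h i l) - int k)\<bar>)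
       + (\<Sum>k<w. \<Sum>n\<in>S. \<bar>Y (Suc i) (n - int k) - ?P (n - int k)\<bar>)"
    by (simp add: sum.distrib sum.swap[of _ _ S])
  also have "\<dots> \<le> (\<Sum>l<i. B) + (\<Sum>k<w. real (i ^ 2))"
  proof (intro add_mono sum_mono)
    fix l
    have "(\<Sum>n\<in>S. \<bar>\<Sum>k<w. Y i ((n - pos h i l) - int k)\<bar>)
        = (\<Sum>n\<in>(\<lambda>n. n - pos h i l) ` S. \<bar>\<Sum>k<w. Y i (n - int k)\<bar>)"
      by (subst sum.reindex) (auto simp: inj_on_def)
    also have "\<dots> \<le> B" using assms(2) S by (simp add: window_bound_def)
    finally show "(\<Sum>n\<in>S. \<bar>\<Sum>k<w. Y i ((n - pos h i l) - int k)\<bar>) \<le> B" .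
  next
    fix k
    show "(\<Sum>n\<in>S. \<bar>Y (Suc i) (n - int k) - ?P (n - int k)\<bar>) \<le> real (i ^ 2)"
      using spacer_error[OF assms(1) S, of "- int k"] by simp
  qed
  finally show "(\<Sum>n\<in>S. \<bar>\<Sum>k<w. Y (Suc i) (n - int k)\<bar>) \<le> real i * B + real w * real (i ^ 2)"
    by simp
qed

text \<open>
  A window that meets the word without containing it has one of at most \<open>2 * ht h q\<close> positions.
\<close>

lemma window_bound_base:
  assumes "m \<le> q"
  defines "H \<equiv> int (ht h q)"
  shows "window_bound q w (real w * \<bar>\<Sum>n\<in>{0..<H}. Y q n\<bar> + 2 * real (ht h q) ^ 2)"
  unfolding window_bound_def
proof (intro allI impI)
  fix S :: "int set" assume S: "finite S"
  have win: "(\<Sum>k<w. Y q (n - int k)) = (\<Sum>n'\<in>{n - int w<..n} \<inter> {0..<H}. Y q n')" for n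
  proof -
    have "(\<Sum>k<w. Y q (n - int k)) = (\<Sum>n'\<in>(\<lambda>k. n - int k) ` {..<w}. Y q n')"
      by (subst sum.reindex) (auto simp: inj_on_def)
    also have "(\<lambda>k. n - int k) ` {..<w} = {n - int w<..n}"
    proof (intro set_eqI iffI)
      fix x assume "x \<in> {n - int w<..n}"
      then show "x \<in> (\<lambda>k. n - int k) ` {..<w}" by (intro image_eqI[of _ _ "nat (n - x)"]) auto
    qed auto
    also have "(\<Sum>n'\<in>{n - int w<..n}. Y q n') = (\<Sum>n'\<in>{n - int w<..n} \<inter> {0..<H}. Y q n')"
      using support[OF assms(1)] by (intro sum.mono_neutral_right) (auto simp: H_def)
    finally show ?thesis .
  qed
  let ?T = "\<bar>\<Sum>n\<in>{0..<H}. Y q n\<bar>"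
  let ?A = "{0..<int w}" and ?B = "{0..<H} \<union> {int w..<int w + H}"
  have le: "\<bar>\<Sum>k<w. Y q (n - int k)\<bar> \<le> (if n \<in> ?A then ?T else 0) + (if n \<in> ?B then real (ht h q) else 0)" for n
  proof -
    have triv: "\<bar>\<Sum>k<w. Y q (n - int k)\<bar> \<le> real (ht h q)"
    proof -
      have "\<bar>\<Sum>k<w. Y q (n - int k)\<bar> \<le> (\<Sum>n'\<in>{n - int w<..n} \<inter> {0..<H}. \<bar>Y q n'\<bar>)"
        unfolding win by (rule sum_abs)
      also have "\<dots> \<le> (\<Sum>n'\<in>{n - int w<..n} \<inter> {0..<H}. 1)" by (intro sum_mono bounded)
      also have "\<dots> \<le> (\<Sum>n'\<in>{0..<H}. 1)" by (intro sum_mono2) auto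
      finally show ?thesis by (simp add: H_def)
    qed
    consider "n \<in> ?B" | "n \<in> ?A" "n \<notin> ?B" | "n < 0 \<or> int w + H \<le> n" by force
    then show ?thesis
    proof cases
      case 1
      then show ?thesis using triv by (auto intro: order_trans)
    next
      case 2
      then have "{n - int w<..n} \<inter> {0..<H} = {0..<H}" by auto
      then show ?thesis using 2 by (simp add: win)
    next
      case 3
      then have "{n - int w<..n} \<inter> {0..<H} = {}" by auto
      then show ?thesis by (simp only: win sum.empty) auto
    qed
  qed
  have "(\<Sum>n\<in>S. \<bar>\<Sum>k<w. Y q (n - int k)\<bar>)
      \<le> (\<Sum>n\<in>S. (if n \<in> ?A then ?T else 0) + (if n \<in> ?B then real (ht h q) else 0))"
    by (intro sum_mono le)
  also have "\<dots> = real (card (S \<inter> ?A)) * ?T + real (card (S \<inter> ?B)) * real (ht h q)"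
    using S by (simp add: sum.distrib sum.If_cases Int_def)
  also have "\<dots> \<le> real w * ?T + real (2 * ht h q) * real (ht h q)"
  proof (intro add_mono mult_right_mono)
    have "card (S \<inter> ?A) \<le> card ?A" by (rule card_mono) auto
    then show "real (card (S \<inter> ?A)) \<le> real w" by simp
    have "card (S \<inter> ?B) \<le> card ?B" by (rule card_mono) auto
    also have "\<dots> \<le> card {0..<H} + card {int w..<int w + H}" by (rule card_Un_le)
    finally show "real (card (S \<inter> ?B)) \<le> real (2 * ht h q)" by (simp add: H_def)
  qed auto
  finally show "(\<Sum>n\<in>S. \<bar>\<Sum>k<w. Y q (n - int k)\<bar>) \<le> real w * ?T + 2 * real (ht h q) ^ 2"
    by (simp add: power2_eq_square)
qed

text \<open>
  The subtracted term is a reserve: since \<open>i * i^2\<close> exceeds \<open>i^2 + (i + 1)^2\<close>, it pays for the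
  spacers of the next stage and is renewed at the same time. Hence the bound grows no faster than
  the heights.
\<close>

lemma window_bound_grow:
  assumes "q \<le> i" "m \<le> q" "3 \<le> q" "window_bound q w (real (ht h q) * C - real w * real (q ^ 2))"
    and C: "0 \<le> C"
  shows "window_bound i w (real (ht h i) * C - real w * real (i ^ 2))"
  using assms(1)
proof (induction i rule: dec_induct)
  case (step i)
  have "window_bound (Suc i) w (real i * (real (ht h i) * C - real w * real (i ^ 2)) + real w * real (i ^ 2))"
    using step assms by (intro window_bound_Suc) auto
  moreover have "real i * (real (ht h i) * C - real w * real (i ^ 2)) + real w * real (i ^ 2)
      \<le> real (ht h (Suc i)) * C - real w * real (Suc i ^ 2)"
  proof -
    have "i * ht h i \<le> ht h (Suc i)" using step assms by (intro ht_Suc_ge) auto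
    then have "real i * real (ht h i) \<le> real (ht h (Suc i))"
      by (metis of_nat_le_iff of_nat_mult)
    then have 1: "real i * real (ht h i) * C \<le> real (ht h (Suc i)) * C" using C by (rule mult_right_mono)
    have "3 * i ^ 2 \<le> i * i ^ 2" using step assms by (intro mult_le_mono1) auto
    moreover have "2 * i + 1 \<le> i ^ 2"
    proof -
      have i: "3 \<le> i" using step.hyps assms(3) by linarith
      then have "3 * i \<le> i * i" by (rule mult_le_mono1)
      then show ?thesis using i unfolding power2_eq_square by linarith
    qed
    moreover have "Suc i ^ 2 = i ^ 2 + 2 * i + 1" by (simp add: power2_eq_square)
    ultimately have "i ^ 2 + Suc i ^ 2 \<le> i * i ^ 2" by linarith
    then have "real (i ^ 2) + real (Suc i ^ 2) \<le> real i * real (i ^ 2)"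
      by (metis of_nat_le_iff of_nat_mult of_nat_add)
    then have "real w * (real (i ^ 2) + real (Suc i ^ 2)) \<le> real w * (real i * real (i ^ 2))"
      by (rule mult_left_mono) simp
    then show ?thesis using 1 by (simp add: algebra_simps)
  qed
  ultimately show ?case unfolding window_bound_def by (meson order_trans)
qed (use assms in simp)

end

locale balanced_word = staircase_word +
  assumes balanced: "(\<lambda>j. (\<Sum>n\<in>{0..<int (ht h j)}. Y j n) / real (ht h j)) \<longlonglongrightarrow> 0"
begin

text \<open>
  Fix a stage \<open>q\<close> at which the mean value and the spacer reserve are small. Windows of length \<open>p - 1\<close>
  are long compared with its height, so the bound of stage \<open>q\<close> is small, and it carries over to \<open>p\<close>.
\<close>

lemma window_bound_eventually:
  assumes "0 < e"
  shows "\<forall>\<^sub>F p in sequentially. window_bound p (p - 1) (e * real p * real (ht h p))"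
proof -
  let ?s = "\<lambda>q. \<bar>\<Sum>n\<in>{0..<int (ht h q)}. Y q n\<bar>"
  have "\<forall>\<^sub>F q in sequentially. ?s q / real (ht h q) < e / 3"
    using order_tendstoD(2)[OF tendsto_rabs_zero[OF balanced], of "e / 3"] assms by simp
  moreover have "\<forall>\<^sub>F q in sequentially. 1 * real q ^ 2 \<le> e / 3 * real (ht h q)"
    using assms by (intro power_le_ht[OF h_pos]) simp
  ultimately have "\<forall>\<^sub>F q in sequentially. ?s q / real (ht h q) < e / 3 \<and> real q ^ 2 \<le> e / 3 * real (ht h q)
      \<and> m \<le> q \<and> 3 \<le> q"
    using eventually_ge_at_top[of m] eventually_ge_at_top[of 3] by eventually_elim auto
  then obtain q where q: "?s q / real (ht h q) < e / 3" "real q ^ 2 \<le> e / 3 * real (ht h q)" "m \<le> q" "3 \<le> q"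
    using eventually_happens by force
  note H = ht_real_pos[OF q(3)]
  have "\<forall>\<^sub>F p in sequentially. 6 * real (ht h q) / e \<le> real p"
    using filterlim_real_sequentially by (auto simp: filterlim_at_top)
  then show ?thesis
    using eventually_ge_at_top[of q]
  proof eventually_elim
    case (elim p)
    let ?w = "p - 1"
    define C where "C = (real ?w * ?s q + 2 * real (ht h q) ^ 2 + real ?w * real (q ^ 2)) / real (ht h q)"
    have "real (ht h q) * C - real ?w * real (q ^ 2) = real ?w * ?s q + 2 * real (ht h q) ^ 2"
      using H by (simp add: C_def)
    then have "window_bound q ?w (real (ht h q) * C - real ?w * real (q ^ 2))"
      using window_bound_base[OF q(3), of ?w] by simp
    moreover have "0 \<le> C" by (simp add: C_def)
    ultimately have wb: "window_bound p ?w (real (ht h p) * C - real ?w * real (p ^ 2))"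
      by (rule window_bound_grow[OF elim(2) q(3,4)])
    have "C = real ?w * (?s q / real (ht h q)) + 2 * real (ht h q) + real ?w * (real q ^ 2 / real (ht h q))"
    proof -
      have "2 * real (ht h q) ^ 2 / real (ht h q) = 2 * real (ht h q)"
        using H by (simp add: power2_eq_square)
      then show ?thesis
        by (simp only: C_def add_divide_distrib times_divide_eq_right of_nat_power)
    qed
    also have "\<dots> \<le> real p * (e / 3) + e / 3 * real p + real p * (e / 3)"
    proof -
      have 1: "2 * real (ht h q) \<le> e / 3 * real p" using elim(1) assms by (simp add: field_simps)
      have "real ?w * (?s q / real (ht h q)) \<le> real p * (e / 3)"
        using q(1) by (intro mult_mono) auto
      moreover have "real ?w * (real q ^ 2 / real (ht h q)) \<le> real p * (e / 3)"
        using q(2) H by (intro mult_mono) (auto simp: field_simps)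
      ultimately show ?thesis using 1 by linarith
    qed
    finally have "C \<le> e * real p" by simp
    then have "real (ht h p) * C \<le> real (ht h p) * (e * real p)" by (rule mult_left_mono) simp
    moreover have "0 \<le> real ?w * real (p ^ 2)" by simp
    moreover have "real (ht h p) * (e * real p) = e * real p * real (ht h p)" by simp
    ultimately have "real (ht h p) * C - real ?w * real (p ^ 2) \<le> e * real p * real (ht h p)"
      by linarith
    then show ?case using wb unfolding window_bound_def by (meson order_trans)
  qed
qed

end

section \<open>Two summation inequalities\<close>

lemma sum_shift_le:
  fixes v :: "nat \<Rightarrow> real"
  assumes "\<And>k. \<bar>v k\<bar> \<le> B"
  shows "\<bar>(\<Sum>k<L. v k) - (\<Sum>k<L. v (k + e))\<bar> \<le> 2 * real e * B"
proof -
  have 1: "(\<Sum>k<L. v (k + e)) = (\<Sum>k\<in>{e..<L + e}. v k)"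
    using sum.shift_bounds_nat_ivl[of v 0 e L] by (simp add: lessThan_atLeast0)
  have 2: "(\<Sum>k<L. v k) + (\<Sum>k\<in>{L..<L + e}. v k) = (\<Sum>k<e. v k) + (\<Sum>k\<in>{e..<L + e}. v k)"
    using sum.atLeastLessThan_concat[of 0 L "L + e" v] sum.atLeastLessThan_concat[of 0 e "L + e" v]
    by (simp add: lessThan_atLeast0)
  have b: "\<bar>\<Sum>k\<in>A. v k\<bar> \<le> real (card A) * B" for A
  proof -
    have "\<bar>\<Sum>k\<in>A. v k\<bar> \<le> (\<Sum>k\<in>A. \<bar>v k\<bar>)" by (rule sum_abs)
    also have "\<dots> \<le> (\<Sum>k\<in>A. B)" by (intro sum_mono assms)
    finally show ?thesis by simp
  qed
  show ?thesis using 1 2 b[of "{..<e}"] b[of "{L..<L + e}"] by simp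
qed

text \<open>
  Cauchy--Schwarz over \<open>S\<close>, after which the sum of squares may be enlarged to \<open>S'\<close>. In one application
  \<open>S'\<close> covers the supports of all the functions, so that the mixed sums become full correlations.
\<close>

lemma van_der_Corput:
  fixes v :: "nat \<Rightarrow> 'a \<Rightarrow> real"
  assumes fin: "finite S'" and sub: "S \<subseteq> S'" and card: "real (card S) \<le> H" and N: "0 < N"
    and diag: "\<And>a. a < N \<Longrightarrow> (\<Sum>n\<in>S'. v a n * v a n) \<le> H"
    and off: "\<And>a b. a < N \<Longrightarrow> b < N \<Longrightarrow> a \<noteq> b \<Longrightarrow> (\<Sum>n\<in>S'. v a n * v b n) \<le> c * H"
    and c: "0 \<le> c"
  shows "(\<Sum>n\<in>S. \<bar>\<Sum>a<N. v a n\<bar>) \<le> real N * H * sqrt (1 / real N + c)"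
proof (rule power2_le_imp_le)
  have H: "0 \<le> H" using card by (rule order_trans[rotated]) simp
  have "(\<Sum>n\<in>S. \<bar>\<Sum>a<N. v a n\<bar>)\<^sup>2 \<le> (\<Sum>n\<in>S. 1\<^sup>2) * (\<Sum>n\<in>S. \<bar>\<Sum>a<N. v a n\<bar>\<^sup>2)"
    using Cauchy_Schwarz_ineq_sum[of "\<lambda>_. 1" "\<lambda>n. \<bar>\<Sum>a<N. v a n\<bar>" S] by simp
  also have "\<dots> \<le> H * (\<Sum>n\<in>S'. \<bar>\<Sum>a<N. v a n\<bar>\<^sup>2)"
    using card H sub fin by (intro mult_mono sum_mono2) (auto intro: sum_nonneg)
  also have "(\<Sum>n\<in>S'. \<bar>\<Sum>a<N. v a n\<bar>\<^sup>2) = (\<Sum>n\<in>S'. \<Sum>a<N. \<Sum>b<N. v a n * v b n)"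
    by (simp add: power2_eq_square sum_product)
  also have "\<dots> = (\<Sum>a<N. \<Sum>b<N. \<Sum>n\<in>S'. v a n * v b n)"
    by (simp add: sum.swap[of _ _ S'])
  also have "\<dots> \<le> (\<Sum>a<N. \<Sum>b<N. (if a = b then H else 0) + c * H)"
  proof (intro sum_mono)
    fix a b assume "a \<in> {..<N}" "b \<in> {..<N}"
    then show "(\<Sum>n\<in>S'. v a n * v b n) \<le> (if a = b then H else 0) + c * H"
      using diag[of a] off[of a b] c H by (cases "a = b") (auto intro: order_trans add_increasing2)
  qed
  also have "\<dots> = real N * H + real N * (real N * (c * H))"
    by (simp add: sum.distrib distrib_left)
  also have "\<dots> = (real N)\<^sup>2 * H * (1 / real N + c)"
    using N by (simp add: field_simps power2_eq_square)
  finally have "(\<Sum>n\<in>S. \<bar>\<Sum>a<N. v a n\<bar>)\<^sup>2 \<le> H * ((real N)\<^sup>2 * H * (1 / real N + c))"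
    using H by (simp add: mult_left_mono)
  also have "\<dots> = (real N * H * sqrt (1 / real N + c))\<^sup>2"
    using c by (simp add: power_mult_distrib power2_eq_square)
  finally show "(\<Sum>n\<in>S. \<bar>\<Sum>a<N. v a n\<bar>)\<^sup>2 \<le> (real N * H * sqrt (1 / real N + c))\<^sup>2" .
  show "0 \<le> real N * H * sqrt (1 / real N + c)" using H c by simp
qed

section \<open>Autocorrelation near a height\<close>

context staircase_word
begin

lemma corr_Suc_le:
  assumes "m \<le> i"
  shows "\<bar>corr (Suc i) x - (\<Sum>l<i. \<Sum>l'<i. corr i (x + pos h i l - pos h i l'))\<bar> \<le> 2 * real (i ^ 2)"
proof -
  have "(\<Sum>n\<in>{0..<int (ht h (Suc i))}. Y i (n + 0 - pos h i l) * Y i (n + x - pos h i l'))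
      = corr i (x + pos h i l - pos h i l')" if "l < i" for l l'
  proof -
    have "pos h i l + int (ht h i) \<le> int (ht h (Suc i))"
      using that assms m_ge by (intro pos_plus_ht_le) simp_all
    then have "(\<Sum>n\<in>{0..<int (ht h (Suc i))}. Y i (n + (- pos h i l)) * Y i (n + (x - pos h i l')))
        = corr i (x - pos h i l' - (- pos h i l))"
      using pos_nonneg[of h i l] by (intro corr_eq[OF assms]) auto
    then show ?thesis by (simp add: algebra_simps)
  qed
  then show ?thesis
    using expand_both[of i "{0..<int (ht h (Suc i))}" 0 x, OF assms]
    by (simp add: corr_def)
qed

lemma corr_progression_le:
  "\<bar>\<Sum>l<L. corr i (s - int t * int l)\<bar>
    \<le> (\<Sum>n\<in>{s..<s + int (ht h i)}. \<bar>\<Sum>l<L. Y i (n - int t * int l)\<bar>)"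
proof -
  have "(\<Sum>l<L. corr i (s - int t * int l))
      = (\<Sum>n\<in>{0..<int (ht h i)}. Y i n * (\<Sum>l<L. Y i (n + s - int t * int l)))"
    unfolding corr_def by (subst sum.swap) (simp add: sum_distrib_left algebra_simps)
  also have "\<bar>\<dots>\<bar> \<le> (\<Sum>n\<in>{0..<int (ht h i)}. \<bar>Y i n * (\<Sum>l<L. Y i (n + s - int t * int l))\<bar>)"
    by (rule sum_abs)
  also have "\<dots> \<le> (\<Sum>n\<in>{0..<int (ht h i)}. \<bar>\<Sum>l<L. Y i (n + s - int t * int l)\<bar>)"
    using bounded by (intro sum_mono) (simp add: abs_mult mult_left_le_one_le)
  also have "\<dots> = (\<Sum>n\<in>(\<lambda>n. n + s) ` {0..<int (ht h i)}. \<bar>\<Sum>l<L. Y i (n - int t * int l)\<bar>)"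
    by (subst sum.reindex) (auto simp: inj_on_def)
  also have "(\<lambda>n. n + s) ` {0..<int (ht h i)} = {s..<s + int (ht h i)}"
    using image_add_int_atLeastLessThan[of s] by (simp add: add.commute)
  finally show ?thesis .
qed

text \<open>
  For a lag \<open>x\<close> near the height, copy \<open>l\<close> overlaps substantially only with copy \<open>l + 1\<close>, and with
  shift \<open>x - ht h p - l\<close>. These shifts run through consecutive integers, which turns the sum over
  \<open>l\<close> into window sums of length \<open>p - 1\<close>.
\<close>

lemma corr_near_height_base:
  assumes "m \<le> p" "window_bound p (p - 1) B" "\<bar>real_of_int x - real (ht h p)\<bar> \<le> c * real (ht h p)"
    and c: "0 \<le> c" "c \<le> 1 / 2"
  shows "\<bar>corr (Suc p) x\<bar> \<le> B + 2 * real p * c * real (ht h p) + 2 * real (p ^ 2)"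
proof -
  let ?H = "real (ht h p)"
  define F where "F = (\<lambda>l l'. corr p (x + pos h p l - pos h p l'))"
  have half: "c * ?H \<le> ?H / 2" using c mult_right_mono[of c "1/2" ?H] by simp
  have x: "?H - c * ?H \<le> real_of_int x" "real_of_int x \<le> ?H + c * ?H" using assms(3) by linarith+
  have row: "\<bar>(\<Sum>l'<p. F l l') - (if Suc l < p then F l (Suc l) else 0)\<bar> \<le> 2 * (c * ?H)" for l
  proof -
    have "(\<Sum>l'<p. F l l') - (if Suc l < p then F l (Suc l) else 0)
        = (\<Sum>l'<p. F l l' - (if l' = Suc l then F l l' else 0))"
      by (simp add: sum_subtractf)
    also have "\<bar>\<dots>\<bar> \<le> (\<Sum>l'<p. (if l' = l then c * ?H else 0) + (if l' = l + 2 then c * ?H else 0))"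
    proof (rule order_trans[OF sum_abs sum_mono])
      fix l'
      consider "l' < l" | "l' = l" | "l' = Suc l" | "l' = l + 2" | "l + 3 \<le> l'" by linarith
      then show "\<bar>F l l' - (if l' = Suc l then F l l' else 0)\<bar>
          \<le> (if l' = l then c * ?H else 0) + (if l' = l + 2 then c * ?H else 0)"
      proof cases
        case 1
        then have "l = l' + (l - l')" "1 \<le> int (l - l')" by auto
        then have e: "pos h p l = pos h p l' + int (l - l') * int (ht h p) + int (tri (l - l')) + int l' * int (l - l')"
          using pos_add by metis
        have "1 * int (ht h p) \<le> int (l - l') * int (ht h p)"
          using \<open>1 \<le> int (l - l')\<close> by (rule mult_right_mono) simp
        moreover have "0 \<le> int l' * int (l - l')" by simp
        moreover have "0 \<le> x" using x half by linarith
        ultimately have "int (ht h p) \<le> x + pos h p l - pos h p l'" using e by linarith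
        then have "F l l' = 0" unfolding F_def by (intro corr_eq_0[OF assms(1)]) linarith
        then show ?thesis using 1 by simp
      next
        case 2
        then show ?thesis using corr_le_overlap[OF assms(1), of x] x c by (auto simp: F_def)
      next
        case 4
        then have "pos h p l' = pos h p l + 2 * int (ht h p) + int (tri 2) + int l * 2"
          using pos_add[of h p l 2] by simp
        then have "\<bar>F l l'\<bar> \<le> c * ?H"
          using corr_le_overlap[OF assms(1), of "x + pos h p l - pos h p l'"] x half c
          unfolding F_def by linarith
        then show ?thesis using 4 by simp
      next
        case 5
        then have "l' = l + (l' - l)" "3 \<le> int (l' - l)" by auto
        then have e: "pos h p l' = pos h p l + int (l' - l) * int (ht h p) + int (tri (l' - l)) + int l * int (l' - l)"
          using pos_add by metis
        have "3 * int (ht h p) \<le> int (l' - l) * int (ht h p)"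
          using \<open>3 \<le> int (l' - l)\<close> by (rule mult_right_mono) simp
        moreover have "0 \<le> int l * int (l' - l)" by simp
        moreover have "x \<le> 2 * int (ht h p)" using x half by linarith
        ultimately have "x + pos h p l - pos h p l' \<le> - int (ht h p)" using e by linarith
        then have "F l l' = 0" unfolding F_def by (intro corr_eq_0[OF assms(1)]) linarith
        then show ?thesis using 5 c by simp
      qed simp
    qed
    also have "\<dots> \<le> 2 * (c * ?H)" using c by (simp add: sum.distrib)
    finally show ?thesis .
  qed
  have main: "\<bar>\<Sum>l<p. if Suc l < p then F l (Suc l) else 0\<bar> \<le> B"
  proof -
    have "(\<Sum>l<p. if Suc l < p then F l (Suc l) else 0) = (\<Sum>l<p-1. F l (Suc l))"
      by (intro sum.mono_neutral_cong_right) auto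
    also have "\<dots> = (\<Sum>l<p-1. corr p ((x - int (ht h p)) - int 1 * int l))"
      unfolding F_def using pos_add[of h p _ 1]
      by (intro sum.cong refl arg_cong[where f = "corr p"]) (simp add: tri_def)
    also have "\<bar>\<dots>\<bar> \<le> (\<Sum>n\<in>{x - int (ht h p)..<x - int (ht h p) + int (ht h p)}.
        \<bar>\<Sum>l<p-1. Y p (n - int 1 * int l)\<bar>)"
      by (rule corr_progression_le)
    also have "\<dots> \<le> B" using assms(2) by (simp add: window_bound_def)
    finally show ?thesis .
  qed
  have "\<bar>(\<Sum>l<p. \<Sum>l'<p. F l l') - (\<Sum>l<p. if Suc l < p then F l (Suc l) else 0)\<bar>
      \<le> (\<Sum>l<p. 2 * (c * ?H))"
    unfolding sum_subtractf[symmetric] by (rule order_trans[OF sum_abs sum_mono[OF row]])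
  then show ?thesis
    using main corr_Suc_le[OF assms(1), of x] by (simp add: F_def algebra_simps)
qed

text \<open>
  For a lag below the height, a copy meets itself, and its successor in a strip of width at most \<open>x\<close>.
\<close>

lemma corr_Suc_le_corr:
  assumes "m \<le> i" "0 \<le> x" "x \<le> int (ht h i)"
  shows "\<bar>corr (Suc i) x\<bar> \<le> real i * \<bar>corr i x\<bar> + real i * real_of_int x + 2 * real (i ^ 2)"
proof -
  define F where "F = (\<lambda>l l'. corr i (x + pos h i l - pos h i l'))"
  have "\<bar>\<Sum>l'<i. F l l'\<bar> \<le> \<bar>corr i x\<bar> + real_of_int x" for l
  proof -
    have "\<bar>\<Sum>l'<i. F l l'\<bar> \<le> (\<Sum>l'<i. (if l' = l then \<bar>corr i x\<bar> else 0) + (if l' = Suc l then real_of_int x else 0))"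
    proof (rule order_trans[OF sum_abs sum_mono])
      fix l'
      consider "l' < l" | "l' = l" | "l' = Suc l" | "l + 2 \<le> l'" by linarith
      then show "\<bar>F l l'\<bar> \<le> (if l' = l then \<bar>corr i x\<bar> else 0) + (if l' = Suc l then real_of_int x else 0)"
      proof cases
        case 1
        then have "l = l' + (l - l')" "1 \<le> int (l - l')" by auto
        then have e: "pos h i l = pos h i l' + int (l - l') * int (ht h i) + int (tri (l - l')) + int l' * int (l - l')"
          using pos_add by metis
        have "1 * int (ht h i) \<le> int (l - l') * int (ht h i)"
          using \<open>1 \<le> int (l - l')\<close> by (rule mult_right_mono) simp
        moreover have "0 \<le> int l' * int (l - l')" by simp
        ultimately have "int (ht h i) \<le> x + pos h i l - pos h i l'" using e assms by linarith
        then have "F l l' = 0" unfolding F_def by (intro corr_eq_0[OF assms(1)]) linarith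
        then show ?thesis using 1 by simp
      next
        case 3
        then have "pos h i l' = pos h i l + int (ht h i) + int (tri 1) + int l"
          using pos_add[of h i l 1] by simp
        then show ?thesis
          using 3 corr_le_overlap[OF assms(1), of "x + pos h i l - pos h i l'"] assms
          unfolding F_def by simp
      next
        case 4
        then have "l' = l + (l' - l)" "2 \<le> int (l' - l)" by auto
        then have e: "pos h i l' = pos h i l + int (l' - l) * int (ht h i) + int (tri (l' - l)) + int l * int (l' - l)"
          using pos_add by metis
        have "2 * int (ht h i) \<le> int (l' - l) * int (ht h i)"
          using \<open>2 \<le> int (l' - l)\<close> by (rule mult_right_mono) simp
        moreover have "0 \<le> int l * int (l' - l)" by simp
        ultimately have "x + pos h i l - pos h i l' \<le> - int (ht h i)" using e assms by linarith
        then have "F l l' = 0" unfolding F_def by (intro corr_eq_0[OF assms(1)]) linarith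
        then show ?thesis using 4 by simp
      qed (simp add: F_def)
    qed
    also have "\<dots> \<le> \<bar>corr i x\<bar> + real_of_int x" using assms by (simp add: sum.distrib)
    finally show ?thesis .
  qed
  then have "\<bar>\<Sum>l<i. \<Sum>l'<i. F l l'\<bar> \<le> (\<Sum>l<i. \<bar>corr i x\<bar> + real_of_int x)"
    by (intro order_trans[OF sum_abs sum_mono])
  then show ?thesis
    using corr_Suc_le[OF assms(1), of x] by (simp add: F_def algebra_simps)
qed

text \<open>
  The terms \<open>2 x\<close> and \<open>i^2\<close> are reserves as in the growth of window bounds: multiplied by \<open>i\<close>, they pay
  for the overlap with the successor and for the spacers.
\<close>

lemma corr_grow:
  assumes "q \<le> i" "m \<le> q" "4 \<le> q" "0 \<le> x" "x \<le> int (ht h q)"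
    and "\<bar>corr q x\<bar> + 2 * real_of_int x + real (q ^ 2) \<le> C * real (ht h q)" and C: "0 \<le> C"
  shows "\<bar>corr i x\<bar> + 2 * real_of_int x + real (i ^ 2) \<le> C * real (ht h i)"
  using assms(1)
proof (induction i rule: dec_induct)
  case (step i)
  have i: "4 \<le> i" "m \<le> i" using step.hyps assms(2,3) by linarith+
  have "ht h q \<le> ht h i" using step.hyps assms(2) m_ge by (intro ht_mono) auto
  then have s: "\<bar>corr (Suc i) x\<bar> \<le> real i * \<bar>corr i x\<bar> + real i * real_of_int x + 2 * real (i ^ 2)"
    using assms i by (intro corr_Suc_le_corr) auto
  have "4 * i ^ 2 \<le> i * i ^ 2" using i by (intro mult_le_mono1) auto
  moreover have "2 * i + 1 \<le> i ^ 2"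
  proof -
    have "4 * i \<le> i * i" using i by (intro mult_le_mono1) auto
    then show ?thesis using i unfolding power2_eq_square by linarith
  qed
  moreover have "Suc i ^ 2 = i ^ 2 + 2 * i + 1" by (simp add: power2_eq_square)
  ultimately have "2 * i ^ 2 + Suc i ^ 2 \<le> i * i ^ 2" by linarith
  then have "real (2 * i ^ 2 + Suc i ^ 2) \<le> real (i * i ^ 2)" by (simp only: of_nat_le_iff)
  then have a: "2 * real (i ^ 2) + real (Suc i ^ 2) \<le> real i * real (i ^ 2)"
    by (simp only: of_nat_add of_nat_mult of_nat_numeral)
  have b: "real i * real_of_int x + 2 * real_of_int x \<le> real i * (2 * real_of_int x)"
  proof -
    have "2 * real_of_int x \<le> real i * real_of_int x" using i assms by (intro mult_right_mono) auto
    moreover have "real i * (2 * real_of_int x) = real i * real_of_int x + real i * real_of_int x" by simp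
    ultimately show ?thesis by linarith
  qed
  have "\<bar>corr (Suc i) x\<bar> + 2 * real_of_int x + real (Suc i ^ 2)
      \<le> real i * (\<bar>corr i x\<bar> + 2 * real_of_int x + real (i ^ 2))"
    using s a b by (simp only: distrib_left)
  also have "\<dots> \<le> real i * (C * real (ht h i))" by (intro mult_left_mono step.IH) simp
  also have "\<dots> = C * real (i * ht h i)" by simp
  also have "\<dots> \<le> C * real (ht h (Suc i))"
    using ht_Suc_ge[of i h] i C by (intro mult_left_mono) (simp_all only: of_nat_le_iff)
  finally show ?case .
qed (use assms in simp)

end

context balanced_word
begin

lemma corr_near_height:
  assumes "0 < e"
  shows "\<exists>c>0. \<forall>\<^sub>F p in sequentially. \<forall>i>p. \<forall>x.
    \<bar>real_of_int x - real (ht h p)\<bar> \<le> c * real (ht h p) \<longrightarrow> \<bar>corr i x\<bar> \<le> e * real (ht h i)"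
proof (intro exI conjI)
  \<comment> \<open>at most \<open>1 / 2\<close>, so that no lag in question reaches two heights\<close>
  define c where "c = min (e / 8) (1 / 2)"
  show "0 < c" using assms by (simp add: c_def)
  have c: "0 \<le> c" "c \<le> 1 / 2" "c \<le> e / 8" using assms by (auto simp: c_def)
  have "\<forall>\<^sub>F p in sequentially. 16 / e \<le> real p"
    using filterlim_real_sequentially by (auto simp: filterlim_at_top)
  then show "\<forall>\<^sub>F p in sequentially. \<forall>i>p. \<forall>x.
    \<bar>real_of_int x - real (ht h p)\<bar> \<le> c * real (ht h p) \<longrightarrow> \<bar>corr i x\<bar> \<le> e * real (ht h i)"
    using window_bound_eventually[of "e / 8", OF divide_pos_pos[OF assms zero_less_numeral]]
      power_le_ht[OF h_pos, of "e / 8" 6 2, OF divide_pos_pos[OF assms zero_less_numeral]]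
      eventually_ge_at_top[of m] eventually_ge_at_top[of 4]
  proof eventually_elim
    case (elim p)
    let ?H = "real (ht h p)"
    note p = elim(4,5)
    show ?case
    proof (intro allI impI)
      fix i x assume i: "p < i" and x: "\<bar>real_of_int x - ?H\<bar> \<le> c * ?H"
      have half: "c * ?H \<le> ?H / 2" using c mult_right_mono[of c "1/2" ?H] by simp
      have x': "0 \<le> real_of_int x" "real_of_int x \<le> 2 * ?H" using x half by linarith+
      have "p * ht h p \<le> ht h (Suc p)" using p m_ge by (intro ht_Suc_ge) linarith
      then have "real (p * ht h p) \<le> real (ht h (Suc p))" by (simp only: of_nat_le_iff)
      then have pH: "real p * ?H \<le> real (ht h (Suc p))" by simp
      define K where "K = e * (real p * ?H)"
      have K0: "0 \<le> K" using assms by (simp add: K_def)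
      have "\<bar>corr (Suc p) x\<bar> \<le> e / 8 * real p * ?H + 2 * real p * c * ?H + 2 * real (p ^ 2)"
        by (rule corr_near_height_base[OF p(1) elim(2) x c(1,2)])
      moreover have "c * (2 * (real p * ?H)) \<le> e / 8 * (2 * (real p * ?H))"
        by (rule mult_right_mono[OF c(3)]) simp
      moreover have "e / 8 * real p * ?H = K / 8" "e / 8 * (2 * (real p * ?H)) = K / 4"
        "2 * real p * c * ?H = c * (2 * (real p * ?H))" by (simp_all add: K_def)
      ultimately have 1: "\<bar>corr (Suc p) x\<bar> \<le> 3 / 8 * K + 2 * real (p ^ 2)"
        by linarith
      have 2: "4 * ?H \<le> K / 4"
      proof -
        have "4 \<le> e / 4 * real p" using elim(1) assms by (simp add: field_simps)
        then have "4 * ?H \<le> (e / 4 * real p) * ?H" by (rule mult_right_mono) simp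
        then show ?thesis by (simp add: K_def)
      qed
      have 3: "2 * real (p ^ 2) + real (Suc p ^ 2) \<le> K / 8"
      proof -
        have "Suc p ^ 2 \<le> (2 * p) ^ 2" using p by (intro power_mono) auto
        moreover have "(2 * p) ^ 2 = 4 * p ^ 2" by (simp add: power2_eq_square)
        ultimately have "2 * p ^ 2 + Suc p ^ 2 \<le> 6 * p ^ 2" by linarith
        then have "real (2 * p ^ 2 + Suc p ^ 2) \<le> real (6 * p ^ 2)" by (simp only: of_nat_le_iff)
        then have "2 * real (p ^ 2) + real (Suc p ^ 2) \<le> 6 * real p ^ 2"
          by (simp only: of_nat_add of_nat_mult of_nat_numeral of_nat_power)
        also have "\<dots> \<le> e / 8 * ?H" by (rule elim(3))
        also have "\<dots> \<le> e / 8 * (real p * ?H)"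
        proof (rule mult_left_mono)
          have "1 * ?H \<le> real p * ?H" using p by (intro mult_right_mono) auto
          then show "?H \<le> real p * ?H" by simp
        qed (use assms in simp)
        also have "\<dots> = K / 8" by (simp add: K_def)
        finally show ?thesis .
      qed
      have "\<bar>corr (Suc p) x\<bar> + 2 * real_of_int x + real (Suc p ^ 2) \<le> e * (real p * ?H)"
        unfolding K_def[symmetric] using 1 2 3 x' K0 by linarith
      also have "\<dots> \<le> e * real (ht h (Suc p))" using pH assms by (intro mult_left_mono) auto
      finally have b: "\<bar>corr (Suc p) x\<bar> + 2 * real_of_int x + real (Suc p ^ 2) \<le> e * real (ht h (Suc p))" .
      have "2 * ht h p \<le> p * ht h p" using p by (intro mult_le_mono1) auto
      also have "\<dots> \<le> ht h (Suc p)" using p m_ge by (intro ht_Suc_ge) auto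
      finally have xle: "x \<le> int (ht h (Suc p))" using x' by linarith
      have x0: "0 \<le> x" using x' by simp
      have "\<bar>corr i x\<bar> + 2 * real_of_int x + real (i ^ 2) \<le> e * real (ht h i)"
        by (rule corr_grow[OF _ _ _ x0 xle b]) (use i p assms in auto)
      moreover have "0 \<le> real (i ^ 2)" by simp
      ultimately show "\<bar>corr i x\<bar> \<le> e * real (ht h i)" using x' by linarith
    qed
  qed
qed

end

section \<open>Averages along arithmetic progressions\<close>

context staircase_word
begin

text \<open>
  Shifting the summation index by \<open>e a \<le> E\<close> changes the sum along a progression by at most \<open>2 E\<close>. The
  average over \<open>N\<close> such shifts is controlled by van der Corput, through autocorrelations at the lags
  \<open>t (e b - e a)\<close>; these can be placed where decay is known.
\<close>

lemma progression_by_averaging: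
  assumes "m \<le> i" "0 < N" and e: "\<And>a. a < N \<Longrightarrow> e a \<le> E"
    and small: "\<And>a b. a < b \<Longrightarrow> b < N \<Longrightarrow> corr i (int t * (int (e b) - int (e a))) \<le> c * real (ht h i)"
    and c: "0 \<le> c" and S: "finite S" "card S \<le> ht h i"
  shows "(\<Sum>n\<in>S. \<bar>\<Sum>k<L. Y i (n - int t * int k)\<bar>)
    \<le> real L * real (ht h i) * sqrt (1 / real N + c) + 2 * real E * real (ht h i)"
proof -
  let ?H = "real (ht h i)"
  define v where "v = (\<lambda>k a n. Y i (n - int t * int (k + e a)))"
  have pt: "real N * \<bar>\<Sum>k<L. Y i (n - int t * int k)\<bar> \<le> (\<Sum>k<L. \<bar>\<Sum>a<N. v k a n\<bar>) + real N * (2 * real E)" for n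
  proof -
    have "\<bar>(\<Sum>a<N. (\<Sum>k<L. Y i (n - int t * int k)) - (\<Sum>k<L. v k a n))\<bar> \<le> (\<Sum>a<N. 2 * real E)"
    proof (rule order_trans[OF sum_abs sum_mono])
      fix a assume "a \<in> {..<N}"
      then have "real (e a) \<le> real E" using e by simp
      moreover have "\<bar>(\<Sum>k<L. Y i (n - int t * int k)) - (\<Sum>k<L. v k a n)\<bar> \<le> 2 * real (e a) * 1"
        unfolding v_def by (rule sum_shift_le) (rule bounded)
      ultimately show "\<bar>(\<Sum>k<L. Y i (n - int t * int k)) - (\<Sum>k<L. v k a n)\<bar> \<le> 2 * real E" by linarith
    qed
    moreover have "(\<Sum>a<N. (\<Sum>k<L. Y i (n - int t * int k)) - (\<Sum>k<L. v k a n))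
        = real N * (\<Sum>k<L. Y i (n - int t * int k)) - (\<Sum>k<L. \<Sum>a<N. v k a n)"
      by (simp add: sum_subtractf sum.swap[of _ "{..<N}"])
    moreover have "\<bar>\<Sum>k<L. \<Sum>a<N. v k a n\<bar> \<le> (\<Sum>k<L. \<bar>\<Sum>a<N. v k a n\<bar>)" by (rule sum_abs)
    moreover have "real N * \<bar>\<Sum>k<L. Y i (n - int t * int k)\<bar> = \<bar>real N * (\<Sum>k<L. Y i (n - int t * int k))\<bar>"
      by (simp add: abs_mult)
    moreover have "(\<Sum>a<N. 2 * real E) = real N * (2 * real E)" by simp
    ultimately show ?thesis by linarith
  qed
  have vdc: "(\<Sum>n\<in>S. \<bar>\<Sum>a<N. v k a n\<bar>) \<le> real N * ?H * sqrt (1 / real N + c)" for k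
  proof (rule van_der_Corput[where S' = "S \<union> (\<Union>a<N. {int t * int (k + e a)..<int t * int (k + e a) + int (ht h i)})"])
    let ?S = "S \<union> (\<Union>a<N. {int t * int (k + e a)..<int t * int (k + e a) + int (ht h i)})"
    have vv: "(\<Sum>n\<in>?S. v k a n * v k b n) = corr i (int t * (int (e a) - int (e b)))" if "a < N" for a b
    proof -
      have "(\<Sum>n\<in>?S. Y i (n + (- (int t * int (k + e a)))) * Y i (n + (- (int t * int (k + e b)))))
          = corr i (- (int t * int (k + e b)) - (- (int t * int (k + e a))))"
        using that S(1) by (intro corr_eq[OF assms(1)]) (auto intro!: bexI[of _ a])
      then show ?thesis by (simp add: v_def algebra_simps)
    qed
    show "(\<Sum>n\<in>?S. v k a n * v k a n) \<le> ?H" if "a < N" for a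
      using vv[OF that, of a] corr_le_overlap[OF assms(1), of 0] by simp
    show "(\<Sum>n\<in>?S. v k a n * v k b n) \<le> c * ?H" if "a < N" "b < N" "a \<noteq> b" for a b
    proof (cases "b < a")
      case True
      then show ?thesis using vv[OF that(1), of b] small[OF True that(1)] by simp
    next
      case False
      then have "a < b" using that by simp
      then show ?thesis using vv[OF that(2), of a] small[OF _ that(2), of a] by (simp add: mult.commute)
    qed
  qed (use assms in auto)
  have "real N * (\<Sum>n\<in>S. \<bar>\<Sum>k<L. Y i (n - int t * int k)\<bar>)
      \<le> (\<Sum>n\<in>S. (\<Sum>k<L. \<bar>\<Sum>a<N. v k a n\<bar>) + real N * (2 * real E))"
    unfolding sum_distrib_left by (intro sum_mono pt)
  also have "\<dots> = (\<Sum>k<L. \<Sum>n\<in>S. \<bar>\<Sum>a<N. v k a n\<bar>) + real (card S) * (real N * (2 * real E))"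
    by (simp add: sum.distrib sum.swap[of _ S])
  also have "\<dots> \<le> (\<Sum>k<L. real N * ?H * sqrt (1 / real N + c)) + ?H * (real N * (2 * real E))"
    using S by (intro add_mono sum_mono vdc mult_right_mono) auto
  also have "\<dots> = real N * (real L * ?H * sqrt (1 / real N + c) + 2 * real E * ?H)"
    by (simp add: algebra_simps)
  finally show ?thesis using assms(2) by (simp only: mult_le_cancel_left_pos of_nat_0_less_iff)
qed

end

context balanced_word
begin

text \<open>
  Mixing along progressions, uniformly in the step \<open>t\<close>. The lags are taken to be the multiples of \<open>t\<close>
  next to the heights of \<open>N\<close> consecutive stages, beginning with the first stage \<open>p1\<close> whose height
  dwarfs \<open>t\<close>. The difference of two of them is close to the larger height, where autocorrelations
  are small. The shifts needed are short compared with \<open>i\<close>: going up \<open>N\<close> stages costs a factor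
  polynomial in \<open>p1\<close>, whereas \<open>i \<ge> t\<close> is of the order of the height of stage \<open>p1 - 1\<close> at least
  unless \<open>p1\<close> is bounded.
\<close>

lemma progression_average:
  assumes "0 < e"
  shows "\<forall>\<^sub>F i in sequentially. \<forall>t L S. 1 \<le> t \<longrightarrow> t \<le> i \<longrightarrow> L \<le> i \<longrightarrow> finite S \<longrightarrow> card S \<le> ht h i \<longrightarrow>
    (\<Sum>n\<in>S. \<bar>\<Sum>k<L. Y i (n - int t * int k)\<bar>) \<le> e * real i * real (ht h i)"
proof -
  define c where "c = e\<^sup>2 / 8"
  have c: "0 < c" using assms by (simp add: c_def)
  obtain N :: nat where N: "8 / e\<^sup>2 \<le> real N" "0 < N"
    by (metis gr0I le_less_trans of_nat_0 real_arch_simple divide_pos_pos less_irrefl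
        zero_less_numeral zero_less_power assms)
  have root: "sqrt (1 / real N + c) \<le> e / 2"
  proof (rule real_le_lsqrt)
    have "1 / real N \<le> e\<^sup>2 / 8" using N assms by (simp add: field_simps)
    then show "1 / real N + c \<le> (e / 2)\<^sup>2" by (simp add: c_def power2_eq_square)
  qed (use assms in simp)
  obtain \<eta> where \<eta>: "0 < \<eta>" and near: "\<forall>\<^sub>F p in sequentially. \<forall>i>p. \<forall>x.
    \<bar>real_of_int x - real (ht h p)\<bar> \<le> \<eta> * real (ht h p) \<longrightarrow> \<bar>corr i x\<bar> \<le> c * real (ht h i)"
    using corr_near_height[OF c] by blast
  \<comment> \<open>the coefficient that results from climbing \<open>Suc N\<close> stages, see the bound below\<close>
  define A where "A = (2 / \<eta>) * 4 ^ Suc N + 1"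
  have g1: "\<forall>\<^sub>F p in sequentially. A * real p ^ Suc N \<le> e * \<eta> / 8 * real (ht h p)"
    using assms \<eta> by (intro power_le_ht[OF h_pos]) simp
  have g2: "\<forall>\<^sub>F p in sequentially. 3 * real p ^ 1 \<le> \<eta> / 2 * real (ht h p)"
    using \<eta> by (intro power_le_ht[OF h_pos]) simp
  have g3: "\<forall>\<^sub>F p in sequentially. 2 / \<eta> \<le> real p"
    using filterlim_real_sequentially by (auto simp: filterlim_at_top)
  have "\<forall>\<^sub>F p in sequentially. (\<forall>i>p. \<forall>x.
    \<bar>real_of_int x - real (ht h p)\<bar> \<le> \<eta> * real (ht h p) \<longrightarrow> \<bar>corr i x\<bar> \<le> c * real (ht h i)) \<and>
     A * real p ^ Suc N \<le> e * \<eta> / 8 * real (ht h p) \<and> 3 * real p ^ 1 \<le> \<eta> / 2 * real (ht h p) \<and>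
     2 / \<eta> \<le> real p \<and> m \<le> p \<and> Suc N \<le> p"
    using near g1 g2 g3 eventually_ge_at_top[of m] eventually_ge_at_top[of "Suc N"]
    by eventually_elim blast
  then obtain P where P: "\<And>p i x. P \<le> p \<Longrightarrow> p < i \<Longrightarrow>
      \<bar>real_of_int x - real (ht h p)\<bar> \<le> \<eta> * real (ht h p) \<Longrightarrow> \<bar>corr i x\<bar> \<le> c * real (ht h i)"
    "\<And>p. P \<le> p \<Longrightarrow> A * real p ^ Suc N \<le> e * \<eta> / 8 * real (ht h p)"
    "\<And>p. P \<le> p \<Longrightarrow> 3 * real p \<le> \<eta> / 2 * real (ht h p)"
    "\<And>p. P \<le> p \<Longrightarrow> 2 / \<eta> \<le> real p" "\<And>p. P \<le> p \<Longrightarrow> m \<le> p" "\<And>p. P \<le> p \<Longrightarrow> Suc N \<le> p"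
    unfolding eventually_sequentially power_one_right by blast
  have "\<forall>\<^sub>F i in sequentially. real (ht h (P + N)) + 1 \<le> e / 4 * real i"
  proof -
    have "\<forall>\<^sub>F i in sequentially. (real (ht h (P + N)) + 1) / (e / 4) \<le> real i"
      using filterlim_real_sequentially by (auto simp: filterlim_at_top)
    then show ?thesis by eventually_elim (use assms in \<open>simp add: field_simps\<close>)
  qed
  then show ?thesis
    using eventually_gt_at_top[of "P + N"]
  proof eventually_elim
    case (elim i)
    show ?case
    proof (intro allI impI)
      fix t L :: nat and S :: "int set"
      assume t: "1 \<le> t" "t \<le> i" and L: "L \<le> i" and S: "finite S" "card S \<le> ht h i"
      \<comment> \<open>the first stage whose height dwarfs \<open>t\<close>\<close>
      define Q where "Q = (\<lambda>p. P \<le> p \<and> 2 * real t \<le> \<eta> * real (ht h p))"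
      have "\<exists>p. Q p"
      proof -
        obtain p :: nat where "2 * real t / \<eta> + 1 \<le> real p" using real_arch_simple by blast
        moreover have "real (max p (P + 1)) - 1 \<le> real (ht h (max p (P + 1)))"
          using ht_ge[OF h_pos, of "max p (P + 1)"] by linarith
        ultimately have "2 * real t / \<eta> \<le> real (ht h (max p (P + 1)))" by linarith
        then show ?thesis using \<eta> unfolding Q_def by (intro exI[of _ "max p (P + 1)"]) (simp add: field_simps)
      qed
      define p1 where "p1 = (LEAST p. Q p)"
      have p1: "P \<le> p1" "2 * real t \<le> \<eta> * real (ht h p1)"
        using LeastI_ex[OF \<open>\<exists>p. Q p\<close>] by (auto simp: p1_def Q_def)
      have p11: "1 \<le> p1" using P(6)[OF p1(1)] by simp
      have bound: "p1 + N < i \<and> real (ht h (p1 + N)) / real t + 1 \<le> e / 4 * real i"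
      proof (cases "p1 = P")
        case True
        have "real (ht h (P + N)) / real t \<le> real (ht h (P + N))"
          using t mult_right_mono[of 1 "real t" "real (ht h (P + N))"] by (simp add: field_simps)
        then have "real (ht h (P + N)) / real t + 1 \<le> e / 4 * real i" using elim(1) by linarith
        then show ?thesis using True elim(2) by simp
      next
        case False
        define p where "p = p1 - 1"
        have p: "p1 = Suc p" "P \<le> p" using False p1 p11 by (auto simp: p_def)
        then have "\<not> Q p" unfolding p1_def by (metis lessI not_less_Least p1_def)
        then have tp: "\<eta> * real (ht h p) < 2 * real t" using p by (simp add: Q_def)
        have H: "0 < real (ht h p)" using ht_real_pos P(5)[OF p(2)] by simp
        have N': "Suc N \<le> p" using P(6)[OF p(2)] .
        have "3 * real p < real t" using P(3)[OF p(2)] tp by linarith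
        then have 1: "p1 + N < i" using p N' t by linarith
        have "ht h (p1 + N) \<le> (2 * (p + Suc N)) ^ Suc N * ht h p"
          using ht_growth[OF h_pos, of p "Suc N"] N' p by simp
        also have "\<dots> \<le> (4 * p) ^ Suc N * ht h p"
          using N' by (intro mult_le_mono1 power_mono) auto
        finally have "real (ht h (p1 + N)) \<le> real ((4 * p) ^ Suc N * ht h p)" by (simp only: of_nat_le_iff)
        then have "real (ht h (p1 + N)) \<le> (4 * real p) ^ Suc N * real (ht h p)" by simp
        also have "\<dots> \<le> (4 * real p) ^ Suc N * (2 / \<eta> * real t)"
          using tp \<eta> by (intro mult_left_mono) (auto simp: field_simps)
        finally have "real (ht h (p1 + N)) / real t \<le> (4 * real p) ^ Suc N * (2 / \<eta>)"
          using t by (simp add: field_simps)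
        also have "\<dots> = (2 / \<eta>) * 4 ^ Suc N * real p ^ Suc N" by (simp add: power_mult_distrib)
        finally have "real (ht h (p1 + N)) / real t + 1 \<le> (2 / \<eta>) * 4 ^ Suc N * real p ^ Suc N + 1 * real p ^ Suc N"
          using N' one_le_power[of "real p" "Suc N"] by simp
        also have "\<dots> = A * real p ^ Suc N" by (simp only: A_def distrib_right)
        also have "\<dots> \<le> e * \<eta> / 8 * real (ht h p)" by (rule P(2)[OF p(2)])
        also have "\<dots> = e / 8 * (\<eta> * real (ht h p))" by simp
        also have "\<dots> \<le> e / 8 * (2 * real t)" using tp assms by (intro mult_left_mono) auto
        also have "\<dots> \<le> e / 4 * real i" using t assms by simp
        finally show ?thesis using 1 by simp
      qed
      \<comment> \<open>\<open>t * g a\<close> is the least multiple of \<open>t\<close> that is not below the height of stage \<open>p1 + a\<close>.\<close>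
      define g where "g = (\<lambda>a. (ht h (p1 + a) + (t - 1)) div t)"
      have g_low: "ht h (p1 + a) \<le> t * g a" for a
      proof -
        have "ht h (p1 + a) + (t - 1) = t * g a + (ht h (p1 + a) + (t - 1)) mod t"
          by (simp add: g_def)
        moreover have "(ht h (p1 + a) + (t - 1)) mod t < t" using t by simp
        ultimately show ?thesis by linarith
      qed
      have g_up: "t * g a \<le> ht h (p1 + a) + (t - 1)" for a by (simp add: g_def)
      define E where "E = ht h (p1 + N) div t + 1"
      have gE: "g a \<le> E" if "a < N" for a
      proof -
        have "ht h (p1 + a) \<le> ht h (p1 + N)" using that p11 by (intro ht_mono) auto
        then have "g a \<le> (ht h (p1 + N) + t) div t" unfolding g_def by (intro div_le_mono) simp
        then show ?thesis using t by (simp add: E_def)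
      qed
      have E: "real E \<le> e / 4 * real i"
      proof -
        have "real (ht h (p1 + N) div t) \<le> real (ht h (p1 + N)) / real t" by (simp add: of_nat_div_le_of_nat)
        moreover have "real E = real (ht h (p1 + N) div t) + 1" by (simp add: E_def)
        ultimately show ?thesis using bound by linarith
      qed
      have "corr i (int t * (int (g b) - int (g a))) \<le> c * real (ht h i)" if ab: "a < b" "b < N" for a b
      proof -
        let ?h = "\<lambda>a. real (ht h (p1 + a))"
        have low: "?h a \<le> real t * real (g a)" for a
          using g_low[of a] by (metis of_nat_le_iff of_nat_mult)
        have up: "real t * real (g a) \<le> ?h a + real t" for a
          using g_up[of a] by (metis add_leD2 add_le_mono diff_le_self le_refl le_trans of_nat_add of_nat_le_iff of_nat_mult)
        have "(p1 + a) * ht h (p1 + a) \<le> ht h (Suc (p1 + a))" using p11 by (intro ht_Suc_ge) simp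
        also have "\<dots> \<le> ht h (p1 + b)" using ab p11 by (intro ht_mono) auto
        finally have "real ((p1 + a) * ht h (p1 + a)) \<le> ?h b" by (simp only: of_nat_le_iff)
        moreover have "2 / \<eta> * ?h a \<le> real (p1 + a) * ?h a"
          using P(4)[of "p1 + a"] p1 by (intro mult_right_mono) auto
        ultimately have "2 / \<eta> * ?h a \<le> ?h b" by simp
        then have 1: "?h a \<le> \<eta> / 2 * ?h b" using \<eta> by (simp add: field_simps)
        have "ht h p1 \<le> ht h (p1 + b)" using p11 by (intro ht_mono) auto
        then have "\<eta> * real (ht h p1) \<le> \<eta> * ?h b" using \<eta> by (intro mult_left_mono) auto
        then have 2: "real t \<le> \<eta> / 2 * ?h b" using p1 by simp
        have "0 \<le> ?h a" by simp
        then have "\<bar>real_of_int (int t * (int (g b) - int (g a))) - ?h b\<bar> \<le> \<eta> * ?h b"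
          using 1 2 low[of a] low[of b] up[of a] up[of b] by (simp add: right_diff_distrib)
        then have "\<bar>corr i (int t * (int (g b) - int (g a)))\<bar> \<le> c * real (ht h i)"
          using p1 ab bound by (intro P(1)[of "p1 + b"]) auto
        then show ?thesis by linarith
      qed
      then have "(\<Sum>n\<in>S. \<bar>\<Sum>k<L. Y i (n - int t * int k)\<bar>)
          \<le> real L * real (ht h i) * sqrt (1 / real N + c) + 2 * real E * real (ht h i)"
        using P(5)[of i] elim(2) c N gE S by (intro progression_by_averaging[where e = g]) auto
      also have "\<dots> \<le> real i * real (ht h i) * (e / 2) + 2 * (e / 4 * real i) * real (ht h i)"
        using L root E c by (intro add_mono mult_mono) auto
      also have "\<dots> = e * real i * real (ht h i)" by (simp add: algebra_simps)
      finally show "(\<Sum>n\<in>S. \<bar>\<Sum>k<L. Y i (n - int t * int k)\<bar>) \<le> e * real i * real (ht h i)" .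
    qed
  qed
qed

end

section \<open>Autocorrelation at macroscopic shifts\<close>

lemma sum_translate_int:
  "(\<Sum>n\<in>{a..<b}. f (n + c)) = (\<Sum>n\<in>{a + c..<b + c}. f n)" for a b c :: int
proof -
  have "{a + c..<b + c} = (\<lambda>n. n + c) ` {a..<b}"
  proof (intro set_eqI iffI)
    fix x assume "x \<in> {a + c..<b + c}"
    then show "x \<in> (\<lambda>n. n + c) ` {a..<b}" by (intro image_eqI[of _ _ "x - c"]) auto
  qed auto
  moreover have "sum f ((\<lambda>n. n + c) ` {a..<b}) = (\<Sum>n\<in>{a..<b}. f (n + c))"
    by (subst sum.reindex) (auto simp: inj_on_def)
  ultimately show ?thesis by simp
qed

context staircase_word
begin

text \<open>
  A prefix consists of \<open>L\<close> complete copies of the previous word, at most one incomplete copy, and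
  spacers.
\<close>

lemma prefix_expansion:
  assumes "m \<le> i" "b \<le> int (ht h (Suc i))"
  obtains L where "L \<le> i"
    "\<bar>(\<Sum>n\<in>{0..<b}. Y (Suc i) n * Y (Suc i) (n + s))
      - (\<Sum>l<L. \<Sum>l'<i. corr i (s + pos h i l - pos h i l'))\<bar>
      \<le> real (i ^ 2) + real (ht h i) + real i * real (i ^ 2)"
proof
  let ?H = "int (ht h i)"
  let ?j = "Suc i"
  define L where "L = (LEAST l. \<not> (l < i \<and> pos h i l + ?H \<le> b))"
  have "\<not> (i < i \<and> pos h i i + ?H \<le> b)" by simp
  then have Li: "L \<le> i" unfolding L_def by (rule Least_le)
  show "L \<le> i" by (rule Li)
  have below: "pos h i l + ?H \<le> b" if "l < L" for l
    using not_less_Least[of l "\<lambda>l. \<not> (l < i \<and> pos h i l + ?H \<le> b)"] that by (auto simp: L_def)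
  have at: "\<not> (L < i \<and> pos h i L + ?H \<le> b)"
    unfolding L_def by (rule LeastI[of "\<lambda>l. \<not> (l < i \<and> pos h i l + ?H \<le> b)" i]) simp
  define A where "A = (\<lambda>l. \<Sum>n\<in>{0..<b}. Y i (n + 0 - pos h i l) * Y ?j (n + s))"
  define B where "B = (\<lambda>l. \<Sum>n\<in>{0..<?H}. Y i n * Y ?j (n + (s + pos h i l)))"
  have 1: "\<bar>(\<Sum>n\<in>{0..<b}. Y ?j n * Y ?j (n + s)) - (\<Sum>l<i. A l)\<bar> \<le> real (i ^ 2)"
    using expand_left[OF assms(1) finite_atLeastLessThan_int bounded,
        where c = 0] by (simp add: A_def)
  have shift: "A l = (\<Sum>n\<in>{- pos h i l..<b - pos h i l}. Y i n * Y ?j (n + (s + pos h i l)))" for l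
    unfolding A_def
    using sum_translate_int[where f = "\<lambda>n. Y i n * Y ?j (n + (s + pos h i l))"
        and c = "- pos h i l" and a = 0 and b = b]
    by (simp add: algebra_simps)
  have restrict: "A l = (\<Sum>n\<in>{- pos h i l..<b - pos h i l} \<inter> {0..<?H}. Y i n * Y ?j (n + (s + pos h i l)))" for l
    unfolding shift using support[OF assms(1)] by (intro sum.mono_neutral_right) force+
  have row: "\<bar>A l - (if l < L then B l else 0)\<bar> \<le> (if l = L then real (ht h i) else 0)" if "l < i" for l
  proof -
    consider "l < L" | "l = L" | "L < l" by linarith
    then show ?thesis
    proof cases
      case 1
      then have "{- pos h i l..<b - pos h i l} \<inter> {0..<?H} = {0..<?H}"
        using below[OF 1] pos_nonneg[of h i l] by auto
      then have "A l = B l" unfolding restrict B_def by simp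
      then show ?thesis using 1 by simp
    next
      case 2
      have "\<bar>A l\<bar> \<le> (\<Sum>n\<in>{- pos h i l..<b - pos h i l} \<inter> {0..<?H}. \<bar>Y i n * Y ?j (n + (s + pos h i l))\<bar>)"
        unfolding restrict by (rule sum_abs)
      also have "\<dots> \<le> (\<Sum>n\<in>{- pos h i l..<b - pos h i l} \<inter> {0..<?H}. 1)"
        using bounded by (intro sum_mono) (simp add: abs_mult mult_le_one)
      also have "\<dots> \<le> (\<Sum>n\<in>{0..<?H}. 1)" by (intro sum_mono2) auto
      finally show ?thesis using 2 by simp
    next
      case 3
      then have l: "l = L + (l - L)" "1 \<le> int (l - L)" by auto
      then have e: "pos h i l = pos h i L + int (l - L) * ?H + int (tri (l - L)) + int L * int (l - L)"
        using pos_add by metis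
      have "1 * ?H \<le> int (l - L) * ?H" using l(2) by (rule mult_right_mono) simp
      moreover have "0 \<le> int L * int (l - L)" by simp
      moreover have "b < pos h i L + ?H" using at 3 that by simp
      ultimately have "b - pos h i l < 0" using e by linarith
      then have "{- pos h i l..<b - pos h i l} \<inter> {0..<?H} = {}" by auto
      then have "A l = 0" unfolding restrict by (simp only: sum.empty)
      then show ?thesis using 3 by simp
    qed
  qed
  have "(\<Sum>l<i. if l < L then B l else 0) = (\<Sum>l<L. B l)"
    using Li by (intro sum.mono_neutral_cong_right) auto
  then have "\<bar>(\<Sum>l<i. A l) - (\<Sum>l<L. B l)\<bar> = \<bar>\<Sum>l<i. A l - (if l < L then B l else 0)\<bar>"
    by (simp add: sum_subtractf)
  also have "\<dots> \<le> (\<Sum>l<i. if l = L then real (ht h i) else 0)"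
    using row by (intro order_trans[OF sum_abs sum_mono]) auto
  also have "\<dots> \<le> real (ht h i)" by simp
  finally have 2: "\<bar>(\<Sum>l<i. A l) - (\<Sum>l<L. B l)\<bar> \<le> real (ht h i)" .
  have "\<bar>B l - (\<Sum>l'<i. corr i (s + pos h i l - pos h i l'))\<bar> \<le> real (i ^ 2)" for l
  proof -
    have "\<bar>(\<Sum>n\<in>{0..<?H}. Y ?j (n + (s + pos h i l)) * Y i n)
       - (\<Sum>l'<i. \<Sum>n\<in>{0..<?H}. Y i (n + (s + pos h i l) - pos h i l') * Y i n)\<bar> \<le> real (i ^ 2)"
      by (rule expand_left[OF assms(1) finite_atLeastLessThan_int bounded])
    then show ?thesis by (simp add: B_def corr_def mult.commute algebra_simps)
  qed
  then have "\<bar>(\<Sum>l<L. B l) - (\<Sum>l<L. \<Sum>l'<i. corr i (s + pos h i l - pos h i l'))\<bar> \<le> (\<Sum>l<L. real (i ^ 2))"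
    unfolding sum_subtractf[symmetric] by (intro order_trans[OF sum_abs sum_mono])
  also have "\<dots> \<le> real i * real (i ^ 2)" using Li by (simp add: mult_right_mono)
  finally show "\<bar>(\<Sum>n\<in>{0..<b}. Y ?j n * Y ?j (n + s))
      - (\<Sum>l<L. \<Sum>l'<i. corr i (s + pos h i l - pos h i l'))\<bar>
      \<le> real (i ^ 2) + real (ht h i) + real i * real (i ^ 2)"
    using 1 2 by linarith
qed

text \<open>
  Copies \<open>l\<close> and \<open>l + d\<close> meet with shift \<open>s - d * ht h i - tri d - d * l\<close>, a progression in \<open>l\<close> of step
  \<open>d\<close>. Overlapping copies exist for at most three values of \<open>d\<close>, because spacers shift the copies by
  at most a height.
\<close>

lemma block_pairs_le:
  assumes "m \<le> i" "L \<le> i" "i ^ 2 \<le> ht h i" "int (ht h i) * 3 \<le> s" and c: "0 \<le> c"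
    and AP: "\<And>d L S. 1 \<le> d \<Longrightarrow> d \<le> i \<Longrightarrow> L \<le> i \<Longrightarrow> finite S \<Longrightarrow> card S \<le> ht h i \<Longrightarrow>
      (\<Sum>n\<in>S. \<bar>\<Sum>k<L. Y i (n - int d * int k)\<bar>) \<le> c"
  shows "\<bar>\<Sum>l<L. \<Sum>l'<i. corr i (s + pos h i l - pos h i l')\<bar> \<le> 3 * c"
proof -
  let ?H = "int (ht h i)"
  have H: "0 < ?H" using ht_real_pos[OF assms(1)] by simp
  define f where "f = (\<lambda>l l'. corr i (s + pos h i l - pos h i l'))"
  have rows: "(\<Sum>l'<i. f l l') = (\<Sum>d\<in>{1..<i}. if l + d < i then f l (l + d) else 0)" for l
  proof -
    have zero: "f l l' = 0" if "l' \<le> l" for l'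
    proof -
      have "pos h i l = pos h i l' + int (l - l') * ?H + int (tri (l - l')) + int l' * int (l - l')"
        using that pos_add[of h i l' "l - l'"] by simp
      moreover have "0 \<le> int (l - l') * ?H" "0 \<le> int l' * int (l - l')" by simp_all
      ultimately have "?H \<le> s + pos h i l - pos h i l'" using assms(4) H by linarith
      then show ?thesis unfolding f_def by (intro corr_eq_0[OF assms(1)]) linarith
    qed
    have "(\<Sum>l'<i. f l l') = (\<Sum>l'\<in>{l<..<i}. f l l')"
      using zero by (intro sum.mono_neutral_right) auto
    also have "{l<..<i} = (\<lambda>d. l + d) ` {d\<in>{1..<i}. l + d < i}"
    proof (intro set_eqI iffI)
      fix x assume "x \<in> {l<..<i}"
      then show "x \<in> (\<lambda>d. l + d) ` {d\<in>{1..<i}. l + d < i}" by (intro image_eqI[of _ _ "x - l"]) auto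
    qed auto
    also have "(\<Sum>l'\<in>(\<lambda>d. l + d) ` {d\<in>{1..<i}. l + d < i}. f l l') = (\<Sum>d\<in>{d\<in>{1..<i}. l + d < i}. f l (l + d))"
      by (subst sum.reindex) auto
    also have "\<dots> = (\<Sum>d\<in>{1..<i}. if l + d < i then f l (l + d) else 0)"
      by (intro sum.mono_neutral_cong_left) auto
    finally show ?thesis .
  qed
  define t where "t = nat (s div ?H)"
  have t: "int t * ?H \<le> s" "s < int t * ?H + ?H"
  proof -
    have "0 \<le> s div ?H" using assms(4) H by (simp add: pos_imp_zdiv_nonneg_iff)
    then have e: "int t = s div ?H" by (simp add: t_def)
    have "s = s div ?H * ?H + s mod ?H" by simp
    moreover have "0 \<le> s mod ?H" "s mod ?H < ?H" using H by auto
    ultimately show "int t * ?H \<le> s" "s < int t * ?H + ?H" unfolding e by linarith+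
  qed
  have col: "\<bar>\<Sum>l<L. if l + d < i then f l (l + d) else 0\<bar> \<le> (if d \<in> {t - 1..t + 1} then c else 0)"
    if d: "1 \<le> d" "d < i" for d
  proof (cases "d \<in> {t - 1..t + 1}")
    case True
    have "(\<Sum>l<L. if l + d < i then f l (l + d) else 0) = (\<Sum>l<min L (i - d). f l (l + d))"
      by (intro sum.mono_neutral_cong_right) auto
    also have "\<dots> = (\<Sum>l<min L (i - d). corr i ((s - int d * ?H - int (tri d)) - int d * int l))"
      unfolding f_def pos_add by (intro sum.cong refl arg_cong[where f = "corr i"]) (simp add: algebra_simps)
    also have "\<bar>\<dots>\<bar> \<le> c"
      by (rule order_trans[OF corr_progression_le AP]) (use d assms in auto)
    finally show ?thesis using True by simp
  next
    case False
    have "f l (l + d) = 0" if "l + d < i" for l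
    proof -
      have "tri (l + d) \<le> i ^ 2"
      proof -
        have "tri (l + d) \<le> (l + d) ^ 2" by (rule tri_le_square)
        also have "\<dots> \<le> i ^ 2" using that by (intro power_mono) auto
        finally show ?thesis .
      qed
      then have small: "int (tri d) + int l * int d \<le> ?H"
        using assms(3) unfolding tri_add of_nat_mult[symmetric] of_nat_add[symmetric] of_nat_le_iff by linarith
      have z: "s + pos h i l - pos h i (l + d) = s - int d * ?H - (int (tri d) + int l * int d)"
        by (simp add: pos_add)
      have nn: "0 \<le> int (tri d) + int l * int d" by simp
      consider "d + 2 \<le> t" | "t + 2 \<le> d" using False by fastforce
      then have "?H \<le> \<bar>s + pos h i l - pos h i (l + d)\<bar>"
      proof cases
        case 1
        then have "(int d + 2) * ?H \<le> int t * ?H" using H by (intro mult_right_mono) auto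
        then have "int d * ?H + 2 * ?H \<le> int t * ?H" by (simp only: distrib_right)
        then show ?thesis using z small t by linarith
      next
        case 2
        then have "(int t + 2) * ?H \<le> int d * ?H" using H by (intro mult_right_mono) auto
        then have "int t * ?H + 2 * ?H \<le> int d * ?H" by (simp only: distrib_right)
        then show ?thesis using z nn t by linarith
      qed
      then show ?thesis unfolding f_def by (rule corr_eq_0[OF assms(1)])
    qed
    then have "(\<Sum>l<L. if l + d < i then f l (l + d) else 0) = 0" by (intro sum.neutral) auto
    then show ?thesis using c by simp
  qed
  have "(\<Sum>l<L. \<Sum>l'<i. f l l') = (\<Sum>d\<in>{1..<i}. \<Sum>l<L. if l + d < i then f l (l + d) else 0)"
    unfolding rows by (rule sum.swap)
  also have "\<bar>\<dots>\<bar> \<le> (\<Sum>d\<in>{1..<i}. if d \<in> {t - 1..t + 1} then c else 0)"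
    using col by (intro order_trans[OF sum_abs sum_mono]) auto
  also have "\<dots> = real (card ({1..<i} \<inter> {t - 1..t + 1})) * c"
    by (simp add: sum.If_cases Int_def)
  also have "\<dots> \<le> 3 * c"
  proof (intro mult_right_mono c)
    have "card ({1..<i} \<inter> {t - 1..t + 1}) \<le> card {t - 1..t + 1}" by (intro card_mono) auto
    also have "\<dots> \<le> 3" by simp
    finally show "real (card ({1..<i} \<inter> {t - 1..t + 1})) \<le> 3" by simp
  qed
  finally show ?thesis by (simp add: f_def)
qed

end

context balanced_word
begin

lemma prefix_correlation:
  assumes "0 < e" "0 < \<delta>"
  shows "\<forall>\<^sub>F j in sequentially. \<forall>b s. b \<le> int (ht h j) \<longrightarrow> \<delta> * real (ht h j) \<le> real_of_int s \<longrightarrow>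
    \<bar>\<Sum>n\<in>{0..<b}. Y j n * Y j (n + s)\<bar> \<le> e * real (ht h j)"
proof -
  have 1: "\<forall>\<^sub>F i in sequentially. 2 * real i ^ 2 \<le> min 1 (e / 4) * real (ht h i)"
    using assms by (intro power_le_ht[OF h_pos]) simp
  have 2: "\<forall>\<^sub>F i in sequentially. 4 / e \<le> real i" "\<forall>\<^sub>F i in sequentially. 3 / \<delta> \<le> real i"
    using filterlim_real_sequentially by (auto simp: filterlim_at_top)
  have "\<forall>\<^sub>F i in sequentially. \<forall>b s. b \<le> int (ht h (Suc i)) \<longrightarrow> \<delta> * real (ht h (Suc i)) \<le> real_of_int s \<longrightarrow>
    \<bar>\<Sum>n\<in>{0..<b}. Y (Suc i) n * Y (Suc i) (n + s)\<bar> \<le> e * real (ht h (Suc i))"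
    using 1 2 progression_average[of "e / 6", OF divide_pos_pos[OF assms(1) zero_less_numeral]]
      eventually_ge_at_top[of m] eventually_ge_at_top[of 1]
  proof eventually_elim
    case (elim i)
    let ?H = "real (ht h i)"
    have m1: "min 1 (e / 4) * ?H \<le> 1 * ?H" "min 1 (e / 4) * ?H \<le> e / 4 * ?H"
      by (intro mult_right_mono; simp)+
    then have sq: "2 * real i ^ 2 \<le> ?H" "2 * real i ^ 2 \<le> e / 4 * ?H" using elim(1) by linarith+
    have "i * ht h i \<le> ht h (Suc i)" using elim by (intro ht_Suc_ge)
    then have "real (i * ht h i) \<le> real (ht h (Suc i))" by (simp only: of_nat_le_iff)
    then have iH: "real i * ?H \<le> real (ht h (Suc i))" by simp
    show ?case
    proof (intro allI impI)
      fix b s assume b: "b \<le> int (ht h (Suc i))" and s: "\<delta> * real (ht h (Suc i)) \<le> real_of_int s"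
      obtain L where L: "L \<le> i"
        "\<bar>(\<Sum>n\<in>{0..<b}. Y (Suc i) n * Y (Suc i) (n + s))
          - (\<Sum>l<L. \<Sum>l'<i. corr i (s + pos h i l - pos h i l'))\<bar>
          \<le> real (i ^ 2) + ?H + real i * real (i ^ 2)"
        using prefix_expansion[OF elim(5) b, of s] by blast
      have "\<bar>\<Sum>l<L. \<Sum>l'<i. corr i (s + pos h i l - pos h i l')\<bar> \<le> 3 * (e / 6 * real i * ?H)"
      proof (rule block_pairs_le[OF elim(5) L(1)])
        have "real i ^ 2 \<le> ?H" using sq(1) zero_le_power2[of "real i"] by linarith
        then show "i ^ 2 \<le> ht h i" by (metis of_nat_le_iff of_nat_power)
        have "3 \<le> \<delta> * real i" using elim(3) assms by (simp add: field_simps)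
        then have "3 * ?H \<le> (\<delta> * real i) * ?H" by (rule mult_right_mono) simp
        also have "\<dots> = \<delta> * (real i * ?H)" by simp
        also have "\<dots> \<le> \<delta> * real (ht h (Suc i))" using iH assms by (intro mult_left_mono) auto
        finally have "3 * ?H \<le> real_of_int s" using s by linarith
        then show "int (ht h i) * 3 \<le> s" by linarith
      qed (use elim assms in auto)
      moreover have "?H \<le> e / 4 * (real i * ?H)"
      proof -
        have "1 \<le> e / 4 * real i" using elim(2) assms by (simp add: field_simps)
        then have "1 * ?H \<le> (e / 4 * real i) * ?H" by (rule mult_right_mono) simp
        then show ?thesis by simp
      qed
      moreover have "real (i ^ 2) + real i * real (i ^ 2) \<le> e / 4 * (real i * ?H)"
      proof -
        have "1 * real (i ^ 2) \<le> real i * real (i ^ 2)" using elim by (intro mult_right_mono) auto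
        then have "real (i ^ 2) + real i * real (i ^ 2) \<le> real i * (2 * real i ^ 2)" by simp
        also have "\<dots> \<le> real i * (e / 4 * ?H)" by (intro mult_left_mono sq) simp
        also have "\<dots> = e / 4 * (real i * ?H)" by (rule mult.left_commute)
        finally show ?thesis .
      qed
      moreover have "3 * (e / 6 * real i * ?H) = e / 2 * (real i * ?H)" by simp
      moreover have "e * (real i * ?H) = e / 2 * (real i * ?H) + e / 4 * (real i * ?H) + e / 4 * (real i * ?H)"
        by simp
      moreover have "e * (real i * ?H) \<le> e * real (ht h (Suc i))" using iH assms by (intro mult_left_mono) auto
      ultimately show "\<bar>\<Sum>n\<in>{0..<b}. Y (Suc i) n * Y (Suc i) (n + s)\<bar> \<le> e * real (ht h (Suc i))"
        using L(2) by linarith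
    qed
  qed
  then show ?thesis by (subst (asm) eventually_sequentially_Suc)
qed

text \<open>
  Translation reduces this to an interval at which one factor is untranslated, and that interval is a
  difference of two prefixes.
\<close>

lemma interval_correlation:
  assumes "0 < e" "0 < \<delta>"
  shows "\<forall>\<^sub>F j in sequentially. \<forall>a b u v. \<delta> * real (ht h j) \<le> \<bar>real_of_int u - real_of_int v\<bar> \<longrightarrow>
    \<bar>\<Sum>n\<in>{a..<b}. Y j (n + u) * Y j (n + v)\<bar> \<le> e * real (ht h j)"
  using prefix_correlation[of "e / 2", OF divide_pos_pos[OF assms(1) zero_less_numeral] assms(2)]
    eventually_ge_at_top[of m]
proof eventually_elim
  case (elim j)
  let ?H = "int (ht h j)"
  have ordered: "\<bar>\<Sum>n\<in>{a..<b}. Y j (n + u) * Y j (n + v)\<bar> \<le> e * real (ht h j)"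
    if uv: "\<delta> * real (ht h j) \<le> real_of_int v - real_of_int u" for a b u v
  proof (cases "a < b")
    case False
    then show ?thesis using assms by simp
  next
    case True
    define F where "F = (\<lambda>n. Y j n * Y j (n + (v - u)))"
    define cl where "cl = (\<lambda>x. max 0 (min x ?H))"
    have "(\<Sum>n\<in>{a..<b}. Y j (n + u) * Y j (n + v)) = (\<Sum>n\<in>{a + u..<b + u}. F n)"
      using sum_translate_int[where f = F and c = u and a = a and b = b]
      by (simp add: F_def algebra_simps)
    also have "\<dots> = (\<Sum>n\<in>{cl (a + u)..<cl (b + u)}. F n)"
      using support[OF elim(2)]
      by (intro sum.mono_neutral_right) (fastforce simp: cl_def F_def min_def max_def split: if_splits)+
    also have "\<dots> = (\<Sum>n\<in>{0..<cl (b + u)}. F n) - (\<Sum>n\<in>{0..<cl (a + u)}. F n)"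
    proof -
      have "cl (a + u) \<le> cl (b + u)" "0 \<le> cl (a + u)" using True by (auto simp: cl_def)
      then have "{0..<cl (b + u)} = {0..<cl (a + u)} \<union> {cl (a + u)..<cl (b + u)}" by auto
      then have "(\<Sum>n\<in>{0..<cl (b + u)}. F n) = (\<Sum>n\<in>{0..<cl (a + u)}. F n) + (\<Sum>n\<in>{cl (a + u)..<cl (b + u)}. F n)"
        by (simp only:) (rule sum.union_disjoint; auto)
      then show ?thesis by simp
    qed
    finally have eq: "(\<Sum>n\<in>{a..<b}. Y j (n + u) * Y j (n + v)) = (\<Sum>n\<in>{0..<cl (b + u)}. F n) - (\<Sum>n\<in>{0..<cl (a + u)}. F n)" .
    have p: "\<bar>\<Sum>n\<in>{0..<cl x}. F n\<bar> \<le> e / 2 * real (ht h j)" for x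
      unfolding F_def using uv elim(1)[rule_format, of "cl x" "v - u"] by (simp add: cl_def)
    have "e * real (ht h j) = e / 2 * real (ht h j) + e / 2 * real (ht h j)" by simp
    then show ?thesis using eq p[of "a + u"] p[of "b + u"] by linarith
  qed
  show ?case
  proof (intro allI impI)
    fix a b u v assume uv: "\<delta> * real (ht h j) \<le> \<bar>real_of_int u - real_of_int v\<bar>"
    show "\<bar>\<Sum>n\<in>{a..<b}. Y j (n + u) * Y j (n + v)\<bar> \<le> e * real (ht h j)"
    proof (cases "u \<le> v")
      case True
      then show ?thesis using ordered[of v u a b] uv by simp
    next
      case False
      then show ?thesis using ordered[of u v a b] uv by (simp add: mult.commute)
    qed
  qed
qed

end

section \<open>Correlation of two staircases\<close>

context staircase_word
begin

lemma blocks_meeting_interval: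
  assumes "j ^ 2 \<le> ht h j" "1 \<le> j" "H' \<le> (M + 1) * ht h j"
    and A: "A \<subseteq> {l. l < j \<and> - int (ht h j) < pos h j l - u \<and> pos h j l - u < int H'}"
  shows "card A \<le> M + 3"
proof -
  let ?H = "int (ht h j)"
  have H: "0 < ?H" using ht_pos[OF h_pos assms(2)] by simp
  define q where "q = u div ?H"
  have q: "q * ?H \<le> u" "u < q * ?H + ?H"
  proof -
    have "u = q * ?H + u mod ?H" by (simp add: q_def)
    moreover have "0 \<le> u mod ?H" "u mod ?H < ?H" using H by auto
    ultimately show "q * ?H \<le> u" "u < q * ?H + ?H" by linarith+
  qed
  have "int ` A \<subseteq> {q - 1..<q + int M + 2}"
  proof (intro image_subsetI)
    fix l assume "l \<in> A"
    then have l: "l < j" "- ?H < pos h j l - u" "pos h j l - u < int H'" using A by auto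
    have "tri l \<le> l ^ 2" by (rule tri_le_square)
    also have "\<dots> \<le> j ^ 2" using l by (intro power_mono) auto
    finally have "tri l \<le> ht h j" using assms(1) by simp
    then have p: "int l * ?H \<le> pos h j l" "pos h j l \<le> int l * ?H + ?H" by (simp_all add: pos_def)
    have "q * ?H < (int l + 2) * ?H" using p l q by (simp add: distrib_right)
    then have 1: "q < int l + 2" using H by (simp only: mult_less_cancel_right_pos)
    have "int H' \<le> int ((M + 1) * ht h j)" using assms(3) by (simp only: of_nat_le_iff)
    then have "int l * ?H < (q + int M + 2) * ?H" using p l q by (simp add: distrib_right)
    then have "int l < q + int M + 2" using H by (simp only: mult_less_cancel_right_pos)
    then show "int l \<in> {q - 1..<q + int M + 2}" using 1 by auto
  qed
  then have "card (int ` A) \<le> card {q - 1..<q + int M + 2}" by (intro card_mono) auto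
  then show ?thesis by (simp add: card_image)
qed

lemma window_correlation_le:
  assumes "m \<le> j" "j ^ 2 \<le> ht h j" "H' \<le> (M + 1) * ht h j" "0 \<le> c"
    and far: "\<And>l l'. l < j \<Longrightarrow> l' < j \<Longrightarrow>
      \<delta> * real (ht h j) \<le> \<bar>real_of_int (u - pos h j l) - real_of_int (v - pos h j l')\<bar>"
    and dec: "\<And>a b u v. \<delta> * real (ht h j) \<le> \<bar>real_of_int u - real_of_int v\<bar> \<Longrightarrow>
      \<bar>\<Sum>n\<in>{a..<b}. Y j (n + u) * Y j (n + v)\<bar> \<le> c"
  shows "\<bar>\<Sum>n\<in>{0..<int H'}. Y (Suc j) (n + u) * Y (Suc j) (n + v)\<bar>
    \<le> 2 * real (j ^ 2) + real ((M + 3) ^ 2) * c"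
proof -
  define A where "A = (\<lambda>u. {l. l < j \<and> - int (ht h j) < pos h j l - u \<and> pos h j l - u < int H'})"
  have fin: "finite (A u)" for u by (simp add: A_def)
  have cardA: "card (A u) \<le> M + 3" for u
    using assms(1) m_ge by (intro blocks_meeting_interval[OF assms(2) _ assms(3)]) (auto simp: A_def)
  define g where "g = (\<lambda>l l'. \<Sum>n\<in>{0..<int H'}. Y j (n + u - pos h j l) * Y j (n + v - pos h j l'))"
  have pt: "\<bar>g l l'\<bar> \<le> (if l \<in> A u then if l' \<in> A v then c else 0 else 0)" if "l < j" "l' < j" for l l'
  proof (cases "l \<in> A u \<and> l' \<in> A v")
    case True
    have "g l l' = (\<Sum>n\<in>{0..<int H'}. Y j (n + (u - pos h j l)) * Y j (n + (v - pos h j l')))"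
      by (simp add: g_def algebra_simps)
    then show ?thesis using True dec[OF far[OF that], of 0 "int H'"] by simp
  next
    case False
    have zero: "Y j (n + u - pos h j l) = 0" if "l < j" "l \<notin> A u" "n \<in> {0..<int H'}" for l u n
    proof (rule ccontr)
      assume "Y j (n + u - pos h j l) \<noteq> 0"
      then have "0 \<le> n + u - pos h j l" "n + u - pos h j l < int (ht h j)"
        using support[OF assms(1), of "n + u - pos h j l"] by blast+
      then show False using that by (auto simp: A_def)
    qed
    have "Y j (n + u - pos h j l) * Y j (n + v - pos h j l') = 0" if "n \<in> {0..<int H'}" for n
      using False zero[OF \<open>l < j\<close> _ that, of u] zero[OF \<open>l' < j\<close> _ that, of v] by auto
    then have "g l l' = 0" unfolding g_def by (intro sum.neutral) auto
    then show ?thesis using assms(4) by simp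
  qed
  have "\<bar>\<Sum>l<j. \<Sum>l'<j. g l l'\<bar> \<le> (\<Sum>l<j. \<Sum>l'<j. if l \<in> A u then if l' \<in> A v then c else 0 else 0)"
  proof (rule order_trans[OF sum_abs sum_mono])
    fix l assume "l \<in> {..<j}"
    then show "\<bar>\<Sum>l'<j. g l l'\<bar> \<le> (\<Sum>l'<j. if l \<in> A u then if l' \<in> A v then c else 0 else 0)"
      using pt by (intro order_trans[OF sum_abs sum_mono]) auto
  qed
  also have "\<dots> = (\<Sum>l<j. if l \<in> A u then (\<Sum>l'<j. if l' \<in> A v then c else 0) else 0)"
    by (intro sum.cong) auto
  also have "\<dots> = real (card (A u)) * (real (card (A v)) * c)"
  proof -
    have "{..<j} \<inter> A u = A u" for u by (auto simp: A_def)
    then show ?thesis by (simp add: sum.If_cases Int_def[symmetric])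
  qed
  also have "\<dots> = real (card (A u) * card (A v)) * c" by simp
  also have "\<dots> \<le> real ((M + 3) ^ 2) * c"
  proof (intro mult_right_mono assms(4))
    have "card (A u) * card (A v) \<le> (M + 3) * (M + 3)" by (intro mult_le_mono cardA)
    then show "real (card (A u) * card (A v)) \<le> real ((M + 3) ^ 2)"
      unfolding power2_eq_square by (simp only: of_nat_le_iff)
  qed
  finally show ?thesis
    using expand_both[of j "{0..<int H'}" u v, OF assms(1) finite_atLeastLessThan_int]
    unfolding g_def by linarith
qed

end

text \<open>
  The copies of \<open>X j\<close> occur in \<open>X (Suc j)\<close> at the positions \<open>pos h' j k\<close>. Averaging over \<open>R\<close> consecutive copies
  and applying van der Corput eliminates \<open>X\<close> and leaves autocorrelations of \<open>Y (Suc j)\<close> at lags close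
  to \<open>D * ht h' j\<close> with \<open>1 \<le> D < R\<close>. These lags stay away from the multiples of \<open>ht h j\<close>, so copies
  of \<open>Y j\<close> meet only with shifts of macroscopic size.
\<close>

lemma cross_correlation_step:
  assumes X: "staircase_word h' m X" and Y: "staircase_word h m Y"
    and j: "m \<le> j" "R \<le> j" "0 < R" and sq: "j ^ 2 \<le> ht h j" "5 * real j ^ 2 \<le> \<delta> * real (ht h j)"
    and H': "ht h' j \<le> (M + 1) * ht h j" and c: "0 \<le> c"
    and inc: "\<And>D (z::int). D \<in> {1..R} \<Longrightarrow>
      2 * \<delta> * real (ht h j) \<le> \<bar>real D * real (ht h' j) - z * real (ht h j)\<bar>"
    and dec: "\<And>a b u v. \<delta> * real (ht h j) \<le> \<bar>real_of_int u - real_of_int v\<bar> \<Longrightarrow>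
      \<bar>\<Sum>n\<in>{a..<b}. Y j (n + u) * Y j (n + v)\<bar> \<le> c"
    and k: "2 * real (j ^ 2) + real ((M + 3) ^ 2) * c \<le> \<kappa> * real (ht h' j)" "0 \<le> \<kappa>"
  shows "\<bar>\<Sum>p\<in>{0..<int (ht h' (Suc j))}. X (Suc j) p * Y (Suc j) (p + s)\<bar>
    \<le> real (j ^ 2) + 2 * real R * real (ht h' j) + real j * real (ht h' j) * sqrt (1 / real R + \<kappa>)"
proof -
  interpret X: staircase_word h' m X by fact
  interpret Y: staircase_word h m Y by fact
  let ?H' = "int (ht h' j)" and ?J = "Suc j"
  have j1: "1 \<le> j" using j X.m_ge by simp
  define F where "F = (\<lambda>k. \<Sum>n\<in>{0..<?H'}. X j n * Y ?J (n + (pos h' j k + s)))"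
  have F_bound: "\<bar>F k\<bar> \<le> real (ht h' j)" for k
  proof -
    have "\<bar>F k\<bar> \<le> (\<Sum>n\<in>{0..<?H'}. \<bar>X j n * Y ?J (n + (pos h' j k + s))\<bar>)"
      unfolding F_def by (rule sum_abs)
    also have "\<dots> \<le> (\<Sum>n\<in>{0..<?H'}. 1)"
      using X.bounded Y.bounded by (intro sum_mono) (simp add: abs_mult mult_le_one)
    finally show ?thesis by simp
  qed
  have 1: "\<bar>(\<Sum>p\<in>{0..<int (ht h' ?J)}. X ?J p * Y ?J (p + s)) - (\<Sum>k<j. F k)\<bar> \<le> real (j ^ 2)"
  proof -
    have "(\<Sum>p\<in>{0..<int (ht h' ?J)}. X j (p - pos h' j k) * Y ?J (p + s)) = F k" if "k < j" for k
    proof -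
      have "(\<Sum>p\<in>{0..<int (ht h' ?J)}. X j (p - pos h' j k) * Y ?J (p + s))
          = (\<Sum>p\<in>{pos h' j k..<pos h' j k + ?H'}. X j (p - pos h' j k) * Y ?J (p + s))"
      proof (rule sum.mono_neutral_right)
        show "{pos h' j k..<pos h' j k + ?H'} \<subseteq> {0..<int (ht h' ?J)}"
          using pos_plus_ht_le[OF j1 that, of h'] pos_nonneg[of h' j k] by auto
        show "\<forall>p\<in>{0..<int (ht h' ?J)} - {pos h' j k..<pos h' j k + ?H'}. X j (p - pos h' j k) * Y ?J (p + s) = 0"
          using X.support[OF j(1)] by force
      qed simp
      also have "\<dots> = F k"
        using sum_translate_int[where f = "\<lambda>p. X j (p - pos h' j k) * Y ?J (p + s)"
            and c = "pos h' j k" and a = 0 and b = ?H']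
        by (simp add: F_def algebra_simps)
      finally show ?thesis .
    qed
    then show ?thesis
      using X.expand_left[of j "{0..<int (ht h' ?J)}" "\<lambda>p. Y ?J (p + s)" 0,
          OF j(1) finite_atLeastLessThan_int Y.bounded] by simp
  qed
  have vdc: "\<bar>\<Sum>d<R. F (k + d)\<bar> \<le> real R * real (ht h' j) * sqrt (1 / real R + \<kappa>)" if k: "k < j" for k
  proof -
    define v where "v = (\<lambda>d n. Y ?J (n + (pos h' j (k + d) + s)))"
    have "(\<Sum>d<R. F (k + d)) = (\<Sum>n\<in>{0..<?H'}. X j n * (\<Sum>d<R. v d n))"
      unfolding F_def v_def by (subst sum.swap) (simp add: sum_distrib_left)
    also have "\<bar>\<dots>\<bar> \<le> (\<Sum>n\<in>{0..<?H'}. \<bar>X j n * (\<Sum>d<R. v d n)\<bar>)" by (rule sum_abs)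
    also have "\<dots> \<le> (\<Sum>n\<in>{0..<?H'}. \<bar>\<Sum>d<R. v d n\<bar>)"
      using X.bounded by (intro sum_mono) (simp add: abs_mult mult_left_le_one_le)
    also have "\<dots> \<le> real R * real (ht h' j) * sqrt (1 / real R + \<kappa>)"
    proof (rule van_der_Corput[where S' = "{0..<?H'}"])
      show "(\<Sum>n\<in>{0..<?H'}. v a n * v a n) \<le> real (ht h' j)" for a
      proof -
        have "v a n * v a n \<le> 1" for n
          using Y.bounded[of ?J "n + (pos h' j (k + a) + s)"]
          by (simp add: v_def abs_le_square_iff[of _ "1::real", simplified] flip: power2_eq_square)
        then have "(\<Sum>n\<in>{0..<?H'}. v a n * v a n) \<le> (\<Sum>n\<in>{0..<?H'}. 1)" by (intro sum_mono)
        then show ?thesis by simp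
      qed
      show "(\<Sum>n\<in>{0..<?H'}. v a n * v b n) \<le> \<kappa> * real (ht h' j)" if ab: "a < R" "b < R" "a \<noteq> b" for a b
      proof -
        define u w where "u = pos h' j (k + a) + s" and "w = pos h' j (k + b) + s"
        have "\<bar>\<Sum>n\<in>{0..<?H'}. Y ?J (n + u) * Y ?J (n + w)\<bar>
            \<le> 2 * real (j ^ 2) + real ((M + 3) ^ 2) * c"
        proof (rule Y.window_correlation_le[OF j(1) sq(1) H' c _ dec])
          fix l l' assume l: "l < j" "l' < j"
          let ?H = "real (ht h j)"
          have t: "real (tri x) \<le> 4 * real j ^ 2" if "x \<le> 2 * j" for x
          proof -
            have "tri x \<le> x ^ 2" by (rule tri_le_square)
            also have "\<dots> \<le> (2 * j) ^ 2" using that by (rule power_mono) simp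
            finally have "real (tri x) \<le> real ((2 * j) ^ 2)" by (simp only: of_nat_le_iff)
            then show ?thesis by (simp add: power2_eq_square)
          qed
          have t': "real (tri x) \<le> real j ^ 2" if "x \<le> j" for x
          proof -
            have "tri x \<le> x ^ 2" by (rule tri_le_square)
            also have "\<dots> \<le> j ^ 2" using that by (rule power_mono) simp
            finally have "real (tri x) \<le> real (j ^ 2)" by (simp only: of_nat_le_iff)
            then show ?thesis by simp
          qed
          define main where "main = (real a - real b) * real (ht h' j) - (real l - real l') * ?H"
          define err where "err = real (tri (k + a)) - real (tri (k + b)) + real (tri l') - real (tri l)"
          have z: "real_of_int (u - pos h j l) - real_of_int (w - pos h j l') = main + err"
            by (simp add: u_def w_def pos_def main_def err_def algebra_simps)
          have "2 * \<delta> * ?H \<le> \<bar>(real a - real b) * real (ht h' j) - (real l - real l') * ?H\<bar>"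
          proof (cases "b < a")
            case True
            then have "a - b \<in> {1..R}" using ab by auto
            then show ?thesis using inc[of "a - b" "int l - int l'"] True by (simp add: of_nat_diff)
          next
            case False
            then have "a < b" "b - a \<in> {1..R}" using ab by auto
            then have "\<bar>(real b - real a) * real (ht h' j) - (real l' - real l) * ?H\<bar> \<ge> 2 * \<delta> * ?H"
              using inc[of "b - a" "int l' - int l"] by (simp add: of_nat_diff)
            moreover have "(real a - real b) * real (ht h' j) - (real l - real l') * ?H
                = - ((real b - real a) * real (ht h' j) - (real l' - real l) * ?H)"
              by (simp add: algebra_simps)
            ultimately show ?thesis by (simp only: abs_minus_cancel)
          qed
          then have "2 * \<delta> * ?H \<le> \<bar>main\<bar>" by (simp only: main_def)
          moreover have "\<bar>err\<bar> \<le> 5 * real j ^ 2"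
          proof -
            have "k + a \<le> 2 * j" "k + b \<le> 2 * j" "l \<le> j" "l' \<le> j" using k ab j l by linarith+
            note t[OF this(1)] t[OF this(2)] t'[OF this(3)] t'[OF this(4)]
            moreover have "0 \<le> real (tri x)" for x by simp
            note this[of "k + a"] this[of "k + b"] this[of l] this[of l']
            ultimately show ?thesis unfolding err_def by linarith
          qed
          ultimately show "\<delta> * ?H \<le> \<bar>real_of_int (u - pos h j l) - real_of_int (w - pos h j l')\<bar>"
            using sq(2) unfolding z by linarith
        qed
        then show ?thesis using k(1) unfolding v_def u_def w_def
          using assms(12) by linarith
      qed
    qed (use j \<open>0 \<le> \<kappa>\<close> in auto)
    finally show ?thesis .
  qed
  have 2: "\<bar>real R * (\<Sum>k<j. F k) - (\<Sum>k<j. \<Sum>d<R. F (k + d))\<bar> \<le> real R * (2 * real R * real (ht h' j))"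
  proof -
    have "real R * (\<Sum>k<j. F k) - (\<Sum>k<j. \<Sum>d<R. F (k + d)) = (\<Sum>d<R. (\<Sum>k<j. F k) - (\<Sum>k<j. F (k + d)))"
      by (simp add: sum_subtractf sum.swap[of _ "{..<j}"])
    also have "\<bar>\<dots>\<bar> \<le> (\<Sum>d<R. 2 * real R * real (ht h' j))"
    proof (rule order_trans[OF sum_abs sum_mono])
      fix d assume "d \<in> {..<R}"
      then have "2 * real d * real (ht h' j) \<le> 2 * real R * real (ht h' j)" by (intro mult_right_mono) auto
      then show "\<bar>(\<Sum>k<j. F k) - (\<Sum>k<j. F (k + d))\<bar> \<le> 2 * real R * real (ht h' j)"
        using sum_shift_le[of F "real (ht h' j)" j d, OF F_bound] by linarith
    qed
    finally show ?thesis by simp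
  qed
  have "\<bar>\<Sum>k<j. \<Sum>d<R. F (k + d)\<bar> \<le> (\<Sum>k<j. real R * real (ht h' j) * sqrt (1 / real R + \<kappa>))"
    using vdc by (intro order_trans[OF sum_abs sum_mono]) auto
  also have "\<dots> = real R * (real j * real (ht h' j) * sqrt (1 / real R + \<kappa>))" by simp
  finally have "\<bar>real R * (\<Sum>k<j. F k)\<bar>
      \<le> real R * (2 * real R * real (ht h' j)) + real R * (real j * real (ht h' j) * sqrt (1 / real R + \<kappa>))"
    using 2 by linarith
  then have "real R * \<bar>\<Sum>k<j. F k\<bar>
      \<le> real R * (2 * real R * real (ht h' j) + real j * real (ht h' j) * sqrt (1 / real R + \<kappa>))"
    by (simp only: abs_mult abs_of_nat distrib_left)
  then have "\<bar>\<Sum>k<j. F k\<bar> \<le> 2 * real R * real (ht h' j) + real j * real (ht h' j) * sqrt (1 / real R + \<kappa>)"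
    using j(3) by (simp only: mult_le_cancel_left_pos of_nat_0_less_iff)
  then show ?thesis using 1 by linarith
qed

lemma cross_correlation:
  assumes X: "staircase_word h' m X" and Y: "balanced_word h m Y" and ne: "h \<noteq> h'" and e: "0 < e"
  shows "\<forall>\<^sub>F J in sequentially. \<forall>s.
    \<bar>\<Sum>p\<in>{0..<int (ht h' J)}. X J p * Y J (p + s)\<bar> \<le> e * real (ht h J)"
proof -
  interpret X: staircase_word h' m X by fact
  interpret Y: balanced_word h m Y by fact
  define r where "r = e / (2 * (real h' + 1))"
  have r: "0 < r" using e by (simp add: r_def)
  define \<kappa> where "\<kappa> = r\<^sup>2 / 2"
  have \<kappa>: "0 < \<kappa>" using r by (simp add: \<kappa>_def)
  obtain R :: nat where R: "2 / r\<^sup>2 \<le> real R" "0 < R"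
    by (metis gr0I le_less_trans of_nat_0 real_arch_simple divide_pos_pos less_irrefl
        zero_less_numeral zero_less_power r)
  have root: "sqrt (1 / real R + \<kappa>) \<le> r"
  proof (rule real_le_lsqrt)
    have "1 / real R \<le> r\<^sup>2 / 2" using R r by (simp add: field_simps)
    then show "1 / real R + \<kappa> \<le> r\<^sup>2" by (simp add: \<kappa>_def)
  qed (use r in simp)
  obtain d where d: "0 < d" and inc: "\<forall>\<^sub>F j in sequentially. \<forall>D\<in>{1..R}. \<forall>z::int.
      d * real (ht h j) \<le> \<bar>real D * real (ht h' j) - z * real (ht h j)\<bar>"
    using heights_incommensurable[OF Y.h_pos ne] by blast
  define \<delta> where "\<delta> = d / 2"
  have \<delta>: "0 < \<delta>" using d by (simp add: \<delta>_def)
  define M where "M = h'"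
  \<comment> \<open>At most \<open>(M + 3)^2\<close> pairs of copies meet a window, and \<open>ht h j \<le> (h + 1) * ht h' j\<close>.\<close>
  define K where "K = \<kappa> / (2 * (real h + 1) * real ((M + 3) ^ 2))"
  have K: "0 < K" using \<kappa> by (simp add: K_def)
  have ev1: "\<forall>\<^sub>F j in sequentially. 5 * real j ^ 2 \<le> min (min 1 \<delta>) (\<kappa> / (real h + 1)) * real (ht h j)"
    using \<delta> \<kappa> by (intro power_le_ht[OF Y.h_pos]) simp
  have ev2: "\<forall>\<^sub>F j in sequentially. 1 * real j ^ 1 \<le> e / 4 * real (ht h j)"
    using e by (intro power_le_ht[OF Y.h_pos]) simp
  have ev3: "\<forall>\<^sub>F j in sequentially. 8 * real R * (real h' + 1) / e \<le> real j"
    using filterlim_real_sequentially by (auto simp: filterlim_at_top)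
  have "\<forall>\<^sub>F j in sequentially. \<forall>s.
    \<bar>\<Sum>p\<in>{0..<int (ht h' (Suc j))}. X (Suc j) p * Y (Suc j) (p + s)\<bar> \<le> e * real (ht h (Suc j))"
    using inc ev1 ev2 ev3 Y.interval_correlation[OF K \<delta>]
      eventually_ge_at_top[of m] eventually_ge_at_top[of R]
  proof eventually_elim
    case (elim j)
    let ?H = "real (ht h j)" and ?H' = "real (ht h' j)"
    have j1: "1 \<le> j" using elim(6) X.m_ge by simp
    have mm: "min (min 1 \<delta>) (\<kappa> / (real h + 1)) * ?H \<le> 1 * ?H"
      "min (min 1 \<delta>) (\<kappa> / (real h + 1)) * ?H \<le> \<delta> * ?H"
      "min (min 1 \<delta>) (\<kappa> / (real h + 1)) * ?H \<le> \<kappa> / (real h + 1) * ?H"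
      by (intro mult_right_mono; simp)+
    then have sq: "5 * real j ^ 2 \<le> ?H" "5 * real j ^ 2 \<le> \<delta> * ?H" "5 * real j ^ 2 \<le> \<kappa> / (real h + 1) * ?H"
      using elim(2) by linarith+
    have "real j ^ 2 \<le> ?H" using sq(1) zero_le_power2[of "real j"] by linarith
    then have sqn: "j ^ 2 \<le> ht h j" by (metis of_nat_le_iff of_nat_power)
    have H'H: "ht h' j \<le> (M + 1) * ht h j" unfolding M_def by (rule ht_le_mult[OF j1 Y.h_pos])
    then have "?H' \<le> real ((M + 1) * ht h j)" by (simp only: of_nat_le_iff)
    then have H'H_real: "?H' \<le> (real h' + 1) * ?H" by (simp add: M_def algebra_simps)
    have "?H \<le> real ((h + 1) * ht h' j)" using ht_le_mult[OF j1 X.h_pos, of h] by (simp only: of_nat_le_iff)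
    then have HH'_real: "?H / (real h + 1) \<le> ?H'" by (simp add: field_simps)
    have small: "2 * real (j ^ 2) + real ((M + 3) ^ 2) * (K * ?H) \<le> \<kappa> * ?H'"
    proof -
      have "real ((M + 3) ^ 2) * (K * ?H) = \<kappa> / 2 * (?H / (real h + 1))"
        by (simp add: K_def divide_simps)
      moreover have "\<kappa> / 2 * (?H / (real h + 1)) \<le> \<kappa> / 2 * ?H'"
        using HH'_real \<kappa> by (intro mult_left_mono) auto
      moreover have "2 * real (j ^ 2) \<le> \<kappa> / 2 * (?H / (real h + 1))"
      proof -
        have "\<kappa> / (real h + 1) * ?H = 2 * (\<kappa> / 2 * (?H / (real h + 1)))"
          by (simp only: times_divide_eq_left times_divide_eq_right)
        moreover have "real (j ^ 2) = real j ^ 2" by simp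
        ultimately show ?thesis using sq(3) zero_le_power2[of "real j"] by linarith
      qed
      moreover have "\<kappa> / 2 * ?H' + \<kappa> / 2 * ?H' = \<kappa> * ?H'" by simp
      ultimately show ?thesis by linarith
    qed
    have jH: "real j * ?H \<le> real (ht h (Suc j))"
      using ht_Suc_ge[OF j1, of h] by (metis of_nat_le_iff of_nat_mult)
    show ?case
    proof
      fix s
      have "\<bar>\<Sum>p\<in>{0..<int (ht h' (Suc j))}. X (Suc j) p * Y (Suc j) (p + s)\<bar>
        \<le> real (j ^ 2) + 2 * real R * ?H' + real j * ?H' * sqrt (1 / real R + \<kappa>)"
        by (rule cross_correlation_step[OF X Y.staircase_word_axioms elim(6,7) R(2) sqn sq(2) H'H _ _ _ small])
          (use elim(1,5) K \<kappa> in \<open>auto simp: \<delta>_def\<close>)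
      moreover have "real (j ^ 2) \<le> e / 4 * (real j * ?H)"
      proof -
        have "real j * real j \<le> real j * (e / 4 * ?H)" using elim(3) by (intro mult_left_mono) auto
        then show ?thesis by (simp add: power2_eq_square mult.left_commute)
      qed
      moreover have "2 * real R * ?H' \<le> e / 4 * (real j * ?H)"
      proof -
        have "2 * real R * ?H' \<le> 2 * real R * ((real h' + 1) * ?H)"
          using H'H_real by (intro mult_left_mono) auto
        also have "\<dots> = (2 * real R * (real h' + 1)) * ?H" by simp
        also have "\<dots> \<le> (e / 4 * real j) * ?H"
          using elim(4) e by (intro mult_right_mono) (auto simp: field_simps)
        finally show ?thesis by simp
      qed
      moreover have "real j * ?H' * sqrt (1 / real R + \<kappa>) \<le> e / 2 * (real j * ?H)"
      proof -
        have "real j * ?H' * sqrt (1 / real R + \<kappa>) \<le> real j * ((real h' + 1) * ?H) * r"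
          using H'H_real root \<kappa> by (intro mult_mono) auto
        also have "\<dots> = e / 2 * (real j * ?H)" by (simp add: r_def divide_simps)
        finally show ?thesis .
      qed
      moreover have "e * (real j * ?H) = e / 4 * (real j * ?H) + e / 4 * (real j * ?H) + e / 2 * (real j * ?H)"
        by simp
      moreover have "e * (real j * ?H) \<le> e * real (ht h (Suc j))" using jH e by (intro mult_left_mono) auto
      ultimately show "\<bar>\<Sum>p\<in>{0..<int (ht h' (Suc j))}. X (Suc j) p * Y (Suc j) (p + s)\<bar> \<le> e * real (ht h (Suc j))"
        by linarith
    qed
  qed
  then show ?thesis by (subst (asm) eventually_sequentially_Suc)
qed

section \<open>The levels\<close>

abbreviation lv :: "nat \<Rightarrow> nat \<Rightarrow> real list" where
  "lv h j \<equiv> stair_levels h (\<lambda>j. j) j"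

abbreviation wd :: "nat \<Rightarrow> real" where
  "wd \<equiv> stair_width (\<lambda>j. j)"

abbreviation level :: "nat \<Rightarrow> nat \<Rightarrow> nat \<Rightarrow> real set" where
  "level h \<equiv> stair_level h (\<lambda>j. j)"

lemma length_lv: "length (lv h j) = ht h j"
  by (simp add: ht_def)

lemma wd_Suc: "1 \<le> j \<Longrightarrow> wd (Suc j) = wd j / real j"
  by (cases j) auto

lemma wd_eq: "wd (Suc j) = 1 / fact j"
  by (induction j) (auto simp: wd_Suc)

lemma wd_pos: "1 \<le> j \<Longrightarrow> 0 < wd j"
  using wd_eq[of "j - 1"] by simp

lemma lv_Suc: "1 \<le> j \<Longrightarrow> lv h (Suc j) = stair_cut_stack j (wd j) (lv h j)"
  by (cases j) auto

lemma tri_decompose: "x < tri q \<Longrightarrow> \<exists>i<q. \<exists>k<i. x = tri i + k"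
proof (induction q)
  case (Suc q)
  show ?case
  proof (cases "x < tri q")
    case True
    then show ?thesis using Suc.IH less_SucI by blast
  next
    case False
    then show ?thesis using Suc.prems by (intro exI[of _ q] conjI exI[of _ "x - tri q"]) (auto simp: tri_Suc)
  qed
qed (simp add: tri_def)

lemma lv_grid_step:
  assumes "1 \<le> j" "(\<lambda>c. real c * wd j) ` {..<ht h j} \<subseteq> set (lv h j)" "c < ht h (Suc j)"
  shows "real c * wd (Suc j) \<in> set (lv h (Suc j))"
proof (cases "c < j * ht h j")
  case True
  have "c div j < ht h j" using True assms(1) by (simp add: less_mult_imp_div_less mult.commute)
  then have "real (c div j) * wd j \<in> set (lv h j)" using assms(2) by auto
  moreover have "c mod j < j" using assms(1) by simp
  moreover have "real c * wd (Suc j) = real (c div j) * wd j + real (c mod j) * (wd j / real j)"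
  proof -
    have "real c = real (c div j) * real j + real (c mod j)"
      by (metis div_mult_mod_eq of_nat_add of_nat_mult)
    then show ?thesis using assms(1) by (simp add: wd_Suc distrib_right add_divide_distrib)
  qed
  ultimately show ?thesis
    unfolding lv_Suc[OF assms(1)] stair_cut_stack_def stair_subcolumn_def by auto
next
  case False
  have "c - j * ht h j < tri j" using False assms(3) ht_Suc[OF assms(1), of h] by simp
  then obtain i k where ik: "i < j" "k < i" "c - j * ht h j = tri i + k"
    using tri_decompose by blast
  then have c: "c = j * ht h j + (tri i + k)" using False by simp
  have "real c * wd (Suc j) = real (length (lv h j)) * wd j + real (tri i + k) * (wd j / real j)"
    unfolding c length_lv using assms(1) by (simp add: wd_Suc distrib_right add_divide_distrib)
  then have "real c * wd (Suc j) \<in> set (stair_subcolumn j (wd j) (lv h j) i)"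
    using ik(2) unfolding stair_subcolumn_def tri_def by auto
  then show ?thesis using ik(1) unfolding lv_Suc[OF assms(1)] stair_cut_stack_def by auto
qed

text \<open>
  The cutting and stacking procedure only rearranges a grid: every grid point occurs among the left
  endpoints, and by counting it occurs once.
\<close>

lemma lv_grid:
  assumes "1 \<le> j"
  shows "set (lv h j) = (\<lambda>c. real c * wd j) ` {..<ht h j} \<and> distinct (lv h j)"
  using assms
proof (induction j rule: nat_induct_at_least)
  case base
  show ?case by (auto simp: distinct_map inj_on_def atLeast0LessThan)
next
  case (Suc j)
  let ?G = "(\<lambda>c. real c * wd (Suc j)) ` {..<ht h (Suc j)}"
  have "card ?G = ht h (Suc j)"
    using wd_pos[of "Suc j"] by (subst card_image) (auto simp: inj_on_def)
  moreover have sub: "?G \<subseteq> set (lv h (Suc j))"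
    using lv_grid_step[of j h] Suc by auto
  moreover have "card (set (lv h (Suc j))) \<le> ht h (Suc j)"
    using card_length[of "lv h (Suc j)"] unfolding length_lv .
  ultimately have eq: "?G = set (lv h (Suc j))"
    by (intro card_seteq) auto
  then have "card (set (lv h (Suc j))) = length (lv h (Suc j))"
    using \<open>card ?G = ht h (Suc j)\<close> unfolding length_lv by simp
  then have "distinct (lv h (Suc j))" by (rule card_distinct)
  then show ?case using eq by simp
qed

lemma lv_nth_grid:
  assumes "1 \<le> j" "k < ht h j"
  obtains c where "c < ht h j" "lv h j ! k = real c * wd j"
proof -
  have "lv h j ! k \<in> set (lv h j)" using assms(2) by (simp add: length_lv)
  then show ?thesis using that lv_grid[OF assms(1), of h] by auto
qed

lemma level_eq: "level h j k = {lv h j ! k..<lv h j ! k + wd j}"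
  by (simp add: stair_level_def)

lemma grid_interval_disjoint:
  assumes "0 < w" "real c * w \<le> x" "x < real c * w + w" "real c' * w \<le> x" "x < real c' * w + w"
  shows "c = c'"
proof (rule ccontr)
  assume "c \<noteq> c'"
  then consider "c + 1 \<le> c'" | "c' + 1 \<le> c" by linarith
  then show False
  proof cases
    case 1
    then have "real (c + 1) * w \<le> real c' * w" using assms(1) by (intro mult_right_mono) auto
    then show False using assms by (simp add: distrib_right)
  next
    case 2
    then have "real (c' + 1) * w \<le> real c * w" using assms(1) by (intro mult_right_mono) auto
    then show False using assms by (simp add: distrib_right)
  qed
qed

lemma level_unique:
  assumes "1 \<le> j" "k < ht h j" "k' < ht h j" "x \<in> level h j k" "x \<in> level h j k'"
  shows "k = k'"
proof -
  obtain c where c: "lv h j ! k = real c * wd j" using lv_nth_grid[OF assms(1,2)] by blast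
  obtain c' where c': "lv h j ! k' = real c' * wd j" using lv_nth_grid[OF assms(1,3)] by blast
  have "c = c'"
    using assms(4,5) wd_pos[OF assms(1)] unfolding level_eq c c'
    by (intro grid_interval_disjoint[of "wd j" c x c']) auto
  then show ?thesis using c c' assms(2,3) lv_grid[OF assms(1), of h]
    by (metis length_lv nth_eq_iff_index_eq)
qed

lemma disjoint_family_level: "1 \<le> j \<Longrightarrow> disjoint_family_on (level h j) {..<ht h j}"
  using level_unique unfolding disjoint_family_on_def by blast

lemma Union_levels:
  assumes "1 \<le> j"
  shows "(\<Union>k<ht h j. level h j k) = {0..<real (ht h j) * wd j}"
proof (intro set_eqI iffI)
  note w = wd_pos[OF assms]
  fix x assume "x \<in> (\<Union>k<ht h j. level h j k)"
  then obtain k where k: "k < ht h j" "x \<in> level h j k" by auto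
  obtain c where c: "c < ht h j" "lv h j ! k = real c * wd j" using lv_nth_grid[OF assms k(1)] .
  have "real (c + 1) * wd j \<le> real (ht h j) * wd j" using c w by (intro mult_right_mono) auto
  moreover have "real (c + 1) * wd j = real c * wd j + wd j" by (simp add: distrib_right)
  moreover have "0 \<le> real c * wd j" using w by simp
  ultimately show "x \<in> {0..<real (ht h j) * wd j}" using k(2)
    unfolding level_eq c(2) atLeastLessThan_iff by linarith
next
  note w = wd_pos[OF assms]
  fix x assume x: "x \<in> {0..<real (ht h j) * wd j}"
  define c where "c = nat \<lfloor>x / wd j\<rfloor>"
  have "0 \<le> x / wd j" using x w by simp
  then have c: "real c \<le> x / wd j" "x / wd j < real c + 1" unfolding c_def by linarith+
  then have c': "real c * wd j \<le> x" "x < real c * wd j + wd j" using w by (auto simp: field_simps)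
  then have "real c * wd j < real (ht h j) * wd j" using x unfolding atLeastLessThan_iff by linarith
  then have "c < ht h j" using w by simp
  then have "real c * wd j \<in> set (lv h j)" using lv_grid[OF assms, of h] by auto
  then obtain k where k: "k < ht h j" "lv h j ! k = real c * wd j" unfolding in_set_conv_nth length_lv by blast
  then show "x \<in> (\<Union>k<ht h j. level h j k)" using c' by (intro UN_I[of k]) (auto simp: level_eq)
qed

lemma nth_concat_map:
  assumes "k < q" "n < length (f k)"
  shows "concat (map f [0..<q]) ! ((\<Sum>i<k. length (f i)) + n) = f k ! n"
  using assms(1)
proof (induction q)
  case (Suc q)
  have len: "length (concat (map f [0..<q])) = (\<Sum>i<q. length (f i))"
    by (induction q) auto
  show ?case
  proof (cases "k = q")
    case True
    then show ?thesis using assms(2) len by (simp add: nth_append)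
  next
    case False
    then have k: "k < q" using Suc.prems by simp
    have "(\<Sum>i<k. length (f i)) + n < (\<Sum>i<Suc k. length (f i))" using assms(2) by simp
    also have "\<dots> \<le> (\<Sum>i<q. length (f i))" using k by (intro sum_mono2) auto
    finally show ?thesis using Suc.IH[OF k] len by (simp add: nth_append)
  qed
qed simp

lemma lv_Suc_nth:
  assumes "1 \<le> j" "k < j" "n < ht h j"
  shows "lv h (Suc j) ! (k * ht h j + tri k + n) = lv h j ! n + real k * wd (Suc j)"
proof -
  let ?f = "stair_subcolumn j (wd j) (lv h j)"
  have "length (?f i) = ht h j + i" for i by (simp add: stair_subcolumn_def length_lv)
  moreover have "(\<Sum>i<k. ht h j + i) = k * ht h j + tri k"
    by (induction k) (auto simp: tri_Suc, auto simp: tri_def)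
  ultimately have "lv h (Suc j) ! (k * ht h j + tri k + n) = ?f k ! n"
    using nth_concat_map[of k j n ?f] assms unfolding lv_Suc[OF assms(1)] stair_cut_stack_def by simp
  also have "\<dots> = lv h j ! n + real k * wd (Suc j)"
    using assms by (simp add: stair_subcolumn_def nth_append length_lv wd_Suc)
  finally show ?thesis .
qed

lemma subcolumn_index_less:
  assumes "1 \<le> j" "k < j" "n < ht h j"
  shows "k * ht h j + tri k + n < ht h (Suc j)"
  using subcolumn_fits[OF assms(1,2), of h] assms(3) by simp

lemma level_split:
  assumes "1 \<le> j" "n < ht h j" "x \<in> level h j n"
  obtains k where "k < j" "x \<in> level h (Suc j) (k * ht h j + tri k + n)"
proof -
  define y where "y = (x - lv h j ! n) / wd (Suc j)"
  note w = wd_pos[of "Suc j"]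
  have wj: "wd j = real j * wd (Suc j)" using assms(1) by (simp add: wd_Suc)
  have y: "0 \<le> y" "y < real j"
    using assms(3) w unfolding y_def level_eq wj by (auto simp: divide_less_eq)
  define k where "k = nat \<lfloor>y\<rfloor>"
  have k: "real k \<le> y" "y < real k + 1" using y(1) unfolding k_def by linarith+
  then have "k < j" using y(2) by linarith
  moreover have "x \<in> level h (Suc j) (k * ht h j + tri k + n)"
    unfolding level_eq lv_Suc_nth[OF assms(1) \<open>k < j\<close> assms(2)]
    using k w by (auto simp: y_def field_simps)
  ultimately show ?thesis by (rule that)
qed

lemma level_Suc_subset:
  assumes "1 \<le> j" "k < j" "n < ht h j"
  shows "level h (Suc j) (k * ht h j + tri k + n) \<subseteq> level h j n"
proof -
  note w = wd_pos[of "Suc j"]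
  have wj: "wd j = real j * wd (Suc j)" using assms(1) by (simp add: wd_Suc)
  have "real (k + 1) * wd (Suc j) \<le> real j * wd (Suc j)" using assms(2) w by (intro mult_right_mono) auto
  then have top: "real k * wd (Suc j) + wd (Suc j) \<le> wd j" unfolding wj by (simp add: distrib_right)
  have "0 \<le> real k * wd (Suc j)" using w by simp
  then show ?thesis unfolding level_eq lv_Suc_nth[OF assms]
    using top by (intro subsetI) (simp only: atLeastLessThan_iff, linarith)
qed

section \<open>The probability space\<close>

definition mass :: "nat \<Rightarrow> real" where
  "mass h = real h + exp 1 / 2"

lemma mass_pos: "0 < mass h"
  by (simp add: mass_def add_nonneg_pos)

lemma tower_mass_tendsto: "(\<lambda>j. real (ht h j) * wd j) \<longlonglongrightarrow> mass h"
proof -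
  have "(\<lambda>j. real (ht h (Suc j)) * wd (Suc j)) \<longlonglongrightarrow> mass h"
    using ht_over_fact_tendsto[of h] by (simp add: wd_eq mass_def)
  then show ?thesis by (rule filterlim_sequentially_Suc[THEN iffD1])
qed

lemma wd_tendsto: "wd \<longlonglongrightarrow> 0"
proof -
  have "(\<lambda>j. 1 / fact j :: real) \<longlonglongrightarrow> 0"
    using summable_LIMSEQ_zero[OF summable_exp[of "1::real"]] by (simp add: inverse_eq_divide)
  then have "(\<lambda>j. wd (Suc j)) \<longlonglongrightarrow> 0" by (simp add: wd_eq)
  then show ?thesis by (rule filterlim_sequentially_Suc[THEN iffD1])
qed

lemma tower_mass_Suc: "1 \<le> j \<Longrightarrow> real (ht h j) * wd j \<le> real (ht h (Suc j)) * wd (Suc j)"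
proof -
  assume j: "1 \<le> j"
  have "real (j * ht h j) \<le> real (ht h (Suc j))" using ht_Suc_ge[OF j] by (simp only: of_nat_le_iff)
  then have "real (j * ht h j) * wd (Suc j) \<le> real (ht h (Suc j)) * wd (Suc j)"
    using wd_pos[of "Suc j"] by (intro mult_right_mono) auto
  then show ?thesis using j by (simp add: wd_Suc)
qed

lemma tower_mass_mono: "1 \<le> i \<Longrightarrow> i \<le> j \<Longrightarrow> real (ht h i) * wd i \<le> real (ht h j) * wd j"
proof -
  assume ij: "1 \<le> i" "i \<le> j"
  from ij(2) show ?thesis
  proof (induction j rule: dec_induct)
    case (step j)
    then show ?case using tower_mass_Suc[of j h] ij(1) by linarith
  qed simp
qed

lemma tower_mass_le: "1 \<le> j \<Longrightarrow> real (ht h j) * wd j \<le> mass h"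
proof -
  assume j: "1 \<le> j"
  have "incseq (\<lambda>j. real (ht h (Suc j)) * wd (Suc j))"
    by (intro incseq_SucI tower_mass_Suc) simp
  moreover have "(\<lambda>j. real (ht h (Suc j)) * wd (Suc j)) \<longlonglongrightarrow> mass h"
    using tower_mass_tendsto[of h] by (rule filterlim_sequentially_Suc[THEN iffD2])
  ultimately have "real (ht h (Suc (j - 1))) * wd (Suc (j - 1)) \<le> mass h"
    by (rule incseq_le)
  then show ?thesis using j by simp
qed

lemma space_eq: "staircase_space h (\<lambda>j. j) = {0..<mass h}"
proof -
  have "staircase_space h (\<lambda>j. j) = (\<Union>j\<in>{1..}. {0..<real (ht h j) * wd j})"
    unfolding staircase_space_def by (intro SUP_cong refl) (simp add: Union_levels[symmetric] length_lv)
  also have "\<dots> = {0..<mass h}"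
  proof (intro set_eqI iffI)
    fix x assume "x \<in> (\<Union>j\<in>{1..}. {0..<real (ht h j) * wd j})"
    then show "x \<in> {0..<mass h}" using tower_mass_le[of _ h] by fastforce
  next
    fix x assume x: "x \<in> {0..<mass h}"
    then have "\<forall>\<^sub>F j in sequentially. x < real (ht h j) * wd j"
      using tower_mass_tendsto[of h] by (intro order_tendstoD(1)) auto
    then have "\<forall>\<^sub>F j in sequentially. x < real (ht h j) * wd j \<and> 1 \<le> j"
      using eventually_ge_at_top[of 1] by eventually_elim simp
    then obtain j where "x < real (ht h j) * wd j" "1 \<le> j" using eventually_happens by force
    then show "x \<in> (\<Union>j\<in>{1..}. {0..<real (ht h j) * wd j})" using x by auto
  qed
  finally show ?thesis .
qed

lemma tower_mass_less: "1 \<le> j \<Longrightarrow> x < real (ht h j) * wd j \<Longrightarrow> x < mass h"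
  using tower_mass_le[of j h] by linarith

lemma level_subset_space:
  assumes "1 \<le> j" "k < ht h j"
  shows "level h j k \<subseteq> {0..<mass h}"
proof
  fix x assume "x \<in> level h j k"
  then have "x \<in> {0..<real (ht h j) * wd j}" using Union_levels[OF assms(1), of h] assms(2) by blast
  then show "x \<in> {0..<mass h}" using tower_mass_less[OF assms(1)] by auto
qed

abbreviation SM :: "nat \<Rightarrow> real measure" where
  "SM h \<equiv> staircase_measure h (\<lambda>j. j)"

lemma space_SM: "space (SM h) = {0..<mass h}"
  by (simp add: staircase_measure_def space_eq space_restrict_space)

lemma sets_SM: "sets (SM h) = sets (restrict_space borel {0..<mass h})"
  unfolding staircase_measure_def space_eq
  by (simp add: sets_restrict_space)

lemma sets_SM_iff: "A \<in> sets (SM h) \<longleftrightarrow> A \<subseteq> {0..<mass h} \<and> A \<in> sets borel"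
  unfolding sets_SM by (subst sets_restrict_space_iff) auto

lemma emeasure_SM: "A \<in> sets (SM h) \<Longrightarrow> emeasure (SM h) A = emeasure lborel A / ennreal (mass h)"
proof -
  assume A: "A \<in> sets (SM h)"
  then have A': "A \<subseteq> {0..<mass h}" "A \<in> sets borel" by (auto simp: sets_SM_iff)
  have "emeasure (restrict_space lborel {0..<mass h}) X = emeasure lborel X"
    if "X \<subseteq> {0..<mass h}" "X \<in> sets borel" for X
    using that by (subst emeasure_restrict_space) auto
  moreover have "{0..<mass h} \<inter> A = A" using A' by auto
  moreover have "A \<in> sets (restrict_space lborel {0..<mass h})" using A' by (subst sets_restrict_space_iff) auto
  moreover have "{0..<mass h} \<in> sets (restrict_space lborel {0..<mass h})" by (subst sets_restrict_space_iff) auto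
  ultimately show ?thesis
    using A' mass_pos[of h] unfolding staircase_measure_def space_eq
    by (subst emeasure_uniform_measure) auto
qed

lemma prob_space_SM: "prob_space (SM h)"
proof
  have "emeasure (SM h) {0..<mass h} = emeasure lborel {0..<mass h} / ennreal (mass h)"
    by (intro emeasure_SM) (simp add: sets_SM_iff)
  also have "\<dots> = 1" using mass_pos[of h] by (simp add: ennreal_divide_self)
  finally show "emeasure (SM h) (space (SM h)) = 1" by (simp add: space_SM)
qed

lemma measure_SM: "A \<in> sets (SM h) \<Longrightarrow> measure (SM h) A = measure lborel A / mass h"
proof -
  assume A: "A \<in> sets (SM h)"
  then have "emeasure lborel A \<le> emeasure lborel {0..<mass h}"
    by (intro emeasure_mono) (auto simp: sets_SM_iff)
  also have "\<dots> < \<infinity>" using mass_pos[of h] by simp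
  finally have f: "emeasure lborel A = ennreal (measure lborel A)"
    by (intro emeasure_eq_ennreal_measure) auto
  have "ennreal (measure (SM h) A) = emeasure (SM h) A"
    using finite_measure.emeasure_eq_measure[OF prob_space.finite_measure[OF prob_space_SM]] by simp
  also have "\<dots> = ennreal (measure lborel A / mass h)"
    unfolding emeasure_SM[OF A] f using mass_pos[of h] by (simp add: divide_ennreal)
  finally show ?thesis using mass_pos[of h] by (subst (asm) ennreal_inj) auto
qed

lemma level_sets: "1 \<le> j \<Longrightarrow> k < ht h j \<Longrightarrow> level h j k \<in> sets (SM h)"
  using level_subset_space[of j k h] by (simp add: sets_SM_iff level_eq)

lemma measure_level:
  assumes "1 \<le> j" "k < ht h j"
  shows "measure (SM h) (level h j k) = wd j / mass h"
proof -
  have "measure (SM h) (level h j k) = measure lborel (level h j k) / mass h"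
    by (rule measure_SM[OF level_sets[OF assms]])
  also have "measure lborel (level h j k) = wd j"
    using wd_pos[OF assms(1)] unfolding level_eq by simp
  finally show ?thesis .
qed

lemma measure_tower: "1 \<le> j \<Longrightarrow> measure (SM h) {0..<real (ht h j) * wd j} = real (ht h j) * wd j / mass h"
proof -
  assume j: "1 \<le> j"
  have "{0..<real (ht h j) * wd j} \<in> sets (SM h)" using tower_mass_le[OF j, of h] unfolding sets_SM_iff by auto
  then have "measure (SM h) {0..<real (ht h j) * wd j} = measure lborel {0..<real (ht h j) * wd j} / mass h"
    by (rule measure_SM)
  also have "measure lborel {0..<real (ht h j) * wd j} = real (ht h j) * wd j"
    using wd_pos[OF j] by simp
  finally show ?thesis .
qed

section \<open>The staircase map\<close>

abbreviation T :: "nat \<Rightarrow> real \<Rightarrow> real" where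
  "T h \<equiv> staircase_map h (\<lambda>j. j)"

abbreviation jump :: "nat \<Rightarrow> nat \<Rightarrow> nat \<Rightarrow> real" where
  "jump h j k \<equiv> lv h j ! Suc k - lv h j ! k"

text \<open>
  A level and its successor in tower \<open>j\<close> stay adjacent within each subcolumn, at the same distance.
\<close>

lemma jump_refine:
  assumes "1 \<le> j" "Suc k < ht h j" "x \<in> level h j k"
  shows "\<exists>k'. Suc k' < ht h (Suc j) \<and> x \<in> level h (Suc j) k' \<and> jump h (Suc j) k' = jump h j k"
proof -
  obtain i where i: "i < j" "x \<in> level h (Suc j) (i * ht h j + tri i + k)"
    using level_split[OF assms(1) _ assms(3)] assms(2) by auto
  let ?k = "i * ht h j + tri i + k"
  have "Suc ?k < ht h (Suc j)" using subcolumn_index_less[OF assms(1) i(1) assms(2)] by simp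
  moreover have "jump h (Suc j) ?k = jump h j k"
    using lv_Suc_nth[OF assms(1) i(1), of k h] lv_Suc_nth[OF assms(1) i(1), of "Suc k" h] assms(2) by simp
  ultimately show ?thesis using i(2) by blast
qed

lemma jump_refine_iterated:
  assumes "j \<le> j'" "1 \<le> j" "Suc k < ht h j" "x \<in> level h j k"
  shows "\<exists>k'. Suc k' < ht h j' \<and> x \<in> level h j' k' \<and> jump h j' k' = jump h j k"
  using assms(1)
proof (induction j' rule: dec_induct)
  case (step i)
  then obtain k' where k': "Suc k' < ht h i" "x \<in> level h i k'" "jump h i k' = jump h j k" by blast
  then show ?case using jump_refine[of i k' h x] step.hyps assms(2) by fastforce
qed (use assms in blast)

lemma jump_unique:
  assumes "1 \<le> j" "Suc k < ht h j" "x \<in> level h j k" "1 \<le> j'" "Suc k' < ht h j'" "x \<in> level h j' k'"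
  shows "jump h j k = jump h j' k'"
proof -
  obtain a where a: "Suc a < ht h (max j j')" "x \<in> level h (max j j') a" "jump h (max j j') a = jump h j k"
    using jump_refine_iterated[of j "max j j'" k h x] assms by auto
  obtain b where b: "Suc b < ht h (max j j')" "x \<in> level h (max j j') b" "jump h (max j j') b = jump h j' k'"
    using jump_refine_iterated[of j' "max j j'" k' h x] assms by auto
  have "a = b" by (rule level_unique[of "max j j'" a h b x]) (use a b assms in auto)
  then show ?thesis using a b by simp
qed

lemma T_eq:
  assumes "1 \<le> j" "Suc k < ht h j" "x \<in> level h j k"
  shows "T h x = x + jump h j k"
  unfolding staircase_map_def length_lv
proof (rule the_equality)
  show "\<exists>i l. 1 \<le> i \<and> Suc l < ht h i \<and> x \<in> level h i l \<and> x + jump h j k = x + jump h i l"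
    using assms by blast
next
  fix y assume "\<exists>i l. 1 \<le> i \<and> Suc l < ht h i \<and> x \<in> level h i l \<and> y = x + jump h i l"
  then show "y = x + jump h j k" using jump_unique[OF assms] by auto
qed

lemma T_level:
  assumes "1 \<le> j" "Suc k < ht h j" "x \<in> level h j k"
  shows "T h x \<in> level h j (Suc k)"
  using assms(3) unfolding T_eq[OF assms] level_eq by simp

lemma ex_nontop_level:
  assumes "0 < h" "x \<in> {0..<mass h}"
  shows "\<exists>j k. 1 \<le> j \<and> Suc k < ht h j \<and> x \<in> level h j k"
proof -
  have "\<forall>\<^sub>F j in sequentially. x < real (ht h j) * wd j"
    using tower_mass_tendsto[of h] assms by (intro order_tendstoD(1)) auto
  then have "\<forall>\<^sub>F j in sequentially. x < real (ht h j) * wd j \<and> 2 \<le> j"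
    using eventually_ge_at_top[of 2] by eventually_elim simp
  then obtain j where j: "x < real (ht h j) * wd j" "2 \<le> j" using eventually_happens by force
  then have j1: "1 \<le> j" by simp
  have "x \<in> (\<Union>k<ht h j. level h j k)" using j assms(2) unfolding Union_levels[OF j1] by auto
  then obtain k where k: "k < ht h j" "x \<in> level h j k" by auto
  obtain i where i: "i < j" "x \<in> level h (Suc j) (i * ht h j + tri i + k)"
    using level_split[OF j1 k] .
  have "Suc (i * ht h j + tri i + k) < ht h (Suc j)"
  proof -
    \<comment> \<open>The last subcolumn carries \<open>j - 1 \<ge> 1\<close> spacers, so no old level is on top.\<close>
    have "i * ht h j + ht h j \<le> j * ht h j"
      using i(1) by (metis Suc_leI add.commute mult_Suc mult_le_mono1)
    moreover have "tri i < tri j"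
    proof -
      have "tri i \<le> tri (j - 1)" using tri_add[of i "j - 1 - i"] i(1) by simp
      also have "\<dots> < tri j" using tri_Suc[of "j - 1"] j(2) by simp
      finally show ?thesis .
    qed
    ultimately show ?thesis using ht_Suc[OF j1, of h] k(1) by simp
  qed
  then show ?thesis using i(2) by (intro exI[of _ "Suc j"] exI[of _ "i * ht h j + tri i + k"]) simp
qed

lemma T_in_space:
  assumes "0 < h" "x \<in> {0..<mass h}"
  shows "T h x \<in> {0..<mass h}"
  using ex_nontop_level[OF assms] T_level level_subset_space by (metis subsetD)

lemma T_vimage_level:
  assumes "1 \<le> j" "Suc k < ht h j"
  shows "T h -` A \<inter> level h j k = (\<lambda>x. x + jump h j k) -` A \<inter> level h j k"
  using T_eq[OF assms] by auto

lemma T_measurable [measurable]: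
  assumes "0 < h"
  shows "T h \<in> measurable (SM h) (SM h)"
proof (rule measurableI)
  fix x assume "x \<in> space (SM h)"
  then show "T h x \<in> space (SM h)" using T_in_space[OF assms] by (simp add: space_SM)
next
  fix A assume A: "A \<in> sets (SM h)"
  let ?I = "SIGMA j:{1..}. {k. Suc k < ht h j}"
  have sub: "level h j k \<subseteq> {0..<mass h}" if "1 \<le> j" "Suc k < ht h j" for j k
    using that level_subset_space[of j k h] by simp
  have "T h -` A \<inter> space (SM h) = (\<Union>(j, k)\<in>?I. T h -` A \<inter> level h j k)"
  proof (intro set_eqI iffI)
    fix x assume x: "x \<in> T h -` A \<inter> space (SM h)"
    then obtain j k where "1 \<le> j" "Suc k < ht h j" "x \<in> level h j k"
      using ex_nontop_level[OF assms, of x] by (auto simp: space_SM)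
    then show "x \<in> (\<Union>(j, k)\<in>?I. T h -` A \<inter> level h j k)" using x by (intro UN_I[of "(j, k)"]) auto
  next
    fix x assume "x \<in> (\<Union>(j, k)\<in>?I. T h -` A \<inter> level h j k)"
    then obtain j k where jk: "1 \<le> j" "Suc k < ht h j" "x \<in> T h -` A \<inter> level h j k" by auto
    then show "x \<in> T h -` A \<inter> space (SM h)" using sub[OF jk(1,2)] by (auto simp: space_SM)
  qed
  also have "\<dots> = (\<Union>(j, k)\<in>?I. (\<lambda>x. x + jump h j k) -` A \<inter> level h j k)"
  proof (intro SUP_cong refl)
    fix p assume "p \<in> ?I"
    then obtain j k where "p = (j, k)" "1 \<le> j" "Suc k < ht h j" by auto
    then show "(case p of (j, k) \<Rightarrow> T h -` A \<inter> level h j k)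
        = (case p of (j, k) \<Rightarrow> (\<lambda>x. x + jump h j k) -` A \<inter> level h j k)"
      using T_vimage_level[of j k h A] by simp
  qed
  also have "\<dots> \<in> sets borel"
  proof (intro sets.countable_UN' countableI_type, clarify)
    fix j k
    have "(\<lambda>x. x + jump h j k) -` A \<inter> space borel \<in> sets borel"
      using A by (intro measurable_sets[of _ borel borel]) (auto simp: sets_SM_iff)
    then show "(\<lambda>x. x + jump h j k) -` A \<inter> level h j k \<in> sets borel" by (simp add: level_eq)
  qed
  finally show "T h -` A \<inter> space (SM h) \<in> sets (SM h)" unfolding sets_SM_iff space_SM by auto
qed

lemma measure_translate_level:
  assumes "1 \<le> j" "Suc k < ht h j" "A \<in> sets (SM h)"
  shows "measure (SM h) (T h -` A \<inter> level h j k) = measure (SM h) (A \<inter> level h j (Suc k))"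
proof -
  let ?d = "jump h j k"
  have A: "A \<in> sets borel" using assms(3) by (simp add: sets_SM_iff)
  have eq: "(\<lambda>x. x + ?d) -` A \<inter> level h j k = (\<lambda>x. ?d + x) -` (A \<inter> level h j (Suc k))"
    by (auto simp: level_eq add.commute)
  have B: "A \<inter> level h j (Suc k) \<in> sets (SM h)" using assms level_sets[of j "Suc k" h] by auto
  then have B': "A \<inter> level h j (Suc k) \<in> sets borel" by (simp add: sets_SM_iff)
  have "(\<lambda>x. ?d + x) -` (A \<inter> level h j (Suc k)) \<inter> space borel \<in> sets borel"
    using B' by (intro measurable_sets[of _ borel borel]) auto
  then have C: "(\<lambda>x. ?d + x) -` (A \<inter> level h j (Suc k)) \<in> sets (SM h)"
    using level_subset_space[of j k h] assms unfolding eq[symmetric] sets_SM_iff by auto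
  have "measure (SM h) (T h -` A \<inter> level h j k) = measure lborel ((\<lambda>x. ?d + x) -` (A \<inter> level h j (Suc k))) / mass h"
    unfolding T_vimage_level[OF assms(1,2)] eq by (rule measure_SM[OF C])
  also have "measure lborel ((\<lambda>x. ?d + x) -` (A \<inter> level h j (Suc k)))
      = measure (distr lborel borel ((+) ?d)) (A \<inter> level h j (Suc k))"
    using B' by (subst measure_distr) auto
  also have "\<dots> = measure lborel (A \<inter> level h j (Suc k))" by (simp only: lborel_distr_plus)
  also have "\<dots> / mass h = measure (SM h) (A \<inter> level h j (Suc k))" by (rule measure_SM[OF B, symmetric])
  finally show ?thesis .
qed

text \<open>
  The function \<open>f\<close> enumerates all levels but one; it will be \<open>\<lambda>k. k\<close>, omitting the top, and \<open>Suc\<close>,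
  omitting the bottom.
\<close>

lemma measure_near_part:
  assumes "B \<in> sets (SM h)" "1 \<le> j" "inj_on f {..<ht h j - 1}" "\<And>k. k < ht h j - 1 \<Longrightarrow> f k < ht h j"
  shows "\<bar>measure (SM h) B - (\<Sum>k<ht h j - 1. measure (SM h) (B \<inter> level h j (f k)))\<bar>
    \<le> 1 - real (ht h j - 1) * (wd j / mass h)"
proof -
  interpret prob_space "SM h" by (rule prob_space_SM)
  let ?U = "\<Union>k<ht h j - 1. level h j (f k)"
  have disj: "disjoint_family_on (\<lambda>k. level h j (f k)) {..<ht h j - 1}"
    unfolding disjoint_family_on_def
  proof (intro ballI impI)
    fix a b assume ab: "a \<in> {..<ht h j - 1}" "b \<in> {..<ht h j - 1}" "a \<noteq> b"
    then have "f a \<noteq> f b" using assms(3) by (auto dest: inj_onD)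
    then show "level h j (f a) \<inter> level h j (f b) = {}"
      using level_unique[OF assms(2), of "f a" h "f b"] assms(4) ab by auto
  qed
  have lev: "level h j (f k) \<in> sets (SM h)" if "k < ht h j - 1" for k
    using level_sets[OF assms(2)] assms(4)[OF that] by simp
  have U: "?U \<in> sets (SM h)" using lev by auto
  have "prob ?U = (\<Sum>k<ht h j - 1. prob (level h j (f k)))"
    using lev disj by (intro finite_measure_finite_Union) auto
  also have "\<dots> = real (ht h j - 1) * (wd j / mass h)"
    using measure_level[OF assms(2)] assms(4) by simp
  finally have mU: "prob ?U = real (ht h j - 1) * (wd j / mass h)" .
  have "prob (B \<inter> ?U) = (\<Sum>k<ht h j - 1. prob (B \<inter> level h j (f k)))"
    unfolding Int_UN_distrib using lev assms(1) disj
    by (intro finite_measure_finite_Union) (auto simp: disjoint_family_on_def)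
  moreover have "prob B = prob (B \<inter> ?U) + prob (B - ?U)"
  proof -
    have "prob (B - ?U) = prob B - prob (B \<inter> ?U)"
      by (rule finite_measure_Diff') (use assms(1) U in auto)
    then show ?thesis by simp
  qed
  moreover have "prob (B - ?U) \<le> prob (space (SM h) - ?U)"
    using assms(1) U sets.sets_into_space[OF assms(1)] by (intro finite_measure_mono) auto
  moreover have "prob (space (SM h) - ?U) = 1 - prob ?U" using U by (rule prob_compl)
  moreover have "0 \<le> prob (B - ?U)" by simp
  ultimately show ?thesis using mU by linarith
qed

lemma uncovered_tendsto:
  "(\<lambda>j. 1 - real (ht h j - 1) * (wd j / mass h)) \<longlonglongrightarrow> 0" if "0 < h"
proof -
  have "(\<lambda>j. 1 - (real (ht h j) * wd j - wd j) / mass h) \<longlonglongrightarrow> 1 - (mass h - 0) / mass h"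
    using mass_pos[of h] by (intro tendsto_intros tower_mass_tendsto wd_tendsto) auto
  then have lim: "(\<lambda>j. 1 - (real (ht h j) * wd j - wd j) / mass h) \<longlonglongrightarrow> 0" using mass_pos[of h] by simp
  have ev: "\<forall>\<^sub>F j in sequentially. 1 - (real (ht h j) * wd j - wd j) / mass h = 1 - real (ht h j - 1) * (wd j / mass h)"
    using eventually_ge_at_top[of 1]
  proof eventually_elim
    case (elim j)
    then have "real (ht h j - 1) = real (ht h j) - 1" using ht_pos[OF that, of j] by simp
    then show ?case by (simp add: left_diff_distrib diff_divide_distrib)
  qed
  show ?thesis by (rule Lim_transform_eventually[OF lim ev])
qed

text \<open>
  On all levels of a tower except the top one the map is a translation onto the next level, and the
  mass outside these levels tends to zero.
\<close>

lemma T_preserves: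
  assumes "0 < h" "A \<in> sets (SM h)"
  shows "measure (SM h) (T h -` A \<inter> space (SM h)) = measure (SM h) A"
proof -
  let ?B = "T h -` A \<inter> space (SM h)"
  have B: "?B \<in> sets (SM h)" using T_measurable[OF assms(1)] assms(2) by (rule measurable_sets)
  have est: "\<bar>measure (SM h) ?B - measure (SM h) A\<bar> \<le> 2 * (1 - real (ht h j - 1) * (wd j / mass h))" if j: "1 \<le> j" for j
  proof -
    have "(\<Sum>k<ht h j - 1. measure (SM h) (?B \<inter> level h j k))
        = (\<Sum>k<ht h j - 1. measure (SM h) (A \<inter> level h j (Suc k)))"
    proof (rule sum.cong)
      fix k assume "k \<in> {..<ht h j - 1}"
      then have k: "Suc k < ht h j" by simp
      then have "?B \<inter> level h j k = T h -` A \<inter> level h j k"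
        using level_subset_space[OF j, of k h] by (auto simp: space_SM)
      then show "measure (SM h) (?B \<inter> level h j k) = measure (SM h) (A \<inter> level h j (Suc k))"
        using measure_translate_level[OF j k assms(2)] by simp
    qed simp
    moreover have "\<bar>measure (SM h) ?B - (\<Sum>k<ht h j - 1. measure (SM h) (?B \<inter> level h j k))\<bar>
        \<le> 1 - real (ht h j - 1) * (wd j / mass h)"
      by (rule measure_near_part[OF B j]) auto
    moreover have "\<bar>measure (SM h) A - (\<Sum>k<ht h j - 1. measure (SM h) (A \<inter> level h j (Suc k)))\<bar>
        \<le> 1 - real (ht h j - 1) * (wd j / mass h)"
      by (rule measure_near_part[OF assms(2) j]) auto
    moreover have "\<bar>a - b\<bar> \<le> 2 * c" if "s = t" "\<bar>a - s\<bar> \<le> c" "\<bar>b - t\<bar> \<le> c" for a b c s t :: real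
      using that by linarith
    ultimately show ?thesis by blast
  qed
  have "(\<lambda>j. 2 * (1 - real (ht h j - 1) * (wd j / mass h))) \<longlonglongrightarrow> 2 * 0"
    by (intro tendsto_intros uncovered_tendsto assms(1))
  then have "\<bar>measure (SM h) ?B - measure (SM h) A\<bar> \<le> 2 * 0"
    by (rule tendsto_lowerbound) (use est in \<open>auto simp: eventually_sequentially\<close>)
  then show ?thesis by simp
qed

lemma distr_T: "0 < h \<Longrightarrow> distr (SM h) (SM h) (T h) = SM h"
proof (rule measure_eqI)
  interpret prob_space "SM h" by (rule prob_space_SM)
  fix A assume h: "0 < h" and "A \<in> sets (distr (SM h) (SM h) (T h))"
  then have A: "A \<in> sets (SM h)" by simp
  then show "emeasure (distr (SM h) (SM h) (T h)) A = emeasure (SM h) A"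
    using T_preserves[OF h A] T_measurable[OF h]
    by (subst emeasure_distr) (auto simp: emeasure_eq_measure)
qed simp

text \<open>
  Measure preservation replaces injectivity: level \<open>k\<close> is contained in the preimage of level \<open>Suc k\<close>
  and has the same measure.
\<close>

lemma vimage_level_null:
  assumes "0 < h" "1 \<le> j" "Suc k < ht h j"
  shows "measure (SM h) ((T h -` level h j (Suc k) \<inter> space (SM h)) - level h j k) = 0"
proof -
  interpret prob_space "SM h" by (rule prob_space_SM)
  have s: "level h j (Suc k) \<in> sets (SM h)" "level h j k \<in> sets (SM h)"
    using level_sets[OF assms(2)] assms(3) by auto
  have sub: "level h j k \<subseteq> T h -` level h j (Suc k) \<inter> space (SM h)"
    using T_level[OF assms(2,3)] level_subset_space[OF assms(2), of k h] assms(3) by (auto simp: space_SM)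
  have "prob ((T h -` level h j (Suc k) \<inter> space (SM h)) - level h j k)
      = prob (T h -` level h j (Suc k) \<inter> space (SM h)) - prob (level h j k)"
    using T_measurable[OF assms(1)] s sub by (intro finite_measure_Diff) (auto intro: measurable_sets)
  also have "\<dots> = 0"
    using T_preserves[OF assms(1) s(1)] measure_level[OF assms(2)] assms(3) by simp
  finally show ?thesis .
qed

section \<open>Generating the sigma-algebra by levels\<close>

lemma level_iterated_subset:
  assumes "j \<le> j'" "1 \<le> j" "k' < ht h j'" "k < ht h j" "x \<in> level h j k" "x \<in> level h j' k'"
  shows "level h j' k' \<subseteq> level h j k"
  using assms(1,3,6)
proof (induction j' arbitrary: k' rule: dec_induct)
  case base
  then show ?case using level_unique[OF assms(2), of k h k' x] assms(4,5) by simp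
next
  case (step i)
  have i1: "1 \<le> i" using step.hyps assms(2) by simp
  have "x < real (ht h i) * wd i"
  proof -
    have "x < real (ht h j) * wd j" using Union_levels[OF assms(2), of h] assms(4,5) by auto
    then show ?thesis using tower_mass_mono[OF assms(2) step.hyps(1), of h] by linarith
  qed
  moreover have "0 \<le> x" using Union_levels[OF assms(2), of h] assms(4,5) by auto
  ultimately have "x \<in> (\<Union>k<ht h i. level h i k)" unfolding Union_levels[OF i1] by simp
  then obtain a where a: "a < ht h i" "x \<in> level h i a" by auto
  obtain b where b: "b < i" "x \<in> level h (Suc i) (b * ht h i + tri b + a)"
    using level_split[OF i1 a] .
  have "k' = b * ht h i + tri b + a"
    using level_unique[of "Suc i" k' h "b * ht h i + tri b + a" x] step.prems b
      subcolumn_index_less[OF i1 b(1) a(1)] by simp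
  then have "level h (Suc i) k' \<subseteq> level h i a" using level_Suc_subset[OF i1 b(1) a(1)] by simp
  also have "\<dots> \<subseteq> level h j k" by (rule step.IH[OF a])
  finally show ?case .
qed

text \<open>
  The empty set and the whole space are included to obtain a generator that is closed under
  intersection and contains the space.
\<close>

definition levels :: "nat \<Rightarrow> real set set" where
  "levels h = insert {} (insert {0..<mass h} {level h j k |j k. 1 \<le> j \<and> k < ht h j})"

lemma Int_stable_levels: "Int_stable (levels h)"
proof (rule Int_stableI)
  have key: "level h j k \<inter> level h j' k' \<in> levels h"
    if a: "1 \<le> j" "k < ht h j" "1 \<le> j'" "k' < ht h j'" "j \<le> j'" for j k j' k'
  proof (cases "level h j k \<inter> level h j' k' = {}")
    case True
    then show ?thesis by (simp add: levels_def)
  next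
    case False
    then obtain x where "x \<in> level h j k" "x \<in> level h j' k'" by blast
    then have "level h j' k' \<subseteq> level h j k" using level_iterated_subset[of j j' k' h k x] a by simp
    then have "level h j k \<inter> level h j' k' = level h j' k'" by blast
    then show ?thesis using a by (auto simp: levels_def)
  qed
  fix A B assume AB: "A \<in> levels h" "B \<in> levels h"
  have sub: "X \<subseteq> {0..<mass h}" if "X \<in> levels h" for X
    using that level_subset_space by (auto simp: levels_def)
  consider "A = {}" | "A = {0..<mass h}" | "B = {}" | "B = {0..<mass h}"
    | j k j' k' where "A = level h j k" "B = level h j' k'" "1 \<le> j" "k < ht h j" "1 \<le> j'" "k' < ht h j'"
    using AB unfolding levels_def by blast
  then show "A \<inter> B \<in> levels h"
  proof cases
    case 5
    then show ?thesis using key[of j k j' k'] key[of j' k' j k] by (cases "j \<le> j'") (auto simp: Int_commute)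
  next
    case 2
    then have "A \<inter> B = B" using sub[OF AB(2)] by blast
    then show ?thesis using AB by simp
  next
    case 4
    then have "A \<inter> B = A" using sub[OF AB(1)] by blast
    then show ?thesis using AB by simp
  qed (simp_all add: levels_def)
qed

lemma countable_levels: "countable (levels h)"
proof -
  have "{level h j k |j k. 1 \<le> j \<and> k < ht h j} \<subseteq> range (\<lambda>(j, k). level h j k)" by auto
  then have "countable {level h j k |j k. 1 \<le> j \<and> k < ht h j}"
    by (rule countable_subset) simp
  then show ?thesis by (simp add: levels_def)
qed

lemma levels_subset: "levels h \<subseteq> Pow {0..<mass h}"
  using level_subset_space by (auto simp: levels_def)

text \<open>
  The widths of the levels tend to zero, so every open set is a countable union of levels.
\<close>

lemma sets_SM_levels: "sets (SM h) = sigma_sets {0..<mass h} (levels h)"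
proof
  have "levels h \<subseteq> sets (SM h)"
    using level_sets by (auto simp: levels_def sets_SM_iff)
  then show "sigma_sets {0..<mass h} (levels h) \<subseteq> sets (SM h)"
    using sets.sigma_sets_subset[of "levels h" "SM h"] by (simp add: space_SM)
next
  interpret S: sigma_algebra "{0..<mass h}" "sigma_sets {0..<mass h} (levels h)"
    by (rule sigma_algebra_sigma_sets[OF levels_subset])
  have open_in: "U \<inter> {0..<mass h} \<in> sigma_sets {0..<mass h} (levels h)" if U: "open U" for U
  proof -
    let ?L = "{L \<in> levels h. L \<subseteq> U \<inter> {0..<mass h}}"
    have "U \<inter> {0..<mass h} \<subseteq> \<Union>?L"
    proof
      fix x assume x: "x \<in> U \<inter> {0..<mass h}"
      then obtain e where e: "0 < e" "ball x e \<subseteq> U" using U openE by blast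
      have "\<forall>\<^sub>F j in sequentially. wd j < e" using wd_tendsto e(1) by (rule order_tendstoD(2))
      moreover have "\<forall>\<^sub>F j in sequentially. x < real (ht h j) * wd j"
        using tower_mass_tendsto[of h] x by (intro order_tendstoD(1)) auto
      ultimately have "\<forall>\<^sub>F j in sequentially. wd j < e \<and> x < real (ht h j) * wd j \<and> 1 \<le> j"
        using eventually_ge_at_top[of 1] by eventually_elim simp
      then obtain j where j: "wd j < e" "x < real (ht h j) * wd j" "1 \<le> j" using eventually_happens by force
      then have "x \<in> (\<Union>k<ht h j. level h j k)" using x unfolding Union_levels[OF j(3)] by simp
      then obtain k where k: "k < ht h j" "x \<in> level h j k" by auto
      have "level h j k \<subseteq> ball x e"
        using k(2) j(1) by (auto simp: level_eq dist_real_def)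
      then have "level h j k \<in> ?L"
        using e(2) k j level_subset_space[of j k h] by (auto simp: levels_def)
      then show "x \<in> \<Union>?L" using k(2) by blast
    qed
    then have eq: "U \<inter> {0..<mass h} = \<Union>?L" by blast
    have "countable ?L" using countable_levels by (rule countable_subset[rotated]) auto
    then have "\<Union>?L \<in> sigma_sets {0..<mass h} (levels h)"
      by (intro S.countable_Union) (auto intro: sigma_sets.Basic)
    then show ?thesis using eq by simp
  qed
  show "sets (SM h) \<subseteq> sigma_sets {0..<mass h} (levels h)"
  proof
    fix A assume "A \<in> sets (SM h)"
    then have A: "A \<in> sigma_sets UNIV {U::real set. open U}" "A \<subseteq> {0..<mass h}"
      by (auto simp: sets_SM_iff borel_def)
    have "X \<inter> {0..<mass h} \<in> sigma_sets {0..<mass h} (levels h)" if "X \<in> sigma_sets UNIV {U::real set. open U}" for X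
      using that
    proof induction
      case (Basic a)
      then show ?case using open_in by simp
    next
      case Empty
      then show ?case by (simp add: sigma_sets.Empty)
    next
      case (Compl a)
      have "(UNIV - a) \<inter> {0..<mass h} = {0..<mass h} - (a \<inter> {0..<mass h})" by blast
      then show ?case using Compl by (simp add: sigma_sets.Compl)
    next
      case (Union a)
      have eq: "(\<Union>i. a i) \<inter> {0..<mass h} = (\<Union>i. a i \<inter> {0..<mass h})" by blast
      show ?case unfolding eq by (rule sigma_sets.Union[OF Union.IH])
    qed
    from this[OF A(1)] have "A \<inter> {0..<mass h} \<in> sigma_sets {0..<mass h} (levels h)" .
    moreover have "A \<inter> {0..<mass h} = A" using A(2) by blast
    ultimately show "A \<in> sigma_sets {0..<mass h} (levels h)" by simp
  qed
qed

section \<open>Words of level functions\<close>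

definition word :: "nat \<Rightarrow> (real \<Rightarrow> real) \<Rightarrow> nat \<Rightarrow> int \<Rightarrow> real" where
  "word h g j n = (if 0 \<le> n \<and> n < int (ht h j) then g (lv h j ! nat n) else 0)"

text \<open>
  Constancy is required on the grid cells, which are the levels regardless of their order, and also
  on the half-line beyond the tower, from which all later spacers are cut. In this form the property
  passes to the next stage.
\<close>

definition level_function :: "nat \<Rightarrow> nat \<Rightarrow> (real \<Rightarrow> real) \<Rightarrow> bool" where
  "level_function h j g \<longleftrightarrow>
     (\<forall>c<ht h j. \<forall>x. real c * wd j \<le> x \<longrightarrow> x < real c * wd j + wd j \<longrightarrow> g x = g (real c * wd j)) \<and>
     (\<forall>x\<ge>real (ht h j) * wd j. g x = g (real (ht h j) * wd j))"

lemma level_functionD: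
  assumes "level_function h j g" "1 \<le> j" "k < ht h j" "x \<in> level h j k"
  shows "g x = g (lv h j ! k)"
proof -
  obtain c where c: "c < ht h j" "lv h j ! k = real c * wd j" using lv_nth_grid[OF assms(2,3)] .
  have "real c * wd j \<le> x" "x < real c * wd j + wd j"
    using assms(4) unfolding level_eq c(2) by simp_all
  then show ?thesis using assms(1) c(1) unfolding level_function_def c(2) by blast
qed

lemma level_function_Suc:
  assumes "1 \<le> j" "level_function h j g"
  shows "level_function h (Suc j) g"
proof -
  let ?H = "ht h j" and ?w = "wd (Suc j)"
  have w: "0 < ?w" "wd j = real j * ?w" using assms(1) wd_pos[of "Suc j"] by (simp_all add: wd_Suc)
  have cell: "g x = g (real b * wd j)" if "b < ?H" "real b * wd j \<le> x" "x < real b * wd j + wd j" for b x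
    using assms(2) that unfolding level_function_def by blast
  have tail: "g x = g (real ?H * wd j)" if "real ?H * wd j \<le> x" for x
    using assms(2) that unfolding level_function_def by blast
  show ?thesis unfolding level_function_def
  proof (intro conjI allI impI)
    fix c x assume c: "c < ht h (Suc j)" and x: "real c * ?w \<le> x" "x < real c * ?w + ?w"
    show "g x = g (real c * ?w)"
    proof (cases "c < j * ?H")
      case True
      define b where "b = c div j"
      have b: "b < ?H" using True assms(1) by (simp add: b_def less_mult_imp_div_less mult.commute)
      have lo: "b * j \<le> c" "c + 1 \<le> b * j + j"
      proof -
        have "c = b * j + c mod j" by (simp add: b_def)
        moreover have "c mod j < j" using assms(1) by simp
        ultimately show "b * j \<le> c" "c + 1 \<le> b * j + j" by linarith+
      qed
      have "real (b * j) \<le> real c" "real (c + 1) \<le> real (b * j + j)" using lo by (simp_all only: of_nat_le_iff)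
      then have "real (b * j) * ?w \<le> real c * ?w" "real (c + 1) * ?w \<le> real (b * j + j) * ?w"
        using w(1) by (simp_all only: mult_le_cancel_right_pos)
      then have "real b * wd j \<le> real c * ?w" "real c * ?w + ?w \<le> real b * wd j + wd j"
        using w(2) by (simp_all add: distrib_right mult.assoc)
      then show ?thesis using cell[OF b, of x] cell[OF b, of "real c * ?w"] x w(1) by simp
    next
      case False
      then have "real (j * ?H) \<le> real c" by (simp only: of_nat_le_iff not_less)
      then have "real (j * ?H) * ?w \<le> real c * ?w" using w(1) by (simp only: mult_le_cancel_right_pos)
      then have "real ?H * wd j \<le> real c * ?w" using w(2) by (simp add: mult.commute mult.left_commute)
      then show ?thesis using tail[of x] tail[of "real c * ?w"] x by simp
    qed
  next
    fix x assume "real (ht h (Suc j)) * ?w \<le> x"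
    then show "g x = g (real (ht h (Suc j)) * ?w)"
      using tail[of x] tail[of "real (ht h (Suc j)) * ?w"] tower_mass_Suc[OF assms(1), of h] by simp
  qed
qed

lemma level_function_mono:
  assumes "i \<le> j" "1 \<le> i" "level_function h i g"
  shows "level_function h j g"
  using assms(1)
proof (induction j rule: dec_induct)
  case (step j)
  then show ?case using level_function_Suc[of j h g] assms(2) by simp
qed (use assms in simp)

lemma level_function_indicator:
  assumes "1 \<le> m" "k < ht h m"
  shows "level_function h m (\<lambda>x. indicator (level h m k) x - b)"
proof -
  obtain c0 where c0: "c0 < ht h m" "lv h m ! k = real c0 * wd m" using lv_nth_grid[OF assms] .
  note w = wd_pos[OF assms(1)]
  have in_iff: "x \<in> level h m k \<longleftrightarrow> c = c0" if "real c * wd m \<le> x" "x < real c * wd m + wd m" for c x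
    using that grid_interval_disjoint[OF w that, of c0] unfolding level_eq c0(2) by auto
  have tail: "x \<notin> level h m k" if "real (ht h m) * wd m \<le> x" for x
  proof
    assume "x \<in> level h m k"
    then have "x \<in> {0..<real (ht h m) * wd m}" using Union_levels[OF assms(1), of h] assms(2) by blast
    then show False using that by simp
  qed
  show ?thesis unfolding level_function_def
  proof (intro conjI allI impI)
    fix c x assume "real c * wd m \<le> x" "x < real c * wd m + wd m"
    then have "x \<in> level h m k \<longleftrightarrow> real c * wd m \<in> level h m k"
      using in_iff[of c x] in_iff[of c "real c * wd m"] w by simp
    then show "indicator (level h m k) x - b = indicator (level h m k) (real c * wd m) - b"
      by (simp add: indicator_def)
  next
    fix x assume "real (ht h m) * wd m \<le> x"
    then show "indicator (level h m k) x - b = indicator (level h m k) (real (ht h m) * wd m) - b"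
      using tail[of x] tail[of "real (ht h m) * wd m"] by simp
  qed
qed

lemma staircase_word_word:
  assumes "0 < h" "1 \<le> m" "level_function h m g" "\<And>x. \<bar>g x\<bar> \<le> 1"
  shows "staircase_word h m (word h g)"
proof
  show "0 < h" "1 \<le> m" by fact+
  show "\<bar>word h g j n\<bar> \<le> 1" for j n using assms(4) by (simp add: word_def)
  show "0 \<le> n \<and> n < int (ht h j)" if "m \<le> j" "word h g j n \<noteq> 0" for j n
    using that by (simp add: word_def split: if_splits)
  fix j assume mj: "m \<le> j"
  have j1: "1 \<le> j" using assms(2) mj by simp
  have g: "level_function h j g" by (rule level_function_mono[OF mj assms(2,3)])
  define blk where "blk = (\<lambda>k. {pos h j k..<pos h j k + int (ht h j)})"
  define Z where "Z = {0..<int (ht h (Suc j))} - (\<Union>k<j. blk k)"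
  have blk_unique: "k = l" if "n \<in> blk k" "n \<in> blk l" for k l n
  proof (rule ccontr)
    have less: False if kl: "k < l" "n \<in> blk k" "n \<in> blk l" for k l
    proof -
      have "pos h j l = pos h j k + int (l - k) * int (ht h j) + int (tri (l - k)) + int k * int (l - k)"
        using pos_add[of h j k "l - k"] kl(1) by simp
      moreover have "1 * int (ht h j) \<le> int (l - k) * int (ht h j)" using kl(1) by (intro mult_right_mono) auto
      moreover have "0 \<le> int k * int (l - k)" by simp
      ultimately have "pos h j k + int (ht h j) \<le> pos h j l" by linarith
      then show False using kl(2,3) by (simp add: blk_def)
    qed
    assume "k \<noteq> l"
    then show False using less[of k l] less[of l k] that by linarith
  qed
  have blk_sub: "blk k \<subseteq> {0..<int (ht h (Suc j))}" if "k < j" for k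
    using pos_plus_ht_le[OF j1 that, of h] pos_nonneg[of h j k] by (auto simp: blk_def)
  have off: "word h g j (n - pos h j k) = 0" if "n \<notin> blk k" for n k
    using that by (auto simp: word_def blk_def)
  have P_in: "(\<Sum>k<j. word h g j (n - pos h j k)) = word h g (Suc j) n" if k: "k < j" "n \<in> blk k" for n k
  proof -
    have "(\<Sum>l<j. word h g j (n - pos h j l)) = (\<Sum>l<j. if l = k then word h g j (n - pos h j k) else 0)"
    proof (intro sum.cong refl)
      fix l
      show "word h g j (n - pos h j l) = (if l = k then word h g j (n - pos h j k) else 0)"
      proof (cases "l = k")
        case False
        then have "n \<notin> blk l" using blk_unique[of n k l] k(2) by blast
        then show ?thesis using off[of n l] False by simp
      qed simp
    qed
    also have "\<dots> = word h g j (n - pos h j k)" using k(1) by simp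
    also have "\<dots> = word h g (Suc j) n"
    proof -
      define i where "i = nat (n - pos h j k)"
      have i: "i < ht h j" "n = pos h j k + int i" using k(2) by (auto simp: i_def blk_def)
      then have "n = int (k * ht h j + tri k + i)" by (simp add: pos_def)
      then have n: "nat n = k * ht h j + tri k + i" by (simp only: nat_int)
      have "lv h (Suc j) ! nat n \<in> level h (Suc j) (nat n)"
        using wd_pos[of "Suc j"] unfolding level_eq by simp
      then have "lv h (Suc j) ! nat n \<in> level h j i"
        using level_Suc_subset[OF j1 k(1) i(1)] unfolding n by blast
      then have "g (lv h (Suc j) ! nat n) = g (lv h j ! i)" by (rule level_functionD[OF g j1 i(1)])
      moreover have "n \<in> {0..<int (ht h (Suc j))}" using blk_sub[OF k(1)] k(2) by blast
      ultimately show ?thesis using i by (simp add: word_def)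
    qed
    finally show ?thesis .
  qed
  have P_out: "(\<Sum>k<j. word h g j (n - pos h j k)) = 0" if "n \<notin> (\<Union>k<j. blk k)" for n
    using that off by (intro sum.neutral) auto
  have "card Z \<le> j ^ 2"
  proof -
    have "card (\<Union>k<j. blk k) = (\<Sum>k<j. card (blk k))"
    proof (rule card_UN_disjoint)
      show "\<forall>a\<in>{..<j}. \<forall>b\<in>{..<j}. a \<noteq> b \<longrightarrow> blk a \<inter> blk b = {}" using blk_unique by blast
    qed (simp_all add: blk_def)
    also have "\<dots> = j * ht h j" by (simp add: blk_def)
    finally have c: "card (\<Union>k<j. blk k) = j * ht h j" .
    have "card Z = ht h (Suc j) - j * ht h j"
    proof -
      have "(\<Union>k<j. blk k) \<subseteq> {0..<int (ht h (Suc j))}" using blk_sub by blast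
      moreover have "finite (\<Union>k<j. blk k)" by (simp add: blk_def)
      ultimately show ?thesis unfolding Z_def by (simp add: card_Diff_subset c)
    qed
    also have "\<dots> = tri j" using ht_Suc[OF j1, of h] by simp
    finally show ?thesis using tri_le_square[of j] by simp
  qed
  moreover have "if n \<in> Z then (\<Sum>k<j. word h g j (n - pos h j k)) = 0
           else word h g (Suc j) n = (\<Sum>k<j. word h g j (n - pos h j k))" for n
  proof (cases "n \<in> (\<Union>k<j. blk k)")
    case True
    then have "n \<notin> Z" by (simp add: Z_def)
    then show ?thesis using True P_in by auto
  next
    case False
    then show ?thesis using P_out[OF False] by (auto simp: Z_def word_def)
  qed
  ultimately show "\<exists>Z. finite Z \<and> card Z \<le> j ^ 2 \<and>
      (\<forall>n. if n \<in> Z then (\<Sum>k<j. word h g j (n - pos h j k)) = 0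
           else word h g (Suc j) n = (\<Sum>k<j. word h g j (n - pos h j k)))"
    by (intro exI[of _ Z]) (auto simp: Z_def)
qed

lemma level_as_union:
  assumes "1 \<le> m" "k < ht h m" "m \<le> q"
  shows "level h m k = (\<Union>n\<in>{n. n < ht h q \<and> lv h q ! n \<in> level h m k}. level h q n)"
proof (intro set_eqI iffI)
  have q1: "1 \<le> q" using assms by simp
  fix x assume x: "x \<in> level h m k"
  then have "x \<in> {0..<real (ht h m) * wd m}" using Union_levels[OF assms(1), of h] assms(2) by blast
  then have "x \<in> (\<Union>n<ht h q. level h q n)"
    using tower_mass_mono[OF assms(1,3), of h] unfolding Union_levels[OF q1] by auto
  then obtain n where n: "n < ht h q" "x \<in> level h q n" by auto
  have "level h q n \<subseteq> level h m k" by (rule level_iterated_subset[OF assms(3,1) n(1) assms(2) x n(2)])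
  moreover have "lv h q ! n \<in> level h q n" using wd_pos[OF q1] by (simp add: level_eq)
  ultimately show "x \<in> (\<Union>n\<in>{n. n < ht h q \<and> lv h q ! n \<in> level h m k}. level h q n)" using n by blast
next
  have q1: "1 \<le> q" using assms by simp
  fix x assume "x \<in> (\<Union>n\<in>{n. n < ht h q \<and> lv h q ! n \<in> level h m k}. level h q n)"
  then obtain n where n: "n < ht h q" "lv h q ! n \<in> level h m k" "x \<in> level h q n" by blast
  have "lv h q ! n \<in> level h q n" using wd_pos[OF q1] by (simp add: level_eq)
  then have "level h q n \<subseteq> level h m k" by (rule level_iterated_subset[OF assms(3,1) n(1) assms(2) n(2)])
  then show "x \<in> level h m k" using n(3) by blast
qed

lemma card_sublevels:
  assumes "1 \<le> m" "k < ht h m" "m \<le> q"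
  shows "real (card {n. n < ht h q \<and> lv h q ! n \<in> level h m k}) * wd q = wd m"
proof -
  interpret prob_space "SM h" by (rule prob_space_SM)
  let ?U = "{n. n < ht h q \<and> lv h q ! n \<in> level h m k}"
  have q1: "1 \<le> q" using assms by simp
  have "prob (level h m k) = prob (\<Union>n\<in>?U. level h q n)" using level_as_union[OF assms] by simp
  also have "\<dots> = (\<Sum>n\<in>?U. prob (level h q n))"
    using level_sets[OF q1] disjoint_family_level[OF q1, of h]
    by (intro finite_measure_finite_Union) (auto simp: disjoint_family_on_def)
  also have "\<dots> = (\<Sum>n\<in>?U. wd q / mass h)" using measure_level[OF q1] by (intro sum.cong) auto
  finally show ?thesis using measure_level[OF assms(1,2)] mass_pos[of h] by simp
qed

lemma sum_int_interval: "(\<Sum>p\<in>{0..<int n}. f p) = (\<Sum>p<n. f (int p))"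
proof -
  have "{0..<int n} = int ` {..<n}"
  proof (intro set_eqI iffI)
    fix x assume "x \<in> {0..<int n}"
    then show "x \<in> int ` {..<n}" by (intro image_eqI[of _ _ "nat x"]) auto
  qed auto
  then show ?thesis by (simp add: sum.reindex)
qed

lemma word_indicator_sum:
  assumes "1 \<le> m" "k < ht h m" "m \<le> q"
  shows "(\<Sum>n\<in>{0..<int (ht h q)}. word h (\<lambda>x. indicator (level h m k) x - b) q n) = wd m / wd q - b * real (ht h q)"
proof -
  let ?g = "\<lambda>x. indicator (level h m k) x - b :: real"
  have w: "0 < wd q" using assms by (intro wd_pos) simp
  have "(\<Sum>n\<in>{0..<int (ht h q)}. word h ?g q n) = (\<Sum>n<ht h q. ?g (lv h q ! n))"
    unfolding sum_int_interval by (simp add: word_def)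
  also have "\<dots> = (\<Sum>n<ht h q. indicator (level h m k) (lv h q ! n)) - b * real (ht h q)"
    by (simp add: sum_subtractf)
  also have "(\<Sum>n<ht h q. indicator (level h m k) (lv h q ! n)) = real (card {n. n < ht h q \<and> lv h q ! n \<in> level h m k})"
    by (simp add: indicator_def sum.If_cases Int_def)
  also have "\<dots> = wd m / wd q" using card_sublevels[OF assms] w by (simp add: field_simps)
  finally show ?thesis .
qed

lemma balanced_word_word:
  assumes "0 < h" "1 \<le> i" "k < ht h i" "i \<le> m"
  shows "balanced_word h m (word h (\<lambda>x. indicator (level h i k) x - wd i / mass h))"
proof -
  let ?b = "wd i / mass h"
  let ?g = "\<lambda>x. indicator (level h i k) x - ?b"
  have b: "0 \<le> ?b" "?b \<le> 1"
  proof -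
    have "?b = measure (SM h) (level h i k)" using measure_level[OF assms(2,3)] by simp
    then show "0 \<le> ?b" "?b \<le> 1" using prob_space.prob_le_1[OF prob_space_SM] by (simp_all add: measure_nonneg)
  qed
  have lf: "level_function h m ?g"
    by (rule level_function_mono[OF assms(4,2) level_function_indicator[OF assms(2,3)]])
  interpret staircase_word h m "word h ?g"
  proof (rule staircase_word_word[OF assms(1) _ lf])
    show "1 \<le> m" using assms by simp
    have "\<bar>indicator A x - b\<bar> \<le> 1" if "0 \<le> b" "b \<le> 1" for A and x b :: real
      using that by (simp add: indicator_def)
    then show "\<bar>?g x\<bar> \<le> 1" for x using b by blast
  qed
  show ?thesis
  proof
    have "(\<lambda>q. wd i / (real (ht h q) * wd q) - ?b) \<longlonglongrightarrow> wd i / mass h - ?b"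
      using mass_pos[of h] by (intro tendsto_intros tower_mass_tendsto) auto
    then have lim: "(\<lambda>q. wd i / (real (ht h q) * wd q) - ?b) \<longlonglongrightarrow> 0" by simp
    have "\<forall>\<^sub>F q in sequentially. wd i / (real (ht h q) * wd q) - ?b
        = (\<Sum>n\<in>{0..<int (ht h q)}. word h ?g q n) / real (ht h q)"
      using eventually_ge_at_top[of m]
    proof eventually_elim
      case (elim q)
      have "0 < real (ht h q)" by (rule ht_real_pos[OF elim])
      then show ?case using word_indicator_sum[OF assms(2,3), of q ?b] elim assms(4)
        by (simp add: diff_divide_distrib mult.commute)
    qed
    then show "(\<lambda>q. (\<Sum>n\<in>{0..<int (ht h q)}. word h ?g q n) / real (ht h q)) \<longlonglongrightarrow> 0"
      by (rule Lim_transform_eventually[OF lim])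
  qed
qed

section \<open>Summation along diagonals\<close>

lemma sum_by_diagonals:
  fixes G :: "int \<Rightarrow> int \<Rightarrow> real"
  assumes "0 \<le> H" "0 \<le> H'"
  shows "(\<Sum>p\<in>{0..<H'}. \<Sum>q\<in>{0..<H}. G p (q - p))
    = (\<Sum>s\<in>{-H'..<H}. \<Sum>p\<in>{0..<H'}. if 0 \<le> p + s \<and> p + s < H then G p s else 0)"
proof -
  have "(\<Sum>q\<in>{0..<H}. G p (q - p)) = (\<Sum>s\<in>{-H'..<H}. if 0 \<le> p + s \<and> p + s < H then G p s else 0)"
    if "p \<in> {0..<H'}" for p
  proof -
    have "(\<Sum>q\<in>{0..<H}. G p (q - p)) = (\<Sum>s\<in>{- p..<H - p}. G p s)"
      using sum_translate_int[where f = "G p" and c = "- p" and a = 0 and b = H] by simp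
    also have "\<dots> = (\<Sum>s\<in>{-H'..<H}. if 0 \<le> p + s \<and> p + s < H then G p s else 0)"
      using that by (intro sum.mono_neutral_cong_left) auto
    finally show ?thesis .
  qed
  then show ?thesis by (subst sum.swap) simp
qed

text \<open>
  In a rectangle, short diagonals occur only near two opposite corners.
\<close>

lemma overlap_small:
  fixes H H' p q :: int
  assumes "0 \<le> p" "p < H'" "0 \<le> q" "q < H" "H \<le> H'" "d < 1"
    and "real (card {r \<in> {0..<H'}. 0 \<le> r + (q - p) \<and> r + (q - p) < H}) < d * real_of_int H"
  shows "real_of_int H - d * real_of_int H < real_of_int q \<or> real_of_int H' - d * real_of_int H < real_of_int p"
proof (cases "p \<le> q")
  case True
  then have "{r \<in> {0..<H'}. 0 \<le> r + (q - p) \<and> r + (q - p) < H} = {0..<H - (q - p)}" using assms by auto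
  then have "real_of_int (H - (q - p)) < d * real_of_int H" using assms(7) True assms by simp
  then show ?thesis using assms(1) by linarith
next
  case False
  then have "{r \<in> {0..<H'}. 0 \<le> r + (q - p) \<and> r + (q - p) < H} = {p - q..<min H' (H + (p - q))}" using assms by auto
  then have *: "real (nat (min H' (H + (p - q)) - (p - q))) < d * real_of_int H" using assms(7) by simp
  have "d * real_of_int H \<le> 1 * real_of_int H" using assms by (intro mult_right_mono) auto
  then have "real_of_int (H' - (p - q)) < d * real_of_int H" using * by linarith
  then show ?thesis using assms(3) by linarith
qed

lemma diagonal_invariance:
  fixes c :: "int \<Rightarrow> int \<Rightarrow> real"
  assumes diag: "\<And>p q. 0 \<le> p \<Longrightarrow> 0 \<le> q \<Longrightarrow> p + 1 < H' \<Longrightarrow> q + 1 < H \<Longrightarrow> c (p + 1) (q + 1) = c p q"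
    and "0 \<le> p" "p < H'" "0 \<le> q" "q < H"
  shows "c p q = c (max 0 (p - q)) (max 0 (q - p))"
proof -
  have *: "c (a + int n) (b + int n) = c a b" if "0 \<le> a" "0 \<le> b" "a + int n < H'" "b + int n < H" for a b n
    using that
  proof (induction n)
    case (Suc n)
    have "c (a + int (Suc n)) (b + int (Suc n)) = c ((a + int n) + 1) ((b + int n) + 1)" by (simp add: algebra_simps)
    also have "\<dots> = c (a + int n) (b + int n)" using Suc.prems by (intro diag) auto
    finally show ?case using Suc by simp
  qed simp
  define a b n where "a = max 0 (p - q)" and "b = max 0 (q - p)" and "n = nat (min p q)"
  have pq: "p = a + int n" "q = b + int n" using assms(2,4) by (auto simp: a_def b_def n_def)
  have "c (a + int n) (b + int n) = c a b"
    by (rule *) (use assms(3,5) in \<open>simp_all add: pq[symmetric], simp_all add: a_def b_def\<close>)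
  then show ?thesis unfolding pq[symmetric] unfolding a_def b_def .
qed

lemma card_upper_part:
  fixes H :: int
  assumes "0 \<le> t" "0 \<le> H"
  shows "real (card {q \<in> {0..<H}. real_of_int H - t < real_of_int q}) \<le> t"
proof -
  have "{q \<in> {0..<H}. real_of_int H - t < real_of_int q} \<subseteq> {H - \<lfloor>t\<rfloor>..<H}" by (auto) linarith
  then have "card {q \<in> {0..<H}. real_of_int H - t < real_of_int q} \<le> card {H - \<lfloor>t\<rfloor>..<H}"
    by (intro card_mono) auto
  also have "\<dots> = nat \<lfloor>t\<rfloor>" by simp
  finally show ?thesis using assms(1) by linarith
qed

text \<open>
  The weights are constant along diagonals, so the sum is a weighted sum of the correlations of \<open>X\<close> and
  \<open>Y\<close>. A diagonal with at least \<open>d * H\<close> points contributes at most \<open>e\<close> times its mass. The shorter ones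
  lie in corners, to which the marginals give mass at most \<open>2 d\<close>.
\<close>

lemma diagonal_estimate:
  fixes c :: "int \<Rightarrow> int \<Rightarrow> real" and X Y :: "int \<Rightarrow> real" and H H' :: int
  assumes H: "0 < H" "H \<le> H'" and d: "0 < d" "d < 1" and e: "0 < e"
    and nonneg: "\<And>p q. 0 \<le> c p q"
    and diag: "\<And>p q. 0 \<le> p \<Longrightarrow> 0 \<le> q \<Longrightarrow> p + 1 < H' \<Longrightarrow> q + 1 < H \<Longrightarrow> c (p + 1) (q + 1) = c p q"
    and rows: "\<And>p. p \<in> {0..<H'} \<Longrightarrow> (\<Sum>q\<in>{0..<H}. c p q) \<le> 1 / real_of_int H'"
    and cols: "\<And>q. q \<in> {0..<H} \<Longrightarrow> (\<Sum>p\<in>{0..<H'}. c p q) \<le> 1 / real_of_int H"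
    and XY: "\<And>p. \<bar>X p\<bar> \<le> 1" "\<And>q. \<bar>Y q\<bar> \<le> 1" and supp: "\<And>q. Y q \<noteq> 0 \<Longrightarrow> 0 \<le> q \<and> q < H"
    and corr: "\<And>s. \<bar>\<Sum>p\<in>{0..<H'}. X p * Y (p + s)\<bar> \<le> e * (d * real_of_int H)"
  shows "\<bar>\<Sum>p\<in>{0..<H'}. \<Sum>q\<in>{0..<H}. X p * Y q * c p q\<bar> \<le> e + 2 * d"
proof -
  define \<gamma> where "\<gamma> = (\<lambda>s. c (max 0 (-s)) (max 0 s))"
  have c_eq: "c p q = \<gamma> (q - p)" if "p \<in> {0..<H'}" "q \<in> {0..<H}" for p q
    using diagonal_invariance[where c = c and H' = H' and H = H and p = p and q = q, OF diag] that
    by (simp add: \<gamma>_def)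
  define I where "I = (\<lambda>s. {p \<in> {0..<H'}. 0 \<le> p + s \<and> p + s < H})"
  define bad where "bad = (\<lambda>s. if real (card (I s)) < d * real_of_int H then 1 else 0 :: real)"
  have H0: "0 \<le> H" "0 \<le> H'" using H by auto
  \<comment> \<open>the trivial bound on short diagonals, the correlation bound on the others\<close>
  have inner: "\<bar>\<Sum>p\<in>I s. X p * Y (p + s)\<bar> \<le> (e + bad s) * real (card (I s))" for s
  proof (cases "real (card (I s)) < d * real_of_int H")
    case True
    have "\<bar>\<Sum>p\<in>I s. X p * Y (p + s)\<bar> \<le> (\<Sum>p\<in>I s. \<bar>X p * Y (p + s)\<bar>)" by (rule sum_abs)
    also have "\<dots> \<le> (\<Sum>p\<in>I s. 1)" using XY by (intro sum_mono) (simp add: abs_mult mult_le_one)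
    also have "\<dots> \<le> (e + bad s) * real (card (I s))" using True e by (simp add: bad_def distrib_right)
    finally show ?thesis .
  next
    case False
    have "(\<Sum>p\<in>I s. X p * Y (p + s)) = (\<Sum>p\<in>{0..<H'}. X p * Y (p + s))"
      using supp by (intro sum.mono_neutral_left) (force simp: I_def)+
    then have "\<bar>\<Sum>p\<in>I s. X p * Y (p + s)\<bar> \<le> e * (d * real_of_int H)" using corr by simp
    also have "\<dots> \<le> e * real (card (I s))" using False e by (intro mult_left_mono) auto
    finally show ?thesis using False by (simp add: bad_def)
  qed
  have ifsum: "(\<Sum>p\<in>{0..<H'}. if 0 \<le> p + s \<and> p + s < H then f p else 0) = (\<Sum>p\<in>I s. f p)" for s and f :: "int \<Rightarrow> real"
    unfolding I_def by (intro sum.mono_neutral_cong_right) auto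
  have "(\<Sum>p\<in>{0..<H'}. \<Sum>q\<in>{0..<H}. X p * Y q * c p q)
      = (\<Sum>p\<in>{0..<H'}. \<Sum>q\<in>{0..<H}. X p * Y (p + (q - p)) * \<gamma> (q - p))"
    using c_eq by (intro sum.cong refl) simp
  also have "\<dots> = (\<Sum>s\<in>{-H'..<H}. \<Sum>p\<in>I s. X p * Y (p + s) * \<gamma> s)"
    using sum_by_diagonals[OF H0, of "\<lambda>p s. X p * Y (p + s) * \<gamma> s"] unfolding ifsum .
  also have "\<dots> = (\<Sum>s\<in>{-H'..<H}. (\<Sum>p\<in>I s. X p * Y (p + s)) * \<gamma> s)"
    by (simp add: sum_distrib_right)
  also have "\<bar>\<dots>\<bar> \<le> (\<Sum>s\<in>{-H'..<H}. ((e + bad s) * real (card (I s))) * \<gamma> s)"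
  proof (rule order_trans[OF sum_abs sum_mono])
    fix s
    have "0 \<le> \<gamma> s" using nonneg by (simp add: \<gamma>_def)
    then show "\<bar>(\<Sum>p\<in>I s. X p * Y (p + s)) * \<gamma> s\<bar> \<le> ((e + bad s) * real (card (I s))) * \<gamma> s"
      using inner[of s] by (simp add: abs_mult mult_right_mono)
  qed
  also have "\<dots> = (\<Sum>s\<in>{-H'..<H}. \<Sum>p\<in>I s. (e + bad s) * \<gamma> s)"
    by (intro sum.cong refl) simp
  also have "\<dots> = (\<Sum>p\<in>{0..<H'}. \<Sum>q\<in>{0..<H}. (e + bad (q - p)) * \<gamma> (q - p))"
    using sum_by_diagonals[OF H0, of "\<lambda>p s. (e + bad s) * \<gamma> s"] unfolding ifsum by simp
  also have "\<dots> \<le> (\<Sum>p\<in>{0..<H'}. \<Sum>q\<in>{0..<H}. e * c p q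
      + (if real_of_int H - d * real_of_int H < real_of_int q then c p q else 0)
      + (if real_of_int H' - d * real_of_int H < real_of_int p then c p q else 0))"
  proof (intro sum_mono)
    fix p q assume pq: "p \<in> {0..<H'}" "q \<in> {0..<H}"
    have "bad (q - p) * c p q \<le> (if real_of_int H - d * real_of_int H < real_of_int q then c p q else 0)
      + (if real_of_int H' - d * real_of_int H < real_of_int p then c p q else 0)"
      using overlap_small[of p H' q H d] pq H d nonneg[of p q] by (auto simp: bad_def I_def)
    then show "(e + bad (q - p)) * \<gamma> (q - p) \<le> e * c p q
      + (if real_of_int H - d * real_of_int H < real_of_int q then c p q else 0)
      + (if real_of_int H' - d * real_of_int H < real_of_int p then c p q else 0)"
      using c_eq[OF pq] by (simp add: distrib_right)
  qed
  also have "\<dots> = e * (\<Sum>p\<in>{0..<H'}. \<Sum>q\<in>{0..<H}. c p q)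
      + (\<Sum>q\<in>{0..<H}. if real_of_int H - d * real_of_int H < real_of_int q then (\<Sum>p\<in>{0..<H'}. c p q) else 0)
      + (\<Sum>p\<in>{0..<H'}. if real_of_int H' - d * real_of_int H < real_of_int p then (\<Sum>q\<in>{0..<H}. c p q) else 0)"
  proof -
    have "(\<Sum>p\<in>{0..<H'}. \<Sum>q\<in>{0..<H}. if real_of_int H - d * real_of_int H < real_of_int q then c p q else 0)
      = (\<Sum>q\<in>{0..<H}. if real_of_int H - d * real_of_int H < real_of_int q then (\<Sum>p\<in>{0..<H'}. c p q) else 0)"
      by (subst sum.swap) (intro sum.cong refl; simp)
    moreover have "(\<Sum>p\<in>{0..<H'}. \<Sum>q\<in>{0..<H}. if real_of_int H' - d * real_of_int H < real_of_int p then c p q else 0)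
      = (\<Sum>p\<in>{0..<H'}. if real_of_int H' - d * real_of_int H < real_of_int p then (\<Sum>q\<in>{0..<H}. c p q) else 0)"
      by (intro sum.cong refl) simp
    ultimately show ?thesis by (simp add: sum.distrib sum_distrib_left)
  qed
  also have "\<dots> \<le> e * 1 + d + d"
  proof (intro add_mono)
    have "(\<Sum>p\<in>{0..<H'}. \<Sum>q\<in>{0..<H}. c p q) \<le> (\<Sum>p\<in>{0..<H'}. 1 / real_of_int H')" by (intro sum_mono rows)
    also have "\<dots> = 1" using H by simp
    finally show "e * (\<Sum>p\<in>{0..<H'}. \<Sum>q\<in>{0..<H}. c p q) \<le> e * 1" using e by (intro mult_left_mono) auto
    have t: "0 \<le> d * real_of_int H" using d H by simp
    have "(\<Sum>q\<in>{0..<H}. if real_of_int H - d * real_of_int H < real_of_int q then (\<Sum>p\<in>{0..<H'}. c p q) else 0)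
        \<le> (\<Sum>q\<in>{0..<H}. if real_of_int H - d * real_of_int H < real_of_int q then 1 / real_of_int H else 0)"
      using cols by (intro sum_mono) auto
    also have "\<dots> = real (card {q \<in> {0..<H}. real_of_int H - d * real_of_int H < real_of_int q}) * (1 / real_of_int H)"
      by (simp add: sum.If_cases Int_def)
    also have "\<dots> \<le> (d * real_of_int H) * (1 / real_of_int H)"
      using card_upper_part[OF t, of H] H by (intro mult_right_mono) auto
    also have "\<dots> = d" using H by simp
    finally show "(\<Sum>q\<in>{0..<H}. if real_of_int H - d * real_of_int H < real_of_int q then (\<Sum>p\<in>{0..<H'}. c p q) else 0) \<le> d" .
    have "(\<Sum>p\<in>{0..<H'}. if real_of_int H' - d * real_of_int H < real_of_int p then (\<Sum>q\<in>{0..<H}. c p q) else 0)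
        \<le> (\<Sum>p\<in>{0..<H'}. if real_of_int H' - d * real_of_int H < real_of_int p then 1 / real_of_int H' else 0)"
      using rows by (intro sum_mono) auto
    also have "\<dots> = real (card {p \<in> {0..<H'}. real_of_int H' - d * real_of_int H < real_of_int p}) * (1 / real_of_int H')"
      by (simp add: sum.If_cases Int_def)
    also have "\<dots> \<le> (d * real_of_int H) * (1 / real_of_int H')"
      using card_upper_part[OF t, of H'] H by (intro mult_right_mono) auto
    also have "\<dots> \<le> (d * real_of_int H') * (1 / real_of_int H')"
      using d H by (intro mult_right_mono mult_left_mono) auto
    also have "\<dots> = d" using H by simp
    finally show "(\<Sum>p\<in>{0..<H'}. if real_of_int H' - d * real_of_int H < real_of_int p then (\<Sum>q\<in>{0..<H}. c p q) else 0) \<le> d" .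
  qed
  finally show ?thesis by simp
qed

section \<open>Joinings\<close>

locale staircase_joining =
  fixes h h' :: nat and \<nu> :: "(real \<times> real) measure"
  assumes h: "0 < h" "h < h'"
    and joining: "\<nu> \<in> joinings (SM h') (T h') (SM h) (T h)"
begin

lemma h': "0 < h'"
  using h by simp

lemma sets_joining: "sets \<nu> = sets (SM h' \<Otimes>\<^sub>M SM h)"
  and map_measurable: "map_prod (T h') (T h) \<in> measurable \<nu> \<nu>"
  and map_distr: "distr \<nu> \<nu> (map_prod (T h') (T h)) = \<nu>"
  and fst_distr: "distr \<nu> (SM h') fst = SM h'"
  and snd_distr: "distr \<nu> (SM h) snd = SM h"
  using joining by (auto simp: joinings_def)

lemma space_joining: "space \<nu> = {0..<mass h'} \<times> {0..<mass h}"
  using sets_eq_imp_space_eq[OF sets_joining] by (simp add: space_pair_measure space_SM)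

lemma fst_measurable: "fst \<in> measurable \<nu> (SM h')"
  using measurable_fst[of "SM h'" "SM h"] measurable_cong_sets[OF sets_joining refl] by blast

lemma snd_measurable: "snd \<in> measurable \<nu> (SM h)"
  using measurable_snd[of "SM h'" "SM h"] measurable_cong_sets[OF sets_joining refl] by blast

sublocale prob_space \<nu>
  by (rule prob_space_distrD[OF fst_measurable]) (simp add: fst_distr prob_space_SM)

lemma times_sets: "A \<in> sets (SM h') \<Longrightarrow> B \<in> sets (SM h) \<Longrightarrow> A \<times> B \<in> events"
  unfolding sets_joining by (rule pair_measureI)

lemma first_marginal: "A \<in> sets (SM h') \<Longrightarrow> prob (A \<times> {0..<mass h}) = measure (SM h') A"
proof -
  assume A: "A \<in> sets (SM h')"
  then have "fst -` A \<inter> space \<nu> = A \<times> {0..<mass h}"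
    by (auto simp: space_joining sets_SM_iff)
  then show ?thesis using measure_distr[OF fst_measurable A] by (simp add: fst_distr)
qed

lemma second_marginal: "B \<in> sets (SM h) \<Longrightarrow> prob ({0..<mass h'} \<times> B) = measure (SM h) B"
proof -
  assume B: "B \<in> sets (SM h)"
  then have "snd -` B \<inter> space \<nu> = {0..<mass h'} \<times> B"
    by (auto simp: space_joining sets_SM_iff)
  then show ?thesis using measure_distr[OF snd_measurable B] by (simp add: snd_distr)
qed

lemma full_sets: "{0..<mass h'} \<in> sets (SM h')" "{0..<mass h} \<in> sets (SM h)"
  by (simp_all add: sets_SM_iff)

text \<open>
  The preimage of the product of two levels contains the product of their predecessors. The difference
  projects to a null set in one of the factors, hence is null by the marginals.
\<close>

lemma diagonal_step:
  assumes J: "1 \<le> J" and p: "Suc p < ht h' J" and q: "Suc q < ht h J"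
  shows "prob (level h' J (Suc p) \<times> level h J (Suc q)) = prob (level h' J p \<times> level h J q)"
proof -
  let ?P = "T h' -` level h' J (Suc p) \<inter> space (SM h')" and ?Q = "T h -` level h J (Suc q) \<inter> space (SM h)"
  have s: "level h' J (Suc p) \<in> sets (SM h')" "level h' J p \<in> sets (SM h')"
    "level h J (Suc q) \<in> sets (SM h)" "level h J q \<in> sets (SM h)"
    using p q by (auto intro: level_sets[OF J])
  have PQ: "?P \<in> sets (SM h')" "?Q \<in> sets (SM h)"
    using s T_measurable[OF h'] T_measurable[OF h(1)] by (auto intro: measurable_sets)
  have pre: "map_prod (T h') (T h) -` (level h' J (Suc p) \<times> level h J (Suc q)) \<inter> space \<nu> = ?P \<times> ?Q"
    by (auto simp: space_joining space_SM)
  have "prob (level h' J (Suc p) \<times> level h J (Suc q)) = prob (?P \<times> ?Q)"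
    using measure_distr[OF map_measurable times_sets[OF s(1,3)]] unfolding map_distr pre .
  also have "\<dots> = prob (level h' J p \<times> level h J q)"
  proof (rule antisym)
    have ev: "level h' J p \<times> level h J q \<in> events" "(?P - level h' J p) \<times> {0..<mass h} \<in> events"
      "{0..<mass h'} \<times> (?Q - level h J q) \<in> events"
      using s PQ full_sets by (auto intro!: times_sets)
    have "prob (?P \<times> ?Q) \<le> prob ((level h' J p \<times> level h J q \<union> (?P - level h' J p) \<times> {0..<mass h})
        \<union> {0..<mass h'} \<times> (?Q - level h J q))"
      using ev by (intro finite_measure_mono) (auto simp: space_SM)
    also have "\<dots> \<le> prob (level h' J p \<times> level h J q) + prob ((?P - level h' J p) \<times> {0..<mass h})
        + prob ({0..<mass h'} \<times> (?Q - level h J q))"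
      using measure_Un_le[OF sets.Un[OF ev(1,2)] ev(3)] measure_Un_le[OF ev(1,2)] by linarith
    also have "prob ((?P - level h' J p) \<times> {0..<mass h}) = 0"
      using first_marginal[of "?P - level h' J p"] s PQ vimage_level_null[OF h' J p] by auto
    also have "prob ({0..<mass h'} \<times> (?Q - level h J q)) = 0"
      using second_marginal[of "?Q - level h J q"] s PQ vimage_level_null[OF h(1) J q] by auto
    finally show "prob (?P \<times> ?Q) \<le> prob (level h' J p \<times> level h J q)" by simp
    have "level h' J p \<subseteq> ?P" "level h J q \<subseteq> ?Q"
      using T_level[OF J p] T_level[OF J q] level_subset_space[OF J, of p h'] level_subset_space[OF J, of q h] p q
      by (auto simp: space_SM)
    then show "prob (level h' J p \<times> level h J q) \<le> prob (?P \<times> ?Q)"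
      using times_sets[OF PQ] by (intro finite_measure_mono) auto
  qed
  finally show ?thesis .
qed

lemma rectangle_sum:
  assumes J: "1 \<le> J" and U: "U \<subseteq> {..<ht h' J}" and V: "V \<subseteq> {..<ht h J}"
  shows "prob ((\<Union>p\<in>U. level h' J p) \<times> (\<Union>q\<in>V. level h J q))
    = (\<Sum>p\<in>U. \<Sum>q\<in>V. prob (level h' J p \<times> level h J q))"
proof -
  have fin: "finite U" "finite V" using U V by (auto intro: finite_subset)
  have "(\<Union>p\<in>U. level h' J p) \<times> (\<Union>q\<in>V. level h J q) = (\<Union>z\<in>U \<times> V. level h' J (fst z) \<times> level h J (snd z))"
    by auto
  also have "prob \<dots> = (\<Sum>z\<in>U \<times> V. prob (level h' J (fst z) \<times> level h J (snd z)))"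
  proof (rule finite_measure_finite_Union)
    show "(\<lambda>z. level h' J (fst z) \<times> level h J (snd z)) ` (U \<times> V) \<subseteq> events"
      using U V by (auto intro!: times_sets level_sets[OF J])
    show "disjoint_family_on (\<lambda>z. level h' J (fst z) \<times> level h J (snd z)) (U \<times> V)"
      unfolding disjoint_family_on_def
    proof (intro ballI impI)
      fix z w assume zw: "z \<in> U \<times> V" "w \<in> U \<times> V" "z \<noteq> w"
      show "(level h' J (fst z) \<times> level h J (snd z)) \<inter> (level h' J (fst w) \<times> level h J (snd w)) = {}"
      proof (rule ccontr)
        assume "\<not> ?thesis"
        then obtain x y where xy: "x \<in> level h' J (fst z)" "x \<in> level h' J (fst w)"
          "y \<in> level h J (snd z)" "y \<in> level h J (snd w)" by blast
        have "fst z = fst w" by (rule level_unique[OF J _ _ xy(1,2)]) (use zw U in auto)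
        moreover have "snd z = snd w" by (rule level_unique[OF J _ _ xy(3,4)]) (use zw V in auto)
        ultimately show False using zw(3) by (simp add: prod_eq_iff)
      qed
    qed
  qed (use fin in simp)
  also have "\<dots> = (\<Sum>p\<in>U. \<Sum>q\<in>V. prob (level h' J p \<times> level h J q))"
    by (simp add: sum.cartesian_product case_prod_beta)
  finally show ?thesis .
qed

lemma row_sum:
  assumes J: "1 \<le> J" and p: "p < ht h' J"
  shows "(\<Sum>q<ht h J. prob (level h' J p \<times> level h J q)) \<le> 1 / real (ht h' J)"
proof -
  have "(\<Sum>q<ht h J. prob (level h' J p \<times> level h J q)) = prob (level h' J p \<times> (\<Union>q<ht h J. level h J q))"
    using rectangle_sum[OF J, of "{p}" "{..<ht h J}"] p by simp
  also have "\<dots> \<le> prob (level h' J p \<times> {0..<mass h})"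
    using level_subset_space[OF J, of _ h] level_sets[OF J p] full_sets
    by (intro finite_measure_mono times_sets) auto
  also have "\<dots> = wd J / mass h'"
    using first_marginal[OF level_sets[OF J p]] measure_level[OF J p] by simp
  also have "\<dots> \<le> 1 / real (ht h' J)"
    using tower_mass_le[OF J, of h'] mass_pos[of h'] ht_pos[OF h' J] by (simp add: field_simps)
  finally show ?thesis .
qed

lemma column_sum:
  assumes J: "1 \<le> J" and q: "q < ht h J"
  shows "(\<Sum>p<ht h' J. prob (level h' J p \<times> level h J q)) \<le> 1 / real (ht h J)"
proof -
  have "(\<Sum>p<ht h' J. prob (level h' J p \<times> level h J q)) = prob ((\<Union>p<ht h' J. level h' J p) \<times> level h J q)"
    using rectangle_sum[OF J, of "{..<ht h' J}" "{q}"] q by simp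
  also have "\<dots> \<le> prob ({0..<mass h'} \<times> level h J q)"
    using level_subset_space[OF J, of _ h'] level_sets[OF J q] full_sets
    by (intro finite_measure_mono times_sets) auto
  also have "\<dots> = wd J / mass h"
    using second_marginal[OF level_sets[OF J q]] measure_level[OF J q] by simp
  also have "\<dots> \<le> 1 / real (ht h J)"
    using tower_mass_le[OF J, of h] mass_pos[of h] ht_pos[OF h(1) J] by (simp add: field_simps)
  finally show ?thesis .
qed

text \<open>
  Towers of stage \<open>J\<close> are fine enough to split both levels. The centring constant of the second word
  turns the sum over the rectangle of levels into the deviation from independence, up to the
  mass outside the tower.
\<close>

lemma independence_estimate:
  assumes a: "1 \<le> a" "k < ht h' a" and b: "1 \<le> b" "l < ht h b" and J: "a \<le> J" "b \<le> J"
    and d: "0 < d" "d < 1" and e: "0 < e"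
    and corr: "\<And>s. \<bar>\<Sum>p\<in>{0..<int (ht h' J)}. word h' (\<lambda>x. indicator (level h' a k) x - 0) J p
      * word h (\<lambda>x. indicator (level h b l) x - wd b / mass h) J (p + s)\<bar> \<le> e * d * real (ht h J)"
  shows "\<bar>prob (level h' a k \<times> level h b l) - measure (SM h') (level h' a k) * measure (SM h) (level h b l)\<bar>
    \<le> e + 2 * d + (1 - real (ht h J) * wd J / mass h)"
proof -
  let ?A = "level h' a k" and ?B = "level h b l" and ?\<beta> = "wd b / mass h"
  have J1: "1 \<le> J" using a J by simp
  define X where "X = word h' (\<lambda>x. indicator ?A x - 0) J"
  define Y where "Y = word h (\<lambda>x. indicator ?B x - ?\<beta>) J"
  define c where "c = (\<lambda>p q. prob (level h' J (nat p) \<times> level h J (nat q)))"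
  have \<beta>: "measure (SM h) ?B = ?\<beta>" "0 \<le> ?\<beta>" "?\<beta> \<le> 1"
    using measure_level[OF b] prob_space.prob_le_1[OF prob_space_SM, of h ?B] measure_nonneg[of "SM h" ?B] by simp_all
  have small: "\<bar>\<Sum>p\<in>{0..<int (ht h' J)}. \<Sum>q\<in>{0..<int (ht h J)}. X p * Y q * c p q\<bar> \<le> e + 2 * d"
  proof (rule diagonal_estimate[OF _ _ d e])
    show "0 < int (ht h J)" using ht_pos[OF h(1) J1] by simp
    show "int (ht h J) \<le> int (ht h' J)" using ht_mono_base[OF J1, of h h'] h by simp
    show "0 \<le> c p q" for p q by (simp add: c_def)
    show "c (p + 1) (q + 1) = c p q"
      if "0 \<le> p" "0 \<le> q" "p + 1 < int (ht h' J)" "q + 1 < int (ht h J)" for p q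
    proof -
      have "nat (p + 1) = Suc (nat p)" "nat (q + 1) = Suc (nat q)" using that by auto
      then show ?thesis using diagonal_step[OF J1, of "nat p" "nat q"] that unfolding c_def by simp
    qed
    show "(\<Sum>q\<in>{0..<int (ht h J)}. c p q) \<le> 1 / real_of_int (int (ht h' J))" if "p \<in> {0..<int (ht h' J)}" for p
    proof -
      have "nat p < ht h' J" using that by auto
      then show ?thesis using row_sum[OF J1, of "nat p"] unfolding sum_int_interval c_def by simp
    qed
    show "(\<Sum>p\<in>{0..<int (ht h' J)}. c p q) \<le> 1 / real_of_int (int (ht h J))" if "q \<in> {0..<int (ht h J)}" for q
    proof -
      have "nat q < ht h J" using that by auto
      then show ?thesis using column_sum[OF J1, of "nat q"] unfolding sum_int_interval c_def by simp
    qed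
    show "\<bar>X p\<bar> \<le> 1" for p by (simp add: X_def word_def indicator_def)
    have "\<bar>indicator A x - t\<bar> \<le> 1" if "0 \<le> t" "t \<le> 1" for A and x t :: real
      using that by (simp add: indicator_def)
    then show "\<bar>Y q\<bar> \<le> 1" for q using \<beta>(2,3) unfolding Y_def word_def by simp
    show "0 \<le> q \<and> q < int (ht h J)" if "Y q \<noteq> 0" for q
      using that by (simp add: Y_def word_def split: if_splits)
    show "\<bar>\<Sum>p\<in>{0..<int (ht h' J)}. X p * Y (p + s)\<bar> \<le> e * (d * real_of_int (int (ht h J)))" for s
      using corr[of s] by (simp add: X_def Y_def mult.assoc)
  qed
  define U where "U = {p. p < ht h' J \<and> lv h' J ! p \<in> ?A}"
  define V where "V = {q. q < ht h J \<and> lv h J ! q \<in> ?B}"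
  define f where "f = (\<lambda>p q. prob (level h' J p \<times> level h J q))"
  have UV: "U \<subseteq> {..<ht h' J}" "V \<subseteq> {..<ht h J}" by (auto simp: U_def V_def)
  have A_eq: "?A = (\<Union>p\<in>U. level h' J p)" unfolding U_def by (rule level_as_union[OF a J(1)])
  have B_eq: "?B = (\<Union>q\<in>V. level h J q)" unfolding V_def by (rule level_as_union[OF b J(2)])
  let ?tower = "\<Union>q<ht h J. level h J q"
  have AB: "prob (?A \<times> ?B) = (\<Sum>p\<in>U. \<Sum>q\<in>V. f p q)"
    using rectangle_sum[OF J1 UV] unfolding A_eq[symmetric] B_eq[symmetric] f_def .
  have At: "prob (?A \<times> ?tower) = (\<Sum>p\<in>U. \<Sum>q<ht h J. f p q)"
    using rectangle_sum[OF J1 UV(1) subset_refl] unfolding A_eq[symmetric] f_def .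
  have "(\<Sum>p\<in>{0..<int (ht h' J)}. \<Sum>q\<in>{0..<int (ht h J)}. X p * Y q * c p q)
      = (\<Sum>p<ht h' J. \<Sum>q<ht h J. indicator ?A (lv h' J ! p) * (indicator ?B (lv h J ! q) - ?\<beta>) * f p q)"
    unfolding sum_int_interval by (intro sum.cong refl) (simp add: X_def Y_def c_def f_def word_def)
  also have "\<dots> = (\<Sum>p<ht h' J. if p \<in> U then (\<Sum>q<ht h J. (if q \<in> V then f p q else 0) - ?\<beta> * f p q) else 0)"
    by (intro sum.cong refl) (auto simp: U_def V_def indicator_def algebra_simps intro!: sum.cong)
  also have "\<dots> = (\<Sum>p\<in>U. \<Sum>q<ht h J. (if q \<in> V then f p q else 0) - ?\<beta> * f p q)"
    using UV by (intro sum.mono_neutral_cong_right) auto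
  also have "\<dots> = (\<Sum>p\<in>U. (\<Sum>q\<in>V. f p q) - ?\<beta> * (\<Sum>q<ht h J. f p q))"
  proof (intro sum.cong refl)
    fix p
    have "(\<Sum>q<ht h J. if q \<in> V then f p q else 0) = (\<Sum>q\<in>V. f p q)"
      using UV by (intro sum.mono_neutral_cong_right) auto
    then show "(\<Sum>q<ht h J. (if q \<in> V then f p q else 0) - ?\<beta> * f p q) = (\<Sum>q\<in>V. f p q) - ?\<beta> * (\<Sum>q<ht h J. f p q)"
      by (simp add: sum_subtractf sum_distrib_left)
  qed
  also have "\<dots> = prob (?A \<times> ?B) - ?\<beta> * prob (?A \<times> ?tower)"
    unfolding AB At by (simp add: sum_subtractf sum_distrib_left)
  finally have main: "\<bar>prob (?A \<times> ?B) - ?\<beta> * prob (?A \<times> ?tower)\<bar> \<le> e + 2 * d" using small by simp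
  have As: "?A \<in> sets (SM h')" by (rule level_sets[OF a])
  have ts: "?tower \<in> sets (SM h)" using level_sets[OF J1, of _ h] by auto
  have tm: "measure (SM h) ?tower = real (ht h J) * wd J / mass h"
    unfolding Union_levels[OF J1] by (rule measure_tower[OF J1])
  have "prob (?A \<times> {0..<mass h}) - prob (?A \<times> ?tower) = prob (?A \<times> {0..<mass h} - ?A \<times> ?tower)"
    using As ts full_sets sets.sets_into_space[OF ts]
    by (intro finite_measure_Diff[symmetric] times_sets Sigma_mono) (auto simp: space_SM)
  also have "\<dots> \<le> prob ({0..<mass h'} \<times> ({0..<mass h} - ?tower))"
    using As ts full_sets sets.sets_into_space[OF As]
    by (intro finite_measure_mono times_sets) (auto simp: space_SM)
  also have "\<dots> = measure (SM h) ({0..<mass h} - ?tower)"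
    using ts full_sets by (intro second_marginal) auto
  also have "\<dots> = 1 - real (ht h J) * wd J / mass h"
    using prob_space.prob_compl[OF prob_space_SM ts] tm by (simp add: space_SM)
  finally have up: "measure (SM h') ?A - prob (?A \<times> ?tower) \<le> 1 - real (ht h J) * wd J / mass h"
    using first_marginal[OF As] by simp
  have low: "0 \<le> measure (SM h') ?A - prob (?A \<times> ?tower)"
  proof -
    have "prob (?A \<times> ?tower) \<le> prob (?A \<times> {0..<mass h})"
      using As full_sets sets.sets_into_space[OF ts]
      by (intro finite_measure_mono times_sets Sigma_mono) (auto simp: space_SM)
    then show ?thesis using first_marginal[OF As] by simp
  qed
  have "?\<beta> * (measure (SM h') ?A - prob (?A \<times> ?tower)) \<le> 1 * (1 - real (ht h J) * wd J / mass h)"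
    using \<beta> up low by (intro mult_mono) auto
  moreover have "0 \<le> ?\<beta> * (measure (SM h') ?A - prob (?A \<times> ?tower))" using \<beta>(2) low by (rule mult_nonneg_nonneg)
  moreover have "?\<beta> * (measure (SM h') ?A - prob (?A \<times> ?tower))
      = measure (SM h') ?A * ?\<beta> - ?\<beta> * prob (?A \<times> ?tower)" by (simp add: right_diff_distrib mult.commute)
  moreover have "\<bar>x - y\<bar> \<le> E + r"
    if "z \<le> 1 * r" "0 \<le> z" "z = y - w" "\<bar>x - w\<bar> \<le> E" for x y z w E r :: real
    using that by linarith
  ultimately show ?thesis using main unfolding \<beta>(1) by blast
qed

lemma independent_levels:
  assumes a: "1 \<le> a" "k < ht h' a" and b: "1 \<le> b" "l < ht h b"
  shows "prob (level h' a k \<times> level h b l) = measure (SM h') (level h' a k) * measure (SM h) (level h b l)"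
proof -
  let ?D = "\<bar>prob (level h' a k \<times> level h b l) - measure (SM h') (level h' a k) * measure (SM h) (level h b l)\<bar>"
  define m where "m = max a b"
  have X: "staircase_word h' m (word h' (\<lambda>x. indicator (level h' a k) x - 0))"
  proof (rule staircase_word_word[OF h'])
    show "level_function h' m (\<lambda>x. indicator (level h' a k) x - 0)"
      by (rule level_function_mono[OF _ a(1) level_function_indicator[OF a]]) (simp add: m_def)
  qed (use a in \<open>auto simp: m_def indicator_def\<close>)
  have Y: "balanced_word h m (word h (\<lambda>x. indicator (level h b l) x - wd b / mass h))"
    by (rule balanced_word_word[OF h(1) b]) (simp add: m_def)
  have est: "?D \<le> 3 * d" if d: "0 < d" "d < 1" for d
  proof -
    have "(\<lambda>J. 3 * d + (1 - real (ht h J) * wd J / mass h)) \<longlonglongrightarrow> 3 * d + (1 - mass h / mass h)"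
      using mass_pos[of h] by (intro tendsto_intros tower_mass_tendsto) auto
    then have lim: "(\<lambda>J. 3 * d + (1 - real (ht h J) * wd J / mass h)) \<longlonglongrightarrow> 3 * d"
      using mass_pos[of h] by simp
    have "\<forall>\<^sub>F J in sequentially. ?D \<le> 3 * d + (1 - real (ht h J) * wd J / mass h)"
      using cross_correlation[OF X Y _ mult_pos_pos[OF d(1) d(1)], OF less_imp_neq[OF h(2)]]
        eventually_ge_at_top[of m]
    proof eventually_elim
      case (elim J)
      then show ?case
        using independence_estimate[OF a b, of J d d] d by (simp add: m_def)
    qed
    then show ?thesis by (intro tendsto_lowerbound[OF lim]) simp_all
  qed
  have "?D \<le> 0"
  proof (rule field_le_epsilon)
    fix e :: real assume e: "0 < e"
    have "?D \<le> 3 * min (e / 3) (1 / 2)" using e by (intro est) auto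
    also have "\<dots> \<le> 0 + e" by simp
    finally show "?D \<le> 0 + e" .
  qed
  then show ?thesis by simp
qed

lemma joining_eq_product: "\<nu> = SM h' \<Otimes>\<^sub>M SM h"
proof -
  interpret M': prob_space "SM h'" by (rule prob_space_SM)
  interpret M: prob_space "SM h" by (rule prob_space_SM)
  let ?\<Omega> = "{0..<mass h'} \<times> {0..<mass h}"
  let ?E = "{A \<times> B |A B. A \<in> levels h' \<and> B \<in> levels h}"
  have sub: "levels h' \<subseteq> sets (SM h')" "levels h \<subseteq> sets (SM h)"
    using level_sets by (auto simp: levels_def sets_SM_iff)
  have gen: "sets (SM h' \<Otimes>\<^sub>M SM h) = sets (sigma ?\<Omega> ?E)"
    using sets_pair_eq[of "levels h'" "SM h'" "{{0..<mass h'}}" "levels h" "SM h" "{{0..<mass h}}"]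
      levels_subset sets_SM_levels by (simp add: space_SM levels_def)
  have Epow: "?E \<subseteq> Pow ?\<Omega>" using levels_subset by blast
  then have gen': "sets (SM h' \<Otimes>\<^sub>M SM h) = sigma_sets ?\<Omega> ?E" using gen by (simp add: sets_measure_of)
  show ?thesis
  proof (rule measure_eqI_generator_eq[where A = "\<lambda>_. ?\<Omega>"])
    show "Int_stable ?E"
    proof (rule Int_stableI)
      fix P Q assume "P \<in> ?E" "Q \<in> ?E"
      then obtain A B A' B' where *: "P = A \<times> B" "Q = A' \<times> B'" "A \<in> levels h'" "A' \<in> levels h'" "B \<in> levels h" "B' \<in> levels h"
        by blast
      then have "P \<inter> Q = (A \<inter> A') \<times> (B \<inter> B')" by blast
      moreover have "A \<inter> A' \<in> levels h'" "B \<inter> B' \<in> levels h"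
        using * Int_stable_levels unfolding Int_stable_def by blast+
      ultimately show "P \<inter> Q \<in> ?E" by blast
    qed
    show "?E \<subseteq> Pow ?\<Omega>" by (rule Epow)
    show "sets \<nu> = sigma_sets ?\<Omega> ?E" unfolding sets_joining by (rule gen')
    show "sets (SM h' \<Otimes>\<^sub>M SM h) = sigma_sets ?\<Omega> ?E" by (rule gen')
    show "range (\<lambda>_. ?\<Omega>) \<subseteq> ?E" by (auto simp: levels_def)
    show "emeasure \<nu> ?\<Omega> \<noteq> \<infinity>" by simp
    fix P assume "P \<in> ?E"
    then obtain A B where P: "P = A \<times> B" and AB: "A \<in> levels h'" "B \<in> levels h" by blast
    have AB': "A \<in> sets (SM h')" "B \<in> sets (SM h)" using AB sub by auto
    have full: "measure (SM h') {0..<mass h'} = 1" "measure (SM h) {0..<mass h} = 1"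
      using M'.prob_space M.prob_space by (simp_all add: space_SM)
    have "prob (A \<times> B) = measure (SM h') A * measure (SM h) B"
    proof -
      consider "A = {} \<or> B = {}" | "A = {0..<mass h'}" | "B = {0..<mass h}"
        | a k b l where "A = level h' a k" "1 \<le> a" "k < ht h' a" "B = level h b l" "1 \<le> b" "l < ht h b"
        using AB unfolding levels_def by blast
      then show ?thesis
      proof cases
        case 1
        then show ?thesis by auto
      next
        case 2
        then show ?thesis using second_marginal[OF AB'(2)] full by simp
      next
        case 3
        then show ?thesis using first_marginal[OF AB'(1)] full by simp
      next
        case 4
        then show ?thesis using independent_levels by simp
      qed
    qed
    moreover have "emeasure (SM h' \<Otimes>\<^sub>M SM h) (A \<times> B) = emeasure (SM h') A * emeasure (SM h) B"
      using AB' by (rule M.emeasure_pair_measure_Times)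
    ultimately show "emeasure \<nu> P = emeasure (SM h' \<Otimes>\<^sub>M SM h) P"
      unfolding P emeasure_eq_measure M'.emeasure_eq_measure M.emeasure_eq_measure
      by (simp add: ennreal_mult)
  qed simp
qed

end

lemma product_is_joining:
  assumes "0 < h" "0 < h'"
  shows "SM h' \<Otimes>\<^sub>M SM h \<in> joinings (SM h') (T h') (SM h) (T h)"
proof -
  interpret M': prob_space "SM h'" by (rule prob_space_SM)
  interpret M: prob_space "SM h" by (rule prob_space_SM)
  let ?P = "SM h' \<Otimes>\<^sub>M SM h"
  note T' = T_measurable[OF assms(2)] and T = T_measurable[OF assms(1)]
  have map_eq: "map_prod (T h') (T h) = (\<lambda>(x, y). (T h' x, T h y))" by auto
  have meas: "map_prod (T h') (T h) \<in> measurable ?P ?P"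
    unfolding map_eq using T' T by measurable
  have "distr (SM h') (SM h') (T h') \<Otimes>\<^sub>M distr (SM h) (SM h) (T h) = distr ?P ?P (map_prod (T h') (T h))"
    unfolding map_eq
    by (rule pair_measure_distr[OF T' T]) (simp add: distr_T[OF assms(1)] M.sigma_finite_measure_axioms)
  then have inv: "distr ?P ?P (map_prod (T h') (T h)) = ?P"
    by (simp add: distr_T assms)
  have "distr ?P (SM h) snd = SM h"
  proof (rule measure_eqI)
    fix B assume "B \<in> sets (distr ?P (SM h) snd)"
    then have B: "B \<in> sets (SM h)" by simp
    have "emeasure (distr ?P (SM h) snd) B = emeasure ?P (snd -` B \<inter> space ?P)"
      by (rule emeasure_distr[OF measurable_snd B])
    also have "snd -` B \<inter> space ?P = space (SM h') \<times> B"
      using sets.sets_into_space[OF B] by (auto simp: space_pair_measure)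
    also have "emeasure ?P \<dots> = emeasure (SM h') (space (SM h')) * emeasure (SM h) B"
      by (rule M.emeasure_pair_measure_Times[OF sets.top B])
    finally show "emeasure (distr ?P (SM h) snd) B = emeasure (SM h) B" by (simp add: M'.emeasure_space_1)
  qed simp
  then show ?thesis using meas inv M.distr_pair_fst by (simp add: joinings_def)
qed

theorem mainTheorem3:
  fixes h h' :: nat
  assumes "0 < h" and "h < h'"
  shows "disjoint_systems
           (staircase_measure h' (\<lambda>j. j)) (staircase_map h' (\<lambda>j. j))
           (staircase_measure h (\<lambda>j. j)) (staircase_map h (\<lambda>j. j))"
  unfolding disjoint_systems_def
proof (rule equalityI)
  show "joinings (SM h') (T h') (SM h) (T h) \<subseteq> {SM h' \<Otimes>\<^sub>M SM h}"
  proof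
    fix \<nu> assume "\<nu> \<in> joinings (SM h') (T h') (SM h) (T h)"
    then interpret staircase_joining h h' \<nu> using assms by unfold_locales
    show "\<nu> \<in> {SM h' \<Otimes>\<^sub>M SM h}" using joining_eq_product by simp
  qed
  show "{SM h' \<Otimes>\<^sub>M SM h} \<subseteq> joinings (SM h') (T h') (SM h) (T h)"
    using product_is_joining[of h h'] assms by simp
qed

end
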